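(* Let $n\ge 3$ be an integer and let $k=2$ or $k=n-2$. Let $I\subseteq\mathbb{R}$ be an interval (open or closed) and let $$y^{(n)}+p_1(x)y^{(n-1)}+\dots+p_n(x)y=0$$ be a linear homogeneous differential equation with real-valued continuous coefficients $p_i$ on $I$ which is disconjugate on $I$. Then for any $k$-tuple $(y_1,\dots,y_k)$ of linearly independent (real) solutions, the number of zeros in $I$, counted with multiplicity, of the function $\det W(y_1(x),\dots,y_k(x))$ does not exceed $k(n-k)$.
   Context: The equation of order $n$ is called disconjugate on $I$ if every nontrivial solution has at most $n-1$ zeros on $I$, counted with multiplicity. For functions $y_1,\dots,y_k$, $W(y_1(x),\dots,y_k(x))$ denotes the $k\times k$ Wronskian matrix whose $i$-th row is $(y_i(x),y_i'(x),\dots,y_i^{(k-1)}(x))$. *)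

theory Defs
  imports "HOL-Analysis.Analysis" "HOL-Library.Extended_Nat" "Jordan_Normal_Form.Determinant"
begin

hide_const (open) Determinants.det

(* The derivative is taken within I, i.e. it is one-sided at an end point belonging to I. *)
definition iter_deriv :: "real set \<Rightarrow> nat \<Rightarrow> (real \<Rightarrow> real) \<Rightarrow> real \<Rightarrow> real" where
  "iter_deriv I j = ((\<lambda>f x. vector_derivative f (at x within I)) ^^ j)"

(* y^(n) + p_1 y^(n-1) + ... + p_n y = 0 on I *)
definition is_solution ::
  "nat \<Rightarrow> (nat \<Rightarrow> real \<Rightarrow> real) \<Rightarrow> real set \<Rightarrow> (real \<Rightarrow> real) \<Rightarrow> bool" where
  "is_solution n p I y \<longleftrightarrow>
     (\<forall>j<n. iter_deriv I j y differentiable_on I) \<and>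
     (\<forall>x\<in>I. iter_deriv I n y x + (\<Sum>i=1..n. p i x * iter_deriv I (n - i) y x) = 0)"

(* x is a zero of f of multiplicity at least m. For f that is m times differentiable on I this says
   f(x) = f'(x) = ... = f^(m-1)(x) = 0, see vanishes_to_order_iff_derivs below. The formulation by
   the rate of vanishing is needed because, for merely continuous coefficients p_i, the Wronskian
   determinant of k solutions is in general only n - k + 1 times differentiable, whereas its zeros
   may have orders up to k (n - k). *)
definition vanishes_to_order :: "real set \<Rightarrow> (real \<Rightarrow> real) \<Rightarrow> real \<Rightarrow> nat \<Rightarrow> bool" where
  "vanishes_to_order I f x m \<longleftrightarrow>
     m = 0 \<or> (f x = 0 \<and> ((\<lambda>t. f t / (t - x) ^ (m - 1)) \<longlongrightarrow> 0) (at x within I))"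

definition zero_mult :: "real set \<Rightarrow> (real \<Rightarrow> real) \<Rightarrow> real \<Rightarrow> enat" where
  "zero_mult I f x = (SUP m\<in>{m. vanishes_to_order I f x m}. enat m)"

(* Number of zeros in I counted with multiplicity; points with f x \<noteq> 0 contribute 0. *)
definition zero_count :: "real set \<Rightarrow> (real \<Rightarrow> real) \<Rightarrow> enat" where
  "zero_count I f = (SUP F\<in>{F. finite F \<and> F \<subseteq> I}. \<Sum>x\<in>F. zero_mult I f x)"

definition disconjugate :: "nat \<Rightarrow> (nat \<Rightarrow> real \<Rightarrow> real) \<Rightarrow> real set \<Rightarrow> bool" where
  "disconjugate n p I \<longleftrightarrow>
     (\<forall>y. is_solution n p I y \<and> (\<exists>x\<in>I. y x \<noteq> 0) \<longrightarrow> zero_count I y \<le> enat (n - 1))"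

definition lin_indep_on :: "real set \<Rightarrow> nat \<Rightarrow> (nat \<Rightarrow> real \<Rightarrow> real) \<Rightarrow> bool" where
  "lin_indep_on I k y \<longleftrightarrow>
     (\<forall>c. (\<forall>x\<in>I. (\<Sum>i<k. c i * y i x) = 0) \<longrightarrow> (\<forall>i<k. c i = 0))"

(* Rows are indexed from 0: the tuple (y_1, ..., y_k) is y 0, ..., y (k - 1). *)
definition wronskian_matrix ::
  "real set \<Rightarrow> nat \<Rightarrow> (nat \<Rightarrow> real \<Rightarrow> real) \<Rightarrow> real \<Rightarrow> real mat" where
  "wronskian_matrix I k y x = Matrix.mat k k (\<lambda>(i, j). iter_deriv I j (y i) x)"

lemma iter_deriv_0 [simp]: "iter_deriv I 0 f = f"
  by (simp add: iter_deriv_def)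

lemma iter_deriv_Suc: "iter_deriv I (Suc j) f x = vector_derivative (iter_deriv I j f) (at x within I)"
  by (simp add: iter_deriv_def)

lemma iter_deriv_Suc': "iter_deriv I (Suc j) f = iter_deriv I j (iter_deriv I (Suc 0) f)"
  by (simp add: iter_deriv_def funpow_Suc_right del: funpow.simps)

lemma iter_deriv_Suc_has_derivative:
  assumes "is_interval I" "interior I \<noteq> {}" "x \<in> I" "f differentiable_on I"
  shows "(f has_real_derivative iter_deriv I (Suc 0) f x) (at x within I)"
proof -
  have "f differentiable (at x within I)"
    using assms by (auto simp: differentiable_on_def)
  then show ?thesis
    by (simp add: iter_deriv_Suc vector_derivative_works[symmetric]
        has_real_derivative_iff_has_vector_derivative)
qed

lemma tendsto_quotient_from_deriv:
  fixes g :: "real \<Rightarrow> real"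
  assumes I: "is_interval I" "x \<in> I" and g0: "g x = 0"
    and der: "\<And>t. t \<in> I \<Longrightarrow> (g has_real_derivative g' t) (at t within I)"
    and lim: "((\<lambda>t. g' t / (t - x) ^ r) \<longlongrightarrow> L) (at x within I)"
    and gx: "r > 0 \<Longrightarrow> g' x = 0" "r = 0 \<Longrightarrow> g' x = L"
  shows "((\<lambda>t. g t / (t - x) ^ Suc r) \<longlongrightarrow> L / real (Suc r)) (at x within I)"
  unfolding tendsto_iff eventually_at
proof (intro allI impI)
  fix e :: real
  assume e: "e > 0"
  then have "eventually (\<lambda>t. dist (g' t / (t - x) ^ r) L < e/2) (at x within I)"
    using lim[unfolded tendsto_iff, rule_format, of "e/2"] by simp
  then obtain d where d: "d > 0"
    "\<And>t. t \<in> I \<Longrightarrow> t \<noteq> x \<Longrightarrow> dist t x < d \<Longrightarrow> \<bar>g' t / (t - x) ^ r - L\<bar> < e/2"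
    unfolding eventually_at dist_real_def by auto
  have main: "dist (g t / (t - x) ^ Suc r) (L / real (Suc r)) < e"
    if t: "t \<in> I" "t \<noteq> x" "dist t x < d" for t
  proof -
    let ?S = "closed_segment x t"
    let ?h = "\<lambda>s. g s - L / real (Suc r) * (s - x) ^ Suc r"
    have S: "?S \<subseteq> I"
      using I t by (meson closed_segment_subset is_interval_convex)
    have hd: "(?h has_field_derivative (g' s - L * (s - x) ^ r)) (at s within ?S)"
      if s: "s \<in> ?S" for s
    proof -
      have 1: "(g has_real_derivative g' s) (at s within ?S)"
        using der S s has_field_derivative_subset by blast
      have "((\<lambda>s. (s - x) ^ Suc r) has_real_derivative real (Suc r) * (s - x) ^ r) (at s within ?S)"
      proof -
        have "((\<lambda>s. s - x) has_real_derivative 1) (at s within ?S)"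
          by (auto intro!: derivative_eq_intros)
        from DERIV_power[OF this, where n = "Suc r"] show ?thesis
          by (simp del: power_Suc)
      qed
      from DERIV_diff[OF 1 DERIV_cmult[OF this, of "L / real (Suc r)"]]
      show ?thesis by (simp del: of_nat_Suc)
    qed
    have bd: "norm (g' s - L * (s - x) ^ r) \<le> e/2 * \<bar>t - x\<bar> ^ r" if s: "s \<in> ?S" for s
    proof (cases "s = x")
      case True
      then show ?thesis
        using gx e by (cases "r = 0") (auto simp: zero_power)
    next
      case False
      have le: "\<bar>s - x\<bar> \<le> \<bar>t - x\<bar>"
        using s by (auto simp: closed_segment_eq_real_ivl split: if_splits)
      then have "\<bar>g' s / (s - x) ^ r - L\<bar> < e/2"
        using d(2)[of s] S s t False by (auto simp: dist_real_def)
      moreover have "g' s - L * (s - x) ^ r = (g' s / (s - x) ^ r - L) * (s - x) ^ r"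
        using False by (simp add: field_simps)
      ultimately have "norm (g' s - L * (s - x) ^ r) \<le> e/2 * \<bar>s - x\<bar> ^ r"
        unfolding real_norm_def by (simp only: abs_mult power_abs) (intro mult_right_mono; simp)
      also have "\<dots> \<le> e/2 * \<bar>t - x\<bar> ^ r"
        using le e by (intro mult_left_mono power_mono) auto
      finally show ?thesis .
    qed
    have "norm (?h t - ?h x) \<le> e/2 * \<bar>t - x\<bar> ^ r * norm (t - x)"
      by (rule field_differentiable_bound[of ?S ?h "\<lambda>s. g' s - L * (s - x) ^ r"])
         (use hd bd in auto)
    then have "\<bar>?h t\<bar> \<le> e/2 * \<bar>t - x\<bar> ^ Suc r"
      using g0 by (simp add: mult_ac)
    moreover have "?h t = (g t / (t - x) ^ Suc r - L / real (Suc r)) * (t - x) ^ Suc r"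
      using t by (simp add: left_diff_distrib del: power_Suc of_nat_Suc)
    ultimately have "\<bar>g t / (t - x) ^ Suc r - L / real (Suc r)\<bar> * \<bar>t - x\<bar> ^ Suc r
        \<le> e/2 * \<bar>t - x\<bar> ^ Suc r"
      by (simp only: abs_mult power_abs)
    moreover have "\<bar>t - x\<bar> ^ Suc r > 0"
      using t by (intro zero_less_power) auto
    ultimately have "\<bar>g t / (t - x) ^ Suc r - L / real (Suc r)\<bar> \<le> e/2"
      by (rule mult_right_le_imp_le)
    then show ?thesis
      using e by (simp add: dist_real_def del: power_Suc of_nat_Suc)
  qed
  show "\<exists>d>0. \<forall>t\<in>I. t \<noteq> x \<and> dist t x < d \<longrightarrow>
      dist (g t / (t - x) ^ Suc r) (L / real (Suc r)) < e"
    using d(1) main by blast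
qed

lemma tendsto_quotient_iter_deriv:
  assumes I: "is_interval I" "interior I \<noteq> {}" "x \<in> I"
    and "\<And>j. j \<le> r \<Longrightarrow> iter_deriv I j f differentiable_on I"
    and "\<And>j. j < r \<Longrightarrow> iter_deriv I j f x = 0"
  shows "((\<lambda>t. f t / (t - x) ^ r) \<longlongrightarrow> iter_deriv I r f x / fact r) (at x within I)"
  using assms(4,5)
proof (induction r arbitrary: f)
  case 0
  have "f differentiable_on I"
    using "0.prems"(1)[of 0] by simp
  then have "continuous_on I f"
    by (rule differentiable_imp_continuous_on)
  then show ?case
    using I by (simp add: continuous_on_def)
next
  case (Suc r)
  let ?f' = "iter_deriv I (Suc 0) f"
  have lim: "((\<lambda>t. ?f' t / (t - x) ^ r) \<longlongrightarrow> iter_deriv I r ?f' x / fact r) (at x within I)"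
  proof (rule Suc.IH)
    show "iter_deriv I j ?f' differentiable_on I" if "j \<le> r" for j
      using Suc.prems(1)[of "Suc j"] that by (simp flip: iter_deriv_Suc')
    show "iter_deriv I j ?f' x = 0" if "j < r" for j
      using Suc.prems(2)[of "Suc j"] that by (simp flip: iter_deriv_Suc')
  qed
  have "((\<lambda>t. f t / (t - x) ^ Suc r) \<longlongrightarrow> iter_deriv I r ?f' x / fact r / real (Suc r))
      (at x within I)"
  proof (rule tendsto_quotient_from_deriv[OF I(1,3) _ _ lim])
    show "f x = 0"
      using Suc.prems(2)[of 0] by simp
    show "(f has_real_derivative ?f' t) (at t within I)" if "t \<in> I" for t
      using Suc.prems(1)[of 0] that I by (intro iter_deriv_Suc_has_derivative) auto
    show "?f' x = 0" if "r > 0"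
      using Suc.prems(2)[of "Suc 0"] that by simp
    show "?f' x = iter_deriv I r ?f' x / fact r" if "r = 0"
      using that by simp
  qed
  then show ?case
    by (simp add: iter_deriv_Suc'[symmetric] mult_ac del: power_Suc)
qed

lemma vanishes_to_order_iff_derivs:
  assumes I: "is_interval I" "interior I \<noteq> {}" "x \<in> I"
    and diff: "\<And>j. j < m \<Longrightarrow> iter_deriv I j f differentiable_on I"
  shows "vanishes_to_order I f x m \<longleftrightarrow> (\<forall>j<m. iter_deriv I j f x = 0)"
proof
  assume v: "vanishes_to_order I f x m"
  show "\<forall>j<m. iter_deriv I j f x = 0"
  proof (intro allI impI)
    fix j
    assume "j < m"
    then show "iter_deriv I j f x = 0"
    proof (induction j rule: less_induct)
      case (less j)
      have nb: "at x within I \<noteq> bot"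
      proof -
        obtain a where a: "a \<in> I" "a \<noteq> x"
          using I by (metis ex_in_conv interior_singleton is_singletonI' is_singleton_the_elem)
        have "x islimpt I"
          using I a by (intro connected_imp_perfect) (auto simp: is_interval_connected)
        then show ?thesis
          by (simp add: trivial_limit_within)
      qed
      have 1: "((\<lambda>t. f t / (t - x) ^ j) \<longlongrightarrow> iter_deriv I j f x / fact j) (at x within I)"
        using less diff by (intro tendsto_quotient_iter_deriv[OF I]) auto
      have "((\<lambda>t. f t / (t - x) ^ (m - 1)) \<longlongrightarrow> 0) (at x within I)"
        using v less.prems by (auto simp: vanishes_to_order_def)
      moreover have "((\<lambda>t. (t - x) ^ (m - 1 - j)) \<longlongrightarrow> (x - x) ^ (m - 1 - j)) (at x within I)"
        by (intro tendsto_intros)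
      ultimately have "((\<lambda>t. f t / (t - x) ^ (m - 1) * (t - x) ^ (m - 1 - j)) \<longlongrightarrow> 0 * (x - x) ^ (m - 1 - j))
          (at x within I)"
        by (rule tendsto_mult)
      moreover have "f t / (t - x) ^ (m - 1) * (t - x) ^ (m - 1 - j) = f t / (t - x) ^ j"
        if "t \<noteq> x" for t
      proof -
        have "(t - x) ^ (m - 1) = (t - x) ^ j * (t - x) ^ (m - 1 - j)"
          using less.prems by (simp flip: power_add)
        then show ?thesis
          using that by simp
      qed
      ultimately have "((\<lambda>t. f t / (t - x) ^ j) \<longlongrightarrow> 0) (at x within I)"
        by (auto elim!: Lim_transform_within[where d = 1])
      then have "iter_deriv I j f x / fact j = 0"
        using tendsto_unique[OF nb 1] by blast
      then show ?case
        by simp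
    qed
  qed
next
  assume z: "\<forall>j<m. iter_deriv I j f x = 0"
  show "vanishes_to_order I f x m"
  proof (cases m)
    case 0
    then show ?thesis
      by (simp add: vanishes_to_order_def)
  next
    case (Suc r)
    have "((\<lambda>t. f t / (t - x) ^ r) \<longlongrightarrow> iter_deriv I r f x / fact r) (at x within I)"
      using z diff Suc by (intro tendsto_quotient_iter_deriv[OF I]) auto
    moreover have "f x = 0"
      using z Suc by (metis iter_deriv_0 zero_less_Suc)
    ultimately show ?thesis
      using z Suc by (simp add: vanishes_to_order_def)
  qed
qed

end

theory Submission imports Defs begin

text \<open>The zeros are counted by a sign change argument for curves in the group of lower unipotent matrices.

Take finitely many points of \<open>I\<close> and a segment \<open>[c, d] \<subseteq> I\<close> that contains them. For \<open>e > d\<close> close to \<open>d\<close>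
let \<open>u\<^sub>i\<close> be the solution whose Taylor data at \<open>d\<close> are those of \<open>(t - e)\<^bsup>n-1-i\<^esup>\<close>. A combination of
\<open>u\<^sub>0, \<dots>, u\<^bsub>j-1\<^esub>\<close> then has, so to speak, \<open>n - j\<close> zeros at \<open>e\<close>, and disconjugacy leaves room for at most \<open>j - 1\<close>
zeros at a point of the segment (\<open>chebyshev_basis\<close>). Hence all Wronskians of initial pieces of this basis
are free of zeros on \<open>[c, d]\<close>, and dividing and differentiating in turn (Polya's factorization, \<open>quasi_derivatives\<close>)
turns the basis into a curve \<open>\<Gamma>\<close> of unipotent matrices whose columns satisfy \<open>\<gamma>\<^sub>i' = \<rho>\<^sub>i \<gamma>\<^bsub>i+1\<^esub>\<close> with \<open>\<rho>\<^sub>i > 0\<close>; such a curve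
is called a \<open>flow\<close>. The derivatives of a solution with coordinate row \<open>f\<close> are triangular combinations, with positive
diagonal, of the entries of \<open>f \<Gamma>\<close> (\<open>solution_frame\<close>). Therefore the Wronskian of \<open>k\<close> solutions is a positive function
times the minor of \<open>A \<Gamma>\<close> formed by the first \<open>k\<close> columns, where \<open>A\<close> is the constant matrix of their coordinates.

For \<open>k = 2\<close> this minor is the determinant \<open>v\<^sub>0 \<and> v\<^sub>1\<close> of the first two of the plane vectors \<open>v\<^sub>i = A \<gamma>\<^sub>i\<close>, the leading wedge. For
\<open>k = n - 2\<close> it is, by Jacobi's identity, a constant times the complementary minor of order two of the inverse
(\<open>complementary_minor\<close>), and the rows of \<open>\<Gamma>\<^sup>-\<^sup>1\<close>, in reverse order and with alternating signs, are again a flow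
(\<open>dual_flow\<close>). So both cases follow from one bound: the leading wedge of a flow has at most \<open>2 (n - 2)\<close> zeros
(\<open>flow_zeros_bound\<close>).

The reason for that bound is that each \<open>v\<^sub>i\<close> is always pulled towards \<open>v\<^bsub>i+1\<^esub>\<close>, and \<open>v\<^bsub>n-1\<^esub>\<close> is at rest. Going down from
\<open>i = n - 1\<close>, each vector can make at most two more turns than the next one, where turns are counted so that every
change of sign of \<open>v\<^sub>0 \<and> v\<^sub>1\<close> costs one. To make this precise, the flow is replaced by a sequence of elementary steps
\<open>v\<^sub>i \<mapsto> v\<^sub>i + a v\<^bsub>i+1\<^esub>\<close>, \<open>a > 0\<close>: the matrices \<open>\<Gamma>(s)\<^sup>-\<^sup>1 \<Gamma>(t)\<close>, \<open>s < t\<close>, are totally positive (\<open>flow_tot_pos_mat\<close>) and therefore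
products of such steps (\<open>tot_pos_mat_step_product\<close>), and after a small perturbation of \<open>A\<close> all vectors involved
are in general position (\<open>generic_perturbation\<close>). Then the count is a finite combinatorial statement
(\<open>sign_changes_bound_with_bases\<close>), proved by an integer potential, the height, that only depends on signs of determinants.

A multiple zero at \<open>x\<close> is read off from the vectors at \<open>x\<close>: if \<open>v\<^sub>a\<close> is the first nonzero one and \<open>v\<^sub>b\<close> the first one that
is not parallel to it, the order is \<open>a + b - 1\<close> (\<open>wedge_leading\<close>). It is turned into \<open>a + b - 1\<close> changes of sign
by a detour through nearby matrices, which still consists of totally positive factors (\<open>split_zero\<close>).\<close>


section \<open>Signs of determinants of plane vectors\<close>

definition wedge :: "real \<times> real \<Rightarrow> real \<times> real \<Rightarrow> real" where
  "wedge x y = fst x * snd y - snd x * fst y"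

lemma wedge_simps [simp]:
  "wedge x x = 0" "wedge (x + y) z = wedge x z + wedge y z"
  "wedge z (x + y) = wedge z x + wedge z y"
  "wedge (x - y) z = wedge x z - wedge y z"
  "wedge z (x - y) = wedge z x - wedge z y"
  "wedge (r *\<^sub>R x) z = r * wedge x z" "wedge z (r *\<^sub>R x) = r * wedge z x"
  "wedge (- x) z = - wedge x z" "wedge z (- x) = - wedge z x"
  "wedge 0 z = 0" "wedge z 0 = 0"
  by (auto simp: wedge_def algebra_simps)

lemma wedge_commute: "wedge x y = - wedge y x"
  by (simp add: wedge_def)

lemma pluecker: "wedge a b * wedge c d - wedge a c * wedge b d + wedge a d * wedge b c = 0"
  by (simp add: wedge_def algebra_simps)

text \<open>The potential of the counting argument. It is attached to neighbours \<open>P\<close>, \<open>Q\<close> that carry reference vectors \<open>u\<close>, \<open>w\<close>, former values of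
\<open>P\<close> and \<open>Q\<close> up to a factor; an argument such as \<open>uP\<close> tells whether \<open>wedge u P\<close> is positive. The values are chosen such that
the four estimates below hold for each sign pattern that the Pluecker relations permit.\<close>

definition sign_height :: "bool \<Rightarrow> bool \<Rightarrow> bool \<Rightarrow> bool \<Rightarrow> bool \<Rightarrow> bool \<Rightarrow> int" where
  "sign_height uP wQ PQ uQ uw Pw =
    (if uP = PQ then
       (if wQ = PQ then (if uw = PQ then 0 else if uQ = PQ then 2 else - 2)
        else (if uQ = PQ then 1 else - 1))
     else
       (if wQ = PQ then (if Pw = PQ then - 1 else 1)
        else (if uw = PQ \<and> Pw \<noteq> PQ then - 2 else 0)))"

text \<open>The three terms of \<open>pluecker\<close> add up to zero, so they cannot all have the same sign.\<close>

definition pluecker_signs :: "bool \<Rightarrow> bool \<Rightarrow> bool \<Rightarrow> bool \<Rightarrow> bool \<Rightarrow> bool \<Rightarrow> bool" where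
  "pluecker_signs ab cd ac bd ad bc \<longleftrightarrow> \<not> ((ab = cd) = (ac \<noteq> bd) \<and> (ac \<noteq> bd) = (ad = bc))"

lemma pluecker_signs_wedge:
  assumes "wedge a b \<noteq> 0" "wedge c d \<noteq> 0" "wedge a c \<noteq> 0" "wedge b d \<noteq> 0" "wedge a d \<noteq> 0" "wedge b c \<noteq> 0"
  shows "pluecker_signs (wedge a b > 0) (wedge c d > 0) (wedge a c > 0) (wedge b d > 0) (wedge a d > 0) (wedge b c > 0)"
proof -
  let ?x = "wedge a b * wedge c d" and ?y = "wedge a c * wedge b d" and ?z = "wedge a d * wedge b c"
  have pos: "(x * y > 0) = ((x > 0) = (y > 0))" and neg: "(x * y < 0) = ((x > 0) \<noteq> (y > 0))"
    if "x \<noteq> 0" "y \<noteq> 0" for x y :: real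
    using that by (auto simp: zero_less_mult_iff mult_less_0_iff)
  have "?x - ?y + ?z = 0" "?x \<noteq> 0" "?y \<noteq> 0" "?z \<noteq> 0"
    using assms pluecker[of a b c d] by simp_all
  then have "\<not> ((?x > 0) = (?y < 0) \<and> (?y < 0) = (?z > 0))"
    by linarith
  then show ?thesis
    unfolding pluecker_signs_def pos[OF assms(1,2)] neg[OF assms(3,4)] pos[OF assms(5,6)] .
qed

lemma sign_height_Q_step_fold:
  assumes "pluecker_signs uP QR uQ PQ2 uQ2 PQ" "QR \<noteq> wQ"
  shows "sign_height uP wQ PQ uQ uw Pw \<le> 1 + sign_height uP QR PQ2 uQ2 uQ PQ"
  using assms unfolding sign_height_def pluecker_signs_def
  by (cases PQ; cases uP; cases wQ; cases uQ; simp; cases PQ2; simp; cases uQ2; simp; cases uw; simp)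

lemma sign_height_Q_step_stay:
  assumes "pluecker_signs uP QR uQ PQ2 uQ2 PQ" "pluecker_signs wQ PQ2 (\<not> Pw) QR wQ2 (\<not> PQ)"
    "pluecker_signs uQ wQ2 uw QR uQ2 (\<not> wQ)" "QR = wQ"
  shows "sign_height uP wQ PQ uQ uw Pw \<le> (if wQ2 = wQ then sign_height uP wQ2 PQ2 uQ2 uw Pw
     else 2 + sign_height uP (\<not> wQ2) PQ2 uQ2 (\<not> uw) (\<not> Pw))"
  using assms unfolding sign_height_def pluecker_signs_def
  by (cases PQ; cases uP; cases wQ; simp; cases uQ; simp; cases PQ2; simp; cases uw; simp; cases uQ2; simp; cases Pw; simp)

lemma sign_height_P_step_stay:
  assumes "pluecker_signs uP (\<not> wQ) uQ Pw uw PQ" "pluecker_signs uP2 (\<not> wQ) uQ Pw2 uw PQ"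
    "uP2 = uP \<or> uP2 = uQ" "Pw2 = Pw \<or> Pw2 = (\<not> wQ)" "uP = PQ"
  shows "(if uP2 = uP then sign_height uP wQ PQ uQ uw Pw \<le> sign_height uP2 wQ PQ uQ uw Pw2
     else 2 + sign_height uP wQ PQ uQ uw Pw \<le> sign_height (\<not> uP2) wQ PQ (\<not> uQ) (\<not> uw) Pw2)"
  using assms unfolding sign_height_def pluecker_signs_def
  by (cases PQ; cases uP; cases wQ; simp; cases uQ; simp; cases uw; simp; cases Pw; simp; cases Pw2; simp; cases uP2; simp)

lemma sign_height_P_step_fold:
  assumes "pluecker_signs uP (\<not> wQ) uQ Pw uw PQ" "pluecker_signs PQ (\<not> wQ) PQ Pw2 Pw PQ"
     "Pw2 = Pw \<or> Pw2 = (\<not> wQ)" "uP \<noteq> PQ"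
  shows "1 + sign_height uP wQ PQ uQ uw Pw \<le> sign_height PQ wQ PQ PQ Pw Pw2"
  using assms unfolding sign_height_def pluecker_signs_def
  by (cases PQ; cases uP; cases wQ; simp; cases uQ; simp; cases uw; simp; cases Pw; simp; cases Pw2; simp)

lemma sign_height_le_2: "sign_height uP wQ PQ uQ uw Pw \<le> 2"
  by (simp add: sign_height_def)

definition height :: "real \<times> real \<Rightarrow> real \<times> real \<Rightarrow> real \<times> real \<Rightarrow> real \<times> real \<Rightarrow> int" where
  "height P u Q w = sign_height (wedge u P > 0) (wedge w Q > 0) (wedge P Q > 0) (wedge u Q > 0) (wedge u w > 0) (wedge P w > 0)"

lemma wedge_pos_swap: "wedge a b \<noteq> 0 \<Longrightarrow> (wedge b a > 0) \<longleftrightarrow> \<not> (wedge a b > 0)"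
  by (auto simp: wedge_def mult.commute)

lemma wedge_nz_swap: "wedge a b \<noteq> 0 \<Longrightarrow> wedge b a \<noteq> 0"
  by (simp add: wedge_def mult.commute)

lemma pos_sum_cases:
  fixes x y a :: real
  assumes "a > 0" "x \<noteq> 0" "y \<noteq> 0" "x + a * y \<noteq> 0"
  shows "(x + a * y > 0) = (x > 0) \<or> (x + a * y > 0) = (y > 0)"
  using assms by (smt (verit) mult_pos_pos mult_pos_neg)

text \<open>\<open>P\<close> is pulled towards \<open>Q\<close>. If \<open>u, P\<close> and \<open>P, Q\<close> are oriented differently, then \<open>P\<close> now turns back, and it becomes its
own reference vector; otherwise the reference vector is kept, or negated when \<open>P\<close> passes the line through it. The
first event is counted once, the last one twice, and the height grows by at least this amount.\<close>

lemma height_P_step: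
  assumes nz: "wedge u P \<noteq> 0" "wedge w Q \<noteq> 0" "wedge P Q \<noteq> 0" "wedge u Q \<noteq> 0" "wedge u w \<noteq> 0" "wedge P w \<noteq> 0"
    and P': "P' = P + a *\<^sub>R Q" "a > 0" and nz': "wedge u P' \<noteq> 0" "wedge P' w \<noteq> 0"
  shows "(wedge u P > 0) \<noteq> (wedge P Q > 0) \<Longrightarrow> 1 + height P u Q w \<le> height P' P Q w"
    and "(wedge u P > 0) = (wedge P Q > 0) \<Longrightarrow> (wedge u P' > 0) = (wedge u P > 0) \<Longrightarrow> height P u Q w \<le> height P' u Q w"
    and "(wedge u P > 0) = (wedge P Q > 0) \<Longrightarrow> (wedge u P' > 0) \<noteq> (wedge u P > 0) \<Longrightarrow> 2 + height P u Q w \<le> height P' (- u) Q w"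
proof -
  have PQ': "wedge P' Q = wedge P Q" and PP': "wedge P P' = a * wedge P Q"
    using P' by auto
  have PP'p: "(wedge P P' > 0) = (wedge P Q > 0)" unfolding PP' using P'(2) by (simp add: zero_less_mult_iff)
  have PP'n: "wedge P P' \<noteq> 0" and PQn: "wedge P' Q \<noteq> 0" unfolding PP' PQ' using P'(2) nz(3) by auto
  have b0: "pluecker_signs (wedge u P > 0) (\<not> wedge w Q > 0) (wedge u Q > 0) (wedge P w > 0) (wedge u w > 0) (wedge P Q > 0)"
    using pluecker_signs_wedge[OF nz(1) wedge_nz_swap[OF nz(2)] nz(4,6,5,3)] unfolding wedge_pos_swap[OF nz(2)] .
  have c1: "(wedge u P' > 0) = (wedge u P > 0) \<or> (wedge u P' > 0) = (wedge u Q > 0)"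
    using pos_sum_cases[OF P'(2) nz(1,4) nz'(1)[unfolded P'(1) wedge_simps]] unfolding P'(1) wedge_simps .
  have c2: "(wedge P' w > 0) = (wedge P w > 0) \<or> (wedge P' w > 0) = (\<not> wedge w Q > 0)"
    using pos_sum_cases[OF P'(2) nz(6) wedge_nz_swap[OF nz(2)] nz'(2)[unfolded P'(1) wedge_simps]]
    unfolding P'(1) wedge_simps wedge_pos_swap[OF nz(2)] .
  show "1 + height P u Q w \<le> height P' P Q w" if "(wedge u P > 0) \<noteq> (wedge P Q > 0)"
  proof -
    have "pluecker_signs (wedge P Q > 0) (\<not> wedge w Q > 0) (wedge P Q > 0) (wedge P' w > 0) (wedge P w > 0) (wedge P Q > 0)"
      using pluecker_signs_wedge[OF PP'n wedge_nz_swap[OF nz(2)] nz(3) nz'(2) nz(6) PQn]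
      unfolding PP'p PQ' wedge_pos_swap[OF nz(2)] .
    from sign_height_P_step_fold[OF b0 this c2 that] show ?thesis
      unfolding height_def PP'p PQ' .
  qed
  have b1: "pluecker_signs (wedge u P' > 0) (\<not> wedge w Q > 0) (wedge u Q > 0) (wedge P' w > 0) (wedge u w > 0) (wedge P Q > 0)"
    using pluecker_signs_wedge[OF nz'(1) wedge_nz_swap[OF nz(2)] nz(4) nz'(2) nz(5) PQn] unfolding wedge_pos_swap[OF nz(2)] PQ' .
  have neg: "(wedge (- u) X > 0) = (\<not> wedge u X > 0)" if "wedge u X \<noteq> 0" for X unfolding wedge_simps neg_0_less_iff_less using that by linarith
  show "height P u Q w \<le> height P' u Q w" if "(wedge u P > 0) = (wedge P Q > 0)" "(wedge u P' > 0) = (wedge u P > 0)"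
    using sign_height_P_step_stay[OF b0 b1 c1 c2 that(1)] by (simp only: height_def PQ' that(2) if_True simp_thms)
  show "2 + height P u Q w \<le> height P' (-u) Q w" if "(wedge u P > 0) = (wedge P Q > 0)" "(wedge u P' > 0) \<noteq> (wedge u P > 0)"
    using sign_height_P_step_stay[OF b0 b1 c1 c2 that(1)] by (simp only: height_def PQ' neg[OF nz'(1)] neg[OF nz(4)] neg[OF nz(5)] that(2) if_False simp_thms)
qed

text \<open>When \<open>Q\<close> moves, the turns of \<open>Q\<close> are counted in the same way, and the height loses at most what this count gains.\<close>

lemma height_Q_step:
  assumes nz: "wedge u P \<noteq> 0" "wedge w Q \<noteq> 0" "wedge P Q \<noteq> 0" "wedge u Q \<noteq> 0" "wedge u w \<noteq> 0" "wedge P w \<noteq> 0"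
    and nz': "wedge Q Q' \<noteq> 0" "wedge P Q' \<noteq> 0" "wedge u Q' \<noteq> 0" "wedge w Q' \<noteq> 0"
  shows "(wedge w Q > 0) \<noteq> (wedge Q Q' > 0) \<Longrightarrow> height P u Q w \<le> 1 + height P u Q' Q"
    and "(wedge w Q > 0) = (wedge Q Q' > 0) \<Longrightarrow> (wedge w Q' > 0) = (wedge w Q > 0) \<Longrightarrow> height P u Q w \<le> height P u Q' w"
    and "(wedge w Q > 0) = (wedge Q Q' > 0) \<Longrightarrow> (wedge w Q' > 0) \<noteq> (wedge w Q > 0) \<Longrightarrow> height P u Q w \<le> 2 + height P u Q' (- w)"
proof -
  have b6: "pluecker_signs (wedge u P > 0) (wedge Q Q' > 0) (wedge u Q > 0) (wedge P Q' > 0) (wedge u Q' > 0) (wedge P Q > 0)"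
    using pluecker_signs_wedge[OF nz(1) nz'(1) nz(4) nz'(2,3) nz(3)] .
  have b7: "pluecker_signs (wedge w Q > 0) (wedge P Q' > 0) (\<not> wedge P w > 0) (wedge Q Q' > 0) (wedge w Q' > 0) (\<not> wedge P Q > 0)"
    using pluecker_signs_wedge[OF nz(2) nz'(2) wedge_nz_swap[OF nz(6)] nz'(1,4) wedge_nz_swap[OF nz(3)]]
    unfolding wedge_pos_swap[OF nz(6)] wedge_pos_swap[OF nz(3)] .
  have b8: "pluecker_signs (wedge u Q > 0) (wedge w Q' > 0) (wedge u w > 0) (wedge Q Q' > 0) (wedge u Q' > 0) (\<not> wedge w Q > 0)"
    using pluecker_signs_wedge[OF nz(4) nz'(4) nz(5) nz'(1,3) wedge_nz_swap[OF nz(2)]]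
    unfolding wedge_pos_swap[OF nz(2)] .
  show "height P u Q w \<le> 1 + height P u Q' Q" if "(wedge w Q > 0) \<noteq> (wedge Q Q' > 0)"
    using sign_height_Q_step_fold[OF b6, of "wedge w Q > 0" "wedge u w > 0" "wedge P w > 0"] that unfolding height_def by blast
  have neg: "(wedge (- w) X > 0) = (\<not> wedge w X > 0)" "(wedge X (-w) > 0) = (\<not> wedge X w > 0)" if "wedge w X \<noteq> 0" for X 
    unfolding wedge_simps neg_0_less_iff_less using that wedge_commute[of w X] by linarith+
  show "height P u Q w \<le> height P u Q' w" if "(wedge w Q > 0) = (wedge Q Q' > 0)" "(wedge w Q' > 0) = (wedge w Q > 0)"
    using sign_height_Q_step_stay[OF b6 b7 b8 that(1)[symmetric]] by (simp only: height_def that(2) if_True simp_thms)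
  show "height P u Q w \<le> 2 + height P u Q' (-w)" if "(wedge w Q > 0) = (wedge Q Q' > 0)" "(wedge w Q' > 0) \<noteq> (wedge w Q > 0)"
    using sign_height_Q_step_stay[OF b6 b7 b8 that(1)[symmetric]] 
    by (simp only: height_def neg(1)[OF nz'(4)] neg(2)[OF wedge_nz_swap[OF nz(5)]] neg(2)[OF wedge_nz_swap[OF nz(6)]] that(2) if_False simp_thms)
qed

section \<open>Sign changes along a walk of plane configurations\<close>

text \<open>The sign of \<open>V 0 \<and> V 1\<close> is only recorded when vector 0 is about to move, because this is where a turn of vector 0 is
noticed. Such a move does not alter the determinant.\<close>

primrec last_sign :: "(nat \<Rightarrow> nat) \<Rightarrow> (nat \<Rightarrow> nat \<Rightarrow> real \<times> real) \<Rightarrow> nat \<Rightarrow> bool" where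
  "last_sign \<iota> V 0 = (wedge (V 0 0) (V 0 1) > 0)"
| "last_sign \<iota> V (Suc s) = (if \<iota> s = 0 then wedge (V s 0) (V s 1) > 0 else last_sign \<iota> V s)"

primrec sign_changes :: "(nat \<Rightarrow> nat) \<Rightarrow> (nat \<Rightarrow> nat \<Rightarrow> real \<times> real) \<Rightarrow> nat \<Rightarrow> nat" where
  "sign_changes \<iota> V 0 = 0"
| "sign_changes \<iota> V (Suc s) = sign_changes \<iota> V s + (if last_sign \<iota> V (Suc s) \<noteq> last_sign \<iota> V s then 1 else 0)"

text \<open>The admissible reference vectors for index \<open>i\<close>: multiples of a value of the \<open>i\<close>-th vector that it has left in the meantime, or
of an artificial predecessor \<open>b i\<close> of its initial value.\<close>

inductive old_vector :: "(nat \<Rightarrow> nat \<Rightarrow> real \<times> real) \<Rightarrow> (nat \<Rightarrow> real \<times> real) \<Rightarrow> (nat \<Rightarrow> nat) \<Rightarrow>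
    nat \<Rightarrow> nat \<Rightarrow> real \<times> real \<Rightarrow> bool" for V b \<iota> where
  old: "c \<noteq> 0 \<Longrightarrow> s' \<le> t \<Longrightarrow> t < s \<Longrightarrow> \<iota> t = i \<Longrightarrow> old_vector V b \<iota> s i (c *\<^sub>R V s' i)"
| base: "c \<noteq> 0 \<Longrightarrow> old_vector V b \<iota> s i (c *\<^sub>R b i)"

lemma height_le_2: "height P u Q w \<le> 2"
  unfolding height_def by (rule sign_height_le_2)

lemma same_sign_add:
  fixes x y a :: real
  assumes "x \<noteq> 0" "y \<noteq> 0" "a > 0" "(x > 0) = (y > 0)"
  shows "(x + a * y > 0) = (x > 0)"
proof (cases "x > 0")
  case True
  then have "a * y > 0" using assms by simp
  then show ?thesis using True by simp
next
  case False
  then have "a * y < 0" using assms by (simp add: mult_less_0_iff)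
  then show ?thesis using False by simp
qed

text \<open>A counter \<open>k i\<close> for the turns of the \<open>i\<close>-th vector is carried along. The invariant says that it exceeds the counter of the
next vector at most by the height of the two, hence at most by 2. The counter of index \<open>n - 2\<close> stays 0, since the last
vector is at rest, and the counter of index 0 dominates the changes of sign. The hypotheses on \<open>V\<close> and \<open>b\<close>
state general position; those on the initial values say that \<open>b i\<close> looks like the \<open>i\<close>-th vector a moment before the start.\<close>

lemma sign_changes_bound_with_bases:
  fixes V :: "nat \<Rightarrow> nat \<Rightarrow> real \<times> real"
  assumes n: "n \<ge> 2"
    and step: "\<And>s. s < S \<Longrightarrow> \<iota> s < n - 1 \<and> \<alpha> s > 0 \<and>
        V (Suc s) = (V s)(\<iota> s := V s (\<iota> s) + \<alpha> s *\<^sub>R V s (Suc (\<iota> s)))"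
    and gen1: "\<And>s s' i j. s \<le> S \<Longrightarrow> s' \<le> S \<Longrightarrow> i < n \<Longrightarrow> j < n \<Longrightarrow> i \<noteq> j \<Longrightarrow> wedge (V s i) (V s' j) \<noteq> 0"
    and gen2: "\<And>s t s' i. s \<le> t \<Longrightarrow> t < s' \<Longrightarrow> s' \<le> S \<Longrightarrow> \<iota> t = i \<Longrightarrow> wedge (V s i) (V s' i) \<noteq> 0"
    and b1: "\<And>s i j. s \<le> S \<Longrightarrow> j < n \<Longrightarrow> i < n - 1 \<Longrightarrow> wedge (b i) (V s j) \<noteq> 0"
    and b2: "\<And>i. i < n - 2 \<Longrightarrow> wedge (b i) (b (Suc i)) \<noteq> 0"
    and i1: "\<And>i. i < n - 1 \<Longrightarrow> (wedge (b i) (V 0 i) > 0) = (wedge (V 0 i) (V 0 (Suc i)) > 0)"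
    and i2: "\<And>i. i < n - 1 \<Longrightarrow> (wedge (b i) (V 0 (Suc i)) > 0) = (wedge (V 0 i) (V 0 (Suc i)) > 0)"
    and i3: "\<And>i. i < n - 2 \<Longrightarrow> (wedge (V 0 i) (b (Suc i)) > 0) = (wedge (V 0 i) (V 0 (Suc i)) > 0)"
    and i4: "\<And>i. i < n - 2 \<Longrightarrow> (wedge (b i) (b (Suc i)) > 0) = (wedge (V 0 i) (V 0 (Suc i)) > 0)"
  shows "sign_changes \<iota> V S \<le> 2 * (n - 2)"
proof -
  let ?orig = "old_vector V b \<iota>"
  have nzA: "wedge u (V s' j) \<noteq> 0" if "?orig s i u" "s \<le> s'" "s' \<le> S" "i < n - 1" "j < n" for s i u s' j
    using that(1)
  proof cases
    case (old c s0 t)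
    then show ?thesis using gen1[of s0 s' i j] gen2[of s0 t s' i] that by (cases "i = j") simp_all
  next
    case (base c)
    then show ?thesis using b1[of s' j i] that by simp
  qed
  have nzB: "wedge u w \<noteq> 0" if o: "?orig s i u" "?orig s (Suc i) w" and S: "s \<le> S" and i: "i < n - 2" for s i u w
    using o(2)
  proof cases
    case w: (old c s0 t)
    have "wedge u (V s0 (Suc i)) \<noteq> 0"
      using o(1)
    proof cases
      case (old c' s1 t1)
      then show ?thesis using w gen1[of s1 s0 i "Suc i"] S i by simp
    next
      case (base c')
      then show ?thesis using w b1[of s0 "Suc i" i] S i by simp
    qed
    then show ?thesis using w by simp
  next
    case w: (base c)
    have "wedge u (b (Suc i)) \<noteq> 0"
      using o(1)
    proof cases
      case (old c' s1 t1)
      have "wedge (b (Suc i)) (V s1 i) \<noteq> 0" using b1[of s1 i "Suc i"] S i old by simp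
      from wedge_nz_swap[OF this] show ?thesis using old by simp
    next
      case (base c')
      then show ?thesis using b2[OF i] by simp
    qed
    then show ?thesis using w by simp
  qed
  have "\<exists>u k. (\<forall>i<n-1. ?orig s i (u i)) \<and>
      (\<forall>i<n-2. k i \<le> k (Suc i) + height (V s i) (u i) (V s (Suc i)) (u (Suc i))) \<and>
      k (n-2) = 0 \<and>
      (wedge (u (n-2)) (V s (n-2)) > 0) = (wedge (V s (n-2)) (V s (n-1)) > 0) \<and>
      (wedge (u (n-2)) (V s (n-1)) > 0) = (wedge (V s (n-2)) (V s (n-1)) > 0) \<and>
      int (sign_changes \<iota> V s) \<le> k 0 \<and> (wedge (u 0) (V s 0) > 0) = last_sign \<iota> V s"
    if "s \<le> S" for s
    using that
  proof (induction s)
    case 0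
    have "?orig 0 i (b i)" for i
      using old_vector.base[of 1 V b \<iota> 0 i] by simp
    moreover have "0 \<le> height (V 0 i) (b i) (V 0 (Suc i)) (b (Suc i))" if "i < n - 2" for i
      using i1[of i] i2[of i] i3[OF that] i4[OF that] that by (simp add: height_def sign_height_def)
    moreover have "Suc (n - 2) = n - 1" using n by simp
    ultimately show ?case
      using i1[of "n-2"] i2[of "n-2"] i1[of 0] n
      by (intro exI[of _ b] exI[of _ "\<lambda>_. 0"]) auto
  next
    case (Suc s)
    then obtain u k where o: "\<And>i. i < n-1 \<Longrightarrow> ?orig s i (u i)"
      and G1: "\<And>i. i < n-2 \<Longrightarrow> k i \<le> k (Suc i) + height (V s i) (u i) (V s (Suc i)) (u (Suc i))"
      and G2: "k (n-2) = 0" "(wedge (u (n-2)) (V s (n-2)) > 0) = (wedge (V s (n-2)) (V s (n-1)) > 0)"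
        "(wedge (u (n-2)) (V s (n-1)) > 0) = (wedge (V s (n-2)) (V s (n-1)) > 0)"
      and G3: "int (sign_changes \<iota> V s) \<le> k 0" "(wedge (u 0) (V s 0) > 0) = last_sign \<iota> V s"
      by auto
    define i where "i = \<iota> s"
    define a where "a = \<alpha> s"
    define P' where "P' = V s i + a *\<^sub>R V s (Suc i)"
    have i: "i < n - 1" and a: "a > 0" and V': "V (Suc s) = (V s)(i := P')"
      using step[of s] Suc.prems by (auto simp: i_def a_def P'_def)
    have V'i: "V (Suc s) i = P'" and V'j: "\<And>j. j \<noteq> i \<Longrightarrow> V (Suc s) j = V s j"
      using V' by auto
    \<comment> \<open>The vector turns back, or passes the line through its reference vector.\<close>
    define fold where "fold \<longleftrightarrow> (wedge (u i) (V s i) > 0) \<noteq> (wedge (V s i) (V s (Suc i)) > 0)"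
    define cross where "cross \<longleftrightarrow> (wedge (u i) P' > 0) \<noteq> (wedge (u i) (V s i) > 0)"
    define u' where "u' = u(i := if fold then V s i else if cross then - u i else u i)"
    define k' where "k' = k(i := k i + (if fold then 1 else if cross then 2 else 0))"
    have o_mono: "?orig (Suc s) j w" if "?orig s j w" for j w
      using that
    proof cases
      case (old c s' t)
      then show ?thesis using old_vector.old[of c s' t "Suc s" \<iota> j V b] by simp
    next
      case (base c)
      then show ?thesis using old_vector.base[of c V b \<iota> "Suc s" j] by simp
    qed
    have o_neg: "?orig (Suc s) j (- w)" if "?orig (Suc s) j w" for j w
      using that
    proof cases
      case (old c s' t)
      then show ?thesis using old_vector.old[of "-c" s' t "Suc s" \<iota> j V b] by simp
    next
      case (base c)
      then show ?thesis using old_vector.base[of "-c" V b \<iota> "Suc s" j] by simp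
    qed
    have o': "?orig (Suc s) j (u' j)" if "j < n - 1" for j
    proof (cases "j = i")
      case True
      have "?orig (Suc s) i (V s i)"
        using old_vector.old[of 1 s s "Suc s" \<iota> i V b] by (simp add: i_def)
      then show ?thesis
        using True o_mono[OF o[OF i]] o_neg by (auto simp: u'_def)
    next
      case False
      then show ?thesis using o_mono[OF o[OF that]] by (simp add: u'_def)
    qed
    note S = Suc.prems
    have vv: "wedge (V s j) (V s (Suc j)) \<noteq> 0" if "j < n - 1" for j
      using gen1[of s s j "Suc j"] that S by simp
    have PP': "wedge (V s i) P' = a * wedge (V s i) (V s (Suc i))"
      by (simp add: P'_def)
    have PP's: "(wedge (V s i) P' > 0) = (wedge (V s i) (V s (Suc i)) > 0)" "wedge (V s i) P' \<noteq> 0"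
      unfolding PP' using a vv[OF i] by (simp_all add: zero_less_mult_iff)
    have G1': "k' j \<le> k' (Suc j) + height (V (Suc s) j) (u' j) (V (Suc s) (Suc j)) (u' (Suc j))"
      if j: "j < n - 2" for j
    proof -
      have j1: "j < n - 1" "Suc j < n - 1" "j < n" "Suc j < n" using j by auto
      have sS: "s \<le> S" using S by simp
      have nz: "wedge (u j) (V s j) \<noteq> 0" "wedge (u (Suc j)) (V s (Suc j)) \<noteq> 0"
        "wedge (V s j) (V s (Suc j)) \<noteq> 0" "wedge (u j) (V s (Suc j)) \<noteq> 0"
        "wedge (u j) (u (Suc j)) \<noteq> 0" "wedge (V s j) (u (Suc j)) \<noteq> 0"
        using nzA[OF o[OF j1(1)] _ sS j1(1,3)] nzA[OF o[OF j1(2)] _ sS j1(2,4)]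
          vv[OF j1(1)] nzA[OF o[OF j1(1)] _ sS j1(1,4)] nzB[OF o[OF j1(1)] o[OF j1(2)] sS j]
          wedge_nz_swap[OF nzA[OF o[OF j1(2)] _ sS j1(2,3)]] by auto
      consider "j = i" | "Suc j = i" | "j \<noteq> i" "Suc j \<noteq> i" by blast
      then show ?thesis
      proof cases
        case 1
        have nz': "wedge (u j) P' \<noteq> 0" "wedge P' (u (Suc j)) \<noteq> 0"
          using nzA[OF o[OF j1(1)] _ S j1(1,3)] wedge_nz_swap[OF nzA[OF o[OF j1(2)] _ S j1(2,3)]] V'i 1 by auto
        have P'eq: "P' = V s j + a *\<^sub>R V s (Suc j)" using 1 by (simp add: P'_def)
        note st = height_P_step[OF nz P'eq a nz']
        have e: "V (Suc s) j = P'" "V (Suc s) (Suc j) = V s (Suc j)" "u' (Suc j) = u (Suc j)" "k' (Suc j) = k (Suc j)"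
          using 1 V'i V'j[of "Suc j"] by (simp_all add: u'_def k'_def)
        show ?thesis
        proof (cases fold)
          case True
          then show ?thesis using st(1) G1[OF j] 1 unfolding e by (simp add: u'_def k'_def fold_def)
        next
          case nf: False
          show ?thesis
          proof (cases cross)
            case True
            then show ?thesis using st(3) nf G1[OF j] 1 unfolding e by (simp add: u'_def k'_def fold_def cross_def)
          next
            case False
            then show ?thesis using st(2) nf G1[OF j] 1 unfolding e by (simp add: u'_def k'_def fold_def cross_def)
          qed
        qed
      next
        case 2
        have nz': "wedge (V s (Suc j)) P' \<noteq> 0" "wedge (V s j) P' \<noteq> 0" "wedge (u j) P' \<noteq> 0" "wedge (u (Suc j)) P' \<noteq> 0"
          using PP's(2) gen1[of s "Suc s" j i] nzA[OF o[OF j1(1)] _ S j1(1,4)] nzA[OF o[OF j1(2)] _ S j1(2,4)] V'i 2 j1 S by auto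
        note st = height_Q_step[OF nz nz']
        have e: "V (Suc s) (Suc j) = P'" "V (Suc s) j = V s j" "u' j = u j" "k' j = k j"
          using 2 V'i V'j[of j] by (auto simp: u'_def k'_def)
        have QQ: "(wedge (V s (Suc j)) P' > 0) = (wedge (V s (Suc j)) (V s (Suc (Suc j))) > 0)"
          using PP's(1) unfolding 2 .
        have c1: "fold \<longleftrightarrow> (wedge (u (Suc j)) (V s (Suc j)) > 0) \<noteq> (wedge (V s (Suc j)) P' > 0)"
          unfolding QQ unfolding fold_def 2 ..
        have c2: "cross \<longleftrightarrow> (wedge (u (Suc j)) P' > 0) \<noteq> (wedge (u (Suc j)) (V s (Suc j)) > 0)"
          unfolding cross_def 2 ..
        show ?thesis
        proof (cases fold)
          case True
          then have "height (V s j) (u j) (V s (Suc j)) (u (Suc j)) \<le> 1 + height (V s j) (u j) P' (V s (Suc j))"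
            using st(1) c1 by blast
          then show ?thesis using True G1[OF j] 2 unfolding e by (simp add: u'_def k'_def)
        next
          case nf: False
          show ?thesis
          proof (cases cross)
            case True
            then have "height (V s j) (u j) (V s (Suc j)) (u (Suc j)) \<le> 2 + height (V s j) (u j) P' (- u (Suc j))"
              using st(3) c1 c2 nf by blast
            then show ?thesis using True nf G1[OF j] 2 unfolding e by (simp add: u'_def k'_def)
          next
            case False
            then have "height (V s j) (u j) (V s (Suc j)) (u (Suc j)) \<le> height (V s j) (u j) P' (u (Suc j))"
              using st(2) c1 c2 nf by blast
            then show ?thesis using False nf G1[OF j] 2 unfolding e by (simp add: u'_def k'_def)
          qed
        qed
      next
        case 3
        then show ?thesis using G1[OF j] V'j by (simp add: u'_def k'_def)
      qed
    qed
    have n2: "n - 2 < n - 1" "Suc (n - 2) = n - 1" "n - 1 < n" "n - 2 < n" using n by auto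
    have sS: "s \<le> S" using S by simp
    \<comment> \<open>The vector of index \<open>n - 2\<close> is pulled towards a fixed target.\<close>
    have last: "\<not> fold \<and> \<not> cross" if "i = n - 2"
    proof -
      have f: "\<not> fold" using G2 that n2 by (simp add: fold_def)
      have "wedge (u i) P' = wedge (u i) (V s i) + a * wedge (u i) (V s (Suc i))" by (simp add: P'_def)
      moreover have "wedge (u i) (V s i) \<noteq> 0" "wedge (u i) (V s (Suc i)) \<noteq> 0"
        using nzA[OF o[OF i] _ sS i] i by auto
      ultimately have "\<not> cross"
        using same_sign_add[of "wedge (u i) (V s i)" "wedge (u i) (V s (Suc i))" a] G2 that n2 a
        by (simp add: cross_def)
      then show ?thesis using f by simp
    qed
    have G2': "k' (n-2) = 0" using G2(1) last by (auto simp: k'_def)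
    have u'l: "u' (n-2) = u (n-2)" using last by (auto simp: u'_def)
    have Vl: "V (Suc s) (n-1) = V s (n-1)" using i V'j by auto
    have Vl2: "wedge (V (Suc s) (n-2)) (V s (n-1)) = wedge (V s (n-2)) (V s (n-1))"
      using V'i V'j[of "n-2"] n2 by (cases "i = n-2") (auto simp: P'_def)
    have Vl3: "(wedge (u (n-2)) (V (Suc s) (n-2)) > 0) = (wedge (u (n-2)) (V s (n-2)) > 0)"
      using last V'i V'j[of "n-2"] by (cases "i = n-2") (auto simp: cross_def)
    \<comment> \<open>A change of sign is recorded exactly when vector 0 turns back.\<close>
    have G3': "int (sign_changes \<iota> V (Suc s)) \<le> k' 0 \<and> (wedge (u' 0) (V (Suc s) 0) > 0) = last_sign \<iota> V (Suc s)"
    proof (cases "i = 0")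
      case True
      then have ls: "last_sign \<iota> V (Suc s) = (wedge (V s i) (V s (Suc i)) > 0)" by (simp add: i_def)
      have f: "fold \<longleftrightarrow> last_sign \<iota> V (Suc s) \<noteq> last_sign \<iota> V s"
        using G3(2) True unfolding ls fold_def by auto
      have k0: "int (sign_changes \<iota> V (Suc s)) \<le> k' 0"
        using G3(1) f True by (auto simp: k'_def simp del: last_sign.simps)
      have uP: "wedge (u i) P' \<noteq> 0" using nzA[OF o[OF i] _ S i] i V'i by auto
      have "(wedge (u' i) P' > 0) = last_sign \<iota> V (Suc s)"
      proof (cases fold)
        case True
        then show ?thesis using PP's unfolding ls by (simp add: u'_def)
      next
        case nf: False
        have eq: "(wedge (u i) (V s i) > 0) = last_sign \<iota> V (Suc s)" using nf unfolding ls fold_def by simp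
        show ?thesis
        proof (cases cross)
          case True
          then have "(wedge (- u i) P' > 0) = (wedge (u i) (V s i) > 0)"
            using uP unfolding cross_def wedge_simps neg_0_less_iff_less by linarith
          then show ?thesis using eq nf True by (simp add: u'_def)
        next
          case False
          then show ?thesis using eq nf by (simp add: u'_def cross_def)
        qed
      qed
      then show ?thesis using k0 True V'i by simp
    next
      case False
      then have "last_sign \<iota> V (Suc s) = last_sign \<iota> V s" by (simp add: i_def)
      then show ?thesis using G3 False V'j[of 0] by (simp add: u'_def k'_def)
    qed
    have G2a: "(wedge (u' (n-2)) (V (Suc s) (n-2)) > 0) = (wedge (V (Suc s) (n-2)) (V (Suc s) (n-1)) > 0)"
      unfolding u'l Vl Vl2 Vl3 by (rule G2(2))
    have G2b: "(wedge (u' (n-2)) (V (Suc s) (n-1)) > 0) = (wedge (V (Suc s) (n-2)) (V (Suc s) (n-1)) > 0)"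
      unfolding u'l Vl Vl2 by (rule G2(3))
    show ?case
      by (rule exI[of _ u'], rule exI[of _ k'], intro conjI allI impI)
        (fact o' | fact G1' | fact G2' | fact G2a | fact G2b | fact G3'[THEN conjunct1] | fact G3'[THEN conjunct2])+
  qed
  from this[of S] obtain u k where G1: "\<And>i. i < n-2 \<Longrightarrow> k i \<le> k (Suc i) + height (V S i) (u i) (V S (Suc i)) (u (Suc i))"
      and G2: "k (n-2) = 0" and G3: "int (sign_changes \<iota> V S) \<le> k 0" by auto
  have "k (n - 2 - j) \<le> 2 * int j" if "j \<le> n - 2" for j
    using that
  proof (induction j)
    case 0
    then show ?case using G2 by simp
  next
    case (Suc j)
    have "k (n - 2 - Suc j) \<le> k (Suc (n - 2 - Suc j)) + 2"
      using G1[of "n - 2 - Suc j"] height_le_2 Suc.prems by (meson add_left_mono diff_less order_trans zero_less_Suc less_le_trans)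
    moreover have "Suc (n - 2 - Suc j) = n - 2 - j" using Suc.prems by simp
    ultimately show ?case using Suc by simp
  qed
  from this[of "n-2"] have "k 0 \<le> 2 * int (n - 2)" by simp
  then show ?thesis using G3 by simp
qed

section \<open>Plane images of the columns of unipotent matrices\<close>

definition pairing :: "nat \<Rightarrow> (nat \<Rightarrow> real) \<Rightarrow> (nat \<Rightarrow> real) \<Rightarrow> real" where
  "pairing n f c = (\<Sum>r<n. f r * c r)"

text \<open>A pair of row vectors, seen as a linear map from \<open>n\<close>-space to the plane.\<close>

definition plane_image :: "nat \<Rightarrow> (nat \<Rightarrow> real) \<times> (nat \<Rightarrow> real) \<Rightarrow> (nat \<Rightarrow> real) \<Rightarrow> real \<times> real" where
  "plane_image n A c = (pairing n (fst A) c, pairing n (snd A) c)"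

definition shear :: "(nat \<Rightarrow> real) \<times> (nat \<Rightarrow> real) \<Rightarrow> real \<Rightarrow> (nat \<Rightarrow> real) \<times> (nat \<Rightarrow> real) \<Rightarrow> (nat \<Rightarrow> real) \<times> (nat \<Rightarrow> real)" where
  "shear A e B = (\<lambda>r. fst A r + e * fst B r, \<lambda>r. snd A r + e * snd B r)"

lemma pairing_shear: "pairing n (\<lambda>r. f r + e * f' r) c = pairing n f c + e * pairing n f' c"
  by (simp add: pairing_def sum.distrib sum_distrib_left algebra_simps)

lemma plane_image_shear: "plane_image n (shear A e B) c = plane_image n A c + e *\<^sub>R plane_image n B c"
  by (simp add: plane_image_def shear_def pairing_shear)

lemma tendsto_wedge [tendsto_intros]:
  "(f \<longlongrightarrow> a) F \<Longrightarrow> (g \<longlongrightarrow> b) F \<Longrightarrow> ((\<lambda>x. wedge (f x) (g x)) \<longlongrightarrow> wedge a b) F"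
  unfolding wedge_def by (intro tendsto_intros)

lemma eventually_same_sign:
  fixes f :: "'a \<Rightarrow> real"
  assumes "(f \<longlongrightarrow> l) F" "l \<noteq> 0"
  shows "eventually (\<lambda>x. f x \<noteq> 0 \<and> (f x > 0) = (l > 0)) F"
proof (cases "l > 0")
  case True
  then show ?thesis using order_tendstoD(1)[OF assms(1), of 0] by (auto elim: eventually_mono)
next
  case False
  then have "l < 0" using assms(2) by simp
  then show ?thesis using order_tendstoD(2)[OF assms(1), of 0] by (auto elim: eventually_mono)
qed

lemma eventually_quadratic_nonzero:
  fixes w0 w1 w2 :: real
  assumes "w2 \<noteq> 0"
  shows "eventually (\<lambda>e. w0 + e * w1 + e * e * w2 \<noteq> 0) (at_right 0)"
proof -
  have pos: "eventually (\<lambda>e::real. e > 0) (at_right 0)"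
    by (simp add: eventually_at_right_less)
  show ?thesis
  proof (cases "w0 = 0")
    case False
    have "((\<lambda>e. w0 + e * w1 + e * e * w2) \<longlongrightarrow> w0 + 0 * w1 + 0 * 0 * w2) (at_right 0)"
      by (intro tendsto_intros)
    from eventually_same_sign[OF this] False show ?thesis by (auto elim: eventually_mono)
  next
    case w0: True
    show ?thesis
    proof (cases "w1 = 0")
      case False
      have "((\<lambda>e. w1 + e * w2) \<longlongrightarrow> w1 + 0 * w2) (at_right 0)"
        by (intro tendsto_intros)
      from eventually_same_sign[OF this] False have "eventually (\<lambda>e. w1 + e * w2 \<noteq> 0) (at_right 0)"
        by (auto elim: eventually_mono)
      from this pos show ?thesis
      proof eventually_elim
        case (elim e)
        then have "e * (w1 + e * w2) \<noteq> 0" by simp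
        then show ?case using w0 by (simp add: algebra_simps)
      qed
    next
      case True
      show ?thesis
        using pos by eventually_elim (use w0 True assms in simp)
    qed
  qed
qed

text \<open>Along the line from \<open>A\<close> in the direction of \<open>B\<close>, each determinant is a quadratic polynomial of the parameter. It is not the zero
polynomial for a suitable \<open>B\<close>, so it does not vanish for small positive parameters; the conditions that hold
already are open. This settles one pair of columns after the other.\<close>

lemma generic_perturbation:
  fixes A :: "(nat \<Rightarrow> real) \<times> (nat \<Rightarrow> real)"
  assumes "finite S" "finite Z"
    and good: "\<And>c c'. (c, c') \<in> S \<Longrightarrow> \<exists>B. wedge (plane_image n B c) (plane_image n B c') \<noteq> 0"
    and Z: "\<And>c c'. (c, c') \<in> Z \<Longrightarrow> wedge (plane_image n A c) (plane_image n A c') \<noteq> 0"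
  shows "\<exists>A'. (\<forall>(c, c')\<in>S. wedge (plane_image n A' c) (plane_image n A' c') \<noteq> 0) \<and>
     (\<forall>(c, c')\<in>Z. wedge (plane_image n A' c) (plane_image n A' c') \<noteq> 0 \<and>
        (wedge (plane_image n A' c) (plane_image n A' c') > 0) = (wedge (plane_image n A c) (plane_image n A c') > 0))"
  using assms(1) good
proof (induction S rule: finite_induct)
  case empty
  then show ?case using Z by (intro exI[of _ A]) auto
next
  case (insert p S)
  then obtain A1 where A1: "\<forall>(c, c')\<in>S. wedge (plane_image n A1 c) (plane_image n A1 c') \<noteq> 0"
    "\<forall>(c, c')\<in>Z. wedge (plane_image n A1 c) (plane_image n A1 c') \<noteq> 0 \<and>
        (wedge (plane_image n A1 c) (plane_image n A1 c') > 0) = (wedge (plane_image n A c) (plane_image n A c') > 0)"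
    by (metis (no_types, lifting) insertCI)
  obtain c0 c0' where p: "p = (c0, c0')" by (cases p)
  obtain B where B: "wedge (plane_image n B c0) (plane_image n B c0') \<noteq> 0"
    using insert.prems[of c0 c0'] p by auto
  let ?w = "\<lambda>e c c'. wedge (plane_image n (shear A1 e B) c) (plane_image n (shear A1 e B) c')"
  have lim: "((\<lambda>e. ?w e c c') \<longlongrightarrow> wedge (plane_image n A1 c + 0 *\<^sub>R plane_image n B c) (plane_image n A1 c' + 0 *\<^sub>R plane_image n B c')) (at_right 0)" for c c'
    unfolding plane_image_shear by (intro tendsto_intros)
  have ev: "eventually (\<lambda>e. ?w e c c' \<noteq> 0 \<and> (?w e c c' > 0) = (wedge (plane_image n A1 c) (plane_image n A1 c') > 0)) (at_right 0)"
    if "wedge (plane_image n A1 c) (plane_image n A1 c') \<noteq> 0" for c c'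
    using eventually_same_sign[OF lim] that by simp
  have "eventually (\<lambda>e. ?w e c0 c0' \<noteq> 0) (at_right 0)"
    using eventually_quadratic_nonzero[OF B, of "wedge (plane_image n A1 c0) (plane_image n A1 c0')"
        "wedge (plane_image n B c0) (plane_image n A1 c0') + wedge (plane_image n A1 c0) (plane_image n B c0')"]
    by (simp add: plane_image_shear algebra_simps)
  moreover have "eventually (\<lambda>e. \<forall>q\<in>S. ?w e (fst q) (snd q) \<noteq> 0) (at_right 0)"
    using insert.hyps(1)
  proof (rule eventually_ball_finite)
    show "\<forall>q\<in>S. eventually (\<lambda>e. ?w e (fst q) (snd q) \<noteq> 0) (at_right 0)"
    proof
      fix q assume "q \<in> S"
      then have "wedge (plane_image n A1 (fst q)) (plane_image n A1 (snd q)) \<noteq> 0" using A1(1) by (cases q) auto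
      from ev[OF this] show "eventually (\<lambda>e. ?w e (fst q) (snd q) \<noteq> 0) (at_right 0)"
        by (rule eventually_mono) simp
    qed
  qed
  moreover have "eventually (\<lambda>e. \<forall>q\<in>Z. ?w e (fst q) (snd q) \<noteq> 0 \<and>
      (?w e (fst q) (snd q) > 0) = (wedge (plane_image n A1 (fst q)) (plane_image n A1 (snd q)) > 0)) (at_right 0)"
    using assms(2)
  proof (rule eventually_ball_finite)
    show "\<forall>q\<in>Z. eventually (\<lambda>e. ?w e (fst q) (snd q) \<noteq> 0 \<and>
      (?w e (fst q) (snd q) > 0) = (wedge (plane_image n A1 (fst q)) (plane_image n A1 (snd q)) > 0)) (at_right 0)"
    proof
      fix q assume "q \<in> Z"
      then have "wedge (plane_image n A1 (fst q)) (plane_image n A1 (snd q)) \<noteq> 0" using A1(2) by (cases q) auto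
      from ev[OF this] show "eventually (\<lambda>e. ?w e (fst q) (snd q) \<noteq> 0 \<and>
      (?w e (fst q) (snd q) > 0) = (wedge (plane_image n A1 (fst q)) (plane_image n A1 (snd q)) > 0)) (at_right 0)" .
    qed
  qed
  ultimately have "eventually (\<lambda>e. ?w e c0 c0' \<noteq> 0 \<and> (\<forall>q\<in>S. ?w e (fst q) (snd q) \<noteq> 0) \<and>
     (\<forall>q\<in>Z. ?w e (fst q) (snd q) \<noteq> 0 \<and>
      (?w e (fst q) (snd q) > 0) = (wedge (plane_image n A1 (fst q)) (plane_image n A1 (snd q)) > 0))) (at_right 0)"
    by eventually_elim simp
  from eventually_happens'[OF _ this] obtain e where e: "?w e c0 c0' \<noteq> 0" "\<forall>q\<in>S. ?w e (fst q) (snd q) \<noteq> 0"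
     "\<forall>q\<in>Z. ?w e (fst q) (snd q) \<noteq> 0 \<and>
      (?w e (fst q) (snd q) > 0) = (wedge (plane_image n A1 (fst q)) (plane_image n A1 (snd q)) > 0)" by auto
  show ?case
  proof (rule exI[of _ "shear A1 e B"], intro conjI)
    show "\<forall>(c, c')\<in>insert p S. ?w e c c' \<noteq> 0" using e(1,2) p by auto
    show "\<forall>(c, c')\<in>Z. ?w e c c' \<noteq> 0 \<and> (?w e c c' > 0) = (wedge (plane_image n A c) (plane_image n A c') > 0)"
      using e(3) A1(2) by fastforce
  qed
qed

text \<open>Lower triangular with unit diagonal.\<close>

definition unipotent :: "nat \<Rightarrow> real mat \<Rightarrow> bool" where
  "unipotent n H \<longleftrightarrow> H \<in> carrier_mat n n \<and> (\<forall>r<n. H $$ (r, r) = 1) \<and> (\<forall>c<n. \<forall>r<c. H $$ (r, c) = 0)"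

text \<open>Multiplication by this matrix from the right adds \<open>a\<close> times column \<open>i + 1\<close> to column \<open>i\<close>.\<close>

definition elem_step :: "nat \<Rightarrow> nat \<Rightarrow> real \<Rightarrow> real mat" where
  "elem_step n i a = Matrix.mat n n (\<lambda>(r, c). if r = c then 1 else if c = i \<and> r = Suc i then a else 0)"

lemma elem_step_carrier [simp]: "elem_step n i a \<in> carrier_mat n n"
  by (simp add: elem_step_def)

lemma mult_index:
  assumes "A \<in> carrier_mat n n" "B \<in> carrier_mat n n" "r < n" "c < n"
  shows "(A * B) $$ (r, c) = (\<Sum>k<n. A $$ (r, k) * B $$ (k, c))"
  using assms by (simp add: scalar_prod_def lessThan_atLeast0)

lemma unipotent_elem_step: "unipotent n (elem_step n i a)"
  by (auto simp: unipotent_def elem_step_def)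

lemma unipotent_mult:
  assumes "unipotent n A" "unipotent n B"
  shows "unipotent n (A * B)"
proof -
  have c: "A \<in> carrier_mat n n" "B \<in> carrier_mat n n" using assms by (auto simp: unipotent_def)
  have z: "(A * B) $$ (r, s) = 0" if "r < s" "s < n" for r s
    unfolding mult_index[OF c less_trans[OF that] that(2)]
  proof (rule sum.neutral, rule ballI)
    fix k assume k: "k \<in> {..<n}"
    show "A $$ (r, k) * B $$ (k, s) = 0"
    proof (cases "r < k")
      case True then show ?thesis using assms k by (simp add: unipotent_def)
    next
      case False then show ?thesis using assms that by (simp add: unipotent_def)
    qed
  qed
  have d: "(A * B) $$ (r, r) = 1" if r: "r < n" for r
  proof -
    have "(\<Sum>k<n. A $$ (r, k) * B $$ (k, r)) = (\<Sum>k<n. if k = r then 1 else 0)"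
    proof (rule sum.cong[OF refl])
      fix k assume "k \<in> {..<n}"
      then show "A $$ (r, k) * B $$ (k, r) = (if k = r then 1 else 0)"
        using assms r unfolding unipotent_def by (cases k r rule: linorder_cases) auto
    qed
    also have "\<dots> = 1" using r by simp
    finally show ?thesis unfolding mult_index[OF c r r] .
  qed
  show ?thesis using c z d by (auto simp: unipotent_def)
qed

lemma mult_elem_step_index:
  assumes H: "H \<in> carrier_mat n n" and i: "Suc i < n" and rc: "r < n" "c < n"
  shows "(H * elem_step n i a) $$ (r, c) = H $$ (r, c) + (if c = i then a * H $$ (r, Suc i) else 0)"
proof -
  have "(\<Sum>k<n. H $$ (r, k) * elem_step n i a $$ (k, c)) =
     (\<Sum>k<n. (if k = c then H $$ (r, c) else 0) + (if k = Suc i then (if c = i then a * H $$ (r, Suc i) else 0) else 0))"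
    using rc by (intro sum.cong) (auto simp: elem_step_def)
  also have "\<dots> = H $$ (r, c) + (if c = i then a * H $$ (r, Suc i) else 0)"
    using rc i by (simp add: sum.distrib)
  finally show ?thesis using mult_index[OF H elem_step_carrier rc] by simp
qed

definition col_fun :: "real mat \<Rightarrow> nat \<Rightarrow> nat \<Rightarrow> real" where
  "col_fun H c r = H $$ (r, c)"

text \<open>The plane vectors \<open>v\<^sub>i\<close> of the introduction.\<close>

definition state :: "nat \<Rightarrow> (nat \<Rightarrow> real) \<times> (nat \<Rightarrow> real) \<Rightarrow> real mat \<Rightarrow> nat \<Rightarrow> real \<times> real" where
  "state n A H i = (if i < n then plane_image n A (col_fun H i) else 0)"

lemma state_mult_elem_step:
  assumes H: "H \<in> carrier_mat n n" and i: "Suc i < n"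
  shows "state n A (H * elem_step n i a) = (state n A H)(i := state n A H i + a *\<^sub>R state n A H (Suc i))"
proof
  fix c
  have p: "pairing n f (col_fun (H * elem_step n i a) c) =
     pairing n f (col_fun H c) + (if c = i then a * pairing n f (col_fun H (Suc i)) else 0)" if "c < n" for f
  proof -
    have "pairing n f (col_fun (H * elem_step n i a) c) =
       (\<Sum>r<n. f r * (H $$ (r, c) + (if c = i then a * H $$ (r, Suc i) else 0)))"
      unfolding pairing_def col_fun_def using mult_elem_step_index[OF H i _ that] by (intro sum.cong) auto
    then show ?thesis
      by (simp add: pairing_def col_fun_def sum.distrib sum_distrib_left algebra_simps)
  qed
  show "state n A (H * elem_step n i a) c = ((state n A H)(i := state n A H i + a *\<^sub>R state n A H (Suc i))) c"
    using i p Suc_lessD[OF i] by (cases "c = i") (auto simp: state_def plane_image_def)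
qed

definition walk :: "nat \<Rightarrow> real mat \<Rightarrow> (nat \<times> real) list \<Rightarrow> real mat" where
  "walk n H xs = foldl (\<lambda>H (i, a). H * elem_step n i a) H xs"

definition valid_steps :: "nat \<Rightarrow> (nat \<times> real) list \<Rightarrow> bool" where
  "valid_steps n xs \<longleftrightarrow> (\<forall>(i, a)\<in>set xs. Suc i < n \<and> a > 0)"

lemma walk_simps [simp]: "walk n H [] = H" "walk n H (xs @ ys) = walk n (walk n H xs) ys"
  "walk n H ((i, a) # xs) = walk n (H * elem_step n i a) xs"
  by (auto simp: walk_def)

lemma walk_unipotent: "unipotent n H \<Longrightarrow> unipotent n (walk n H xs)"
proof (induction xs arbitrary: H)
  case (Cons x xs)
  then show ?case by (cases x) (simp add: unipotent_mult unipotent_elem_step)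
qed simp

lemma walk_take_Suc:
  assumes "s < length xs"
  shows "walk n H (take (Suc s) xs) = walk n H (take s xs) * elem_step n (fst (xs ! s)) (snd (xs ! s))"
  using assms by (simp add: take_Suc_conv_app_nth walk_def split: prod.split)

text \<open>Columns of different index are told apart by their leading units, those of equal index by the entry below the diagonal.\<close>

lemma unipotent_columns_separated:
  assumes H: "unipotent n H" "unipotent n H'" and ij: "i < n" "j < n"
    and ne: "i \<noteq> j \<or> (Suc i < n \<and> H $$ (Suc i, i) \<noteq> H' $$ (Suc i, i))"
  shows "\<exists>B. wedge (plane_image n B (col_fun H i)) (plane_image n B (col_fun H' j)) \<noteq> 0"
proof -
  let ?e = "\<lambda>i r. if r = i then 1 else 0 :: real"
  have e: "pairing n (?e k) c = c k" if "k < n" for k c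
  proof -
    have "(\<Sum>r<n. ?e k r * c r) = (\<Sum>r<n. if r = k then c k else 0)"
      by (intro sum.cong) auto
    then show ?thesis using that by (simp add: pairing_def)
  qed
  have w: "wedge (plane_image n (?e k, ?e l) c) (plane_image n (?e k, ?e l) c') = c k * c' l - c l * c' k" if "k < n" "l < n" for k l c c'
    using that by (simp add: wedge_def plane_image_def e)
  consider "i < j" | "j < i" | "i = j" by linarith
  then show ?thesis
  proof cases
    case 1
    then show ?thesis using w[of i j "col_fun H i" "col_fun H' j"] H ij
      by (intro exI[of _ "(?e i, ?e j)"]) (auto simp: col_fun_def unipotent_def)
  next
    case 2
    then show ?thesis using w[of i j "col_fun H i" "col_fun H' j"] H ij
      by (intro exI[of _ "(?e i, ?e j)"]) (auto simp: col_fun_def unipotent_def)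
  next
    case 3
    then show ?thesis using w[of i "Suc i" "col_fun H i" "col_fun H' j"] H ij ne
      by (intro exI[of _ "(?e i, ?e (Suc i))"]) (auto simp: col_fun_def unipotent_def)
  qed
qed

fun changes :: "bool list \<Rightarrow> nat" where
  "changes (a # b # xs) = (if a \<noteq> b then 1 else 0) + changes (b # xs)"
| "changes xs = 0"

lemma changes_snoc: "xs \<noteq> [] \<Longrightarrow> changes (xs @ [b]) = changes xs + (if last xs \<noteq> b then 1 else 0)"
  by (induction xs rule: changes.induct) auto

lemma last_sign_sign_changes_cong:
  assumes "\<And>t. t < s \<Longrightarrow> \<iota> t = \<iota>' t" "\<And>t. t \<le> s \<Longrightarrow> V t = V' t"
  shows "last_sign \<iota> V s = last_sign \<iota>' V' s" "sign_changes \<iota> V s = sign_changes \<iota>' V' s"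
proof -
  have l: "last_sign \<iota> V t = last_sign \<iota>' V' t" if "t \<le> s" for t
    using that by (induction t) (simp_all add: assms)
  have c: "sign_changes \<iota> V t = sign_changes \<iota>' V' t" if "t \<le> s" for t
    using that
  proof (induction t)
    case (Suc t)
    then show ?case using l[of t] l[of "Suc t"] by (simp del: last_sign.simps)
  qed simp
  show "last_sign \<iota> V s = last_sign \<iota>' V' s" "sign_changes \<iota> V s = sign_changes \<iota>' V' s"
    using l c by auto
qed

lemma sign_changes_ge_change: "s \<le> s' \<Longrightarrow> sign_changes \<iota> V s + (if last_sign \<iota> V s \<noteq> last_sign \<iota> V s' then 1 else 0) \<le> sign_changes \<iota> V s'"
proof (induction s' rule: dec_induct)
  case base
  then show ?case by simp
next
  case (step m)
  have "sign_changes \<iota> V (Suc m) = sign_changes \<iota> V m + (if last_sign \<iota> V (Suc m) \<noteq> last_sign \<iota> V m then 1 else 0)" by simp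
  then show ?case using step.IH by (auto split: if_splits simp del: last_sign.simps sign_changes.simps)
qed

abbreviation walk_state where
  "walk_state n A H xs \<equiv> \<lambda>s. state n A (walk n H (take s xs))"

abbreviation step_index where
  "step_index xs \<equiv> \<lambda>s. fst (xs ! s)"

definition lead_wedge :: "nat \<Rightarrow> (nat \<Rightarrow> real) \<times> (nat \<Rightarrow> real) \<Rightarrow> real mat \<Rightarrow> real" where
  "lead_wedge n A H = wedge (state n A H 0) (state n A H 1)"

text \<open>A walk by elementary steps makes each subdiagonal entry grow whenever its column moves, so a column never
returns to an earlier value and the general position demanded here is attainable. The artificial predecessors of the initial vectors
are \<open>v\<^sub>i - e v\<^bsub>i+1\<^esub>\<close> for small \<open>e > 0\<close>.\<close>

lemma sign_changes_le_generic:
  fixes A :: "(nat \<Rightarrow> real) \<times> (nat \<Rightarrow> real)"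
  assumes n: "n \<ge> 2" and H: "unipotent n H" and v: "valid_steps n xs"
    and gen: "\<And>s s' i j. s \<le> length xs \<Longrightarrow> s' \<le> length xs \<Longrightarrow> i < n \<Longrightarrow> j < n \<Longrightarrow>
      i \<noteq> j \<or> (Suc i < n \<and> walk n H (take s xs) $$ (Suc i, i) \<noteq> walk n H (take s' xs) $$ (Suc i, i)) \<Longrightarrow>
      wedge (walk_state n A H xs s i) (walk_state n A H xs s' j) \<noteq> 0"
  shows "sign_changes (step_index xs) (walk_state n A H xs) (length xs) \<le> 2 * (n - 2)"
proof -
  let ?V = "walk_state n A H xs" and ?M = "\<lambda>s. walk n H (take s xs)"
  have M: "?M s \<in> carrier_mat n n" "unipotent n (?M s)" for s
    using walk_unipotent[OF H, of "take s xs"] by (auto simp: unipotent_def)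
  have vs: "Suc (fst (xs ! s)) < n" "snd (xs ! s) > 0" if "s < length xs" for s
    using v nth_mem[OF that] unfolding valid_steps_def split_beta by blast+
  have mono: "?M s $$ (Suc i, i) \<le> ?M (Suc s) $$ (Suc i, i)" if "s < length xs" "Suc i < n" for s i
    unfolding walk_take_Suc[OF that(1)]
    using mult_elem_step_index[OF M(1) vs(1)[OF that(1)], of "Suc i" i s] that vs[OF that(1)] M(2)[of s]
    by (auto simp: unipotent_def)
  have strict: "?M s $$ (Suc i, i) < ?M (Suc s) $$ (Suc i, i)" if "s < length xs" "fst (xs ! s) = i" for s i
    unfolding walk_take_Suc[OF that(1)]
    using mult_elem_step_index[OF M(1) vs(1)[OF that(1)], of "Suc i" i s] that vs[OF that(1)] M(2)[of s]
    by (auto simp: unipotent_def)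
  have mono': "?M s $$ (Suc i, i) \<le> ?M s' $$ (Suc i, i)" if "s \<le> s'" "s' \<le> length xs" "Suc i < n" for s s' i
    using that by (induction s' rule: dec_induct) (auto intro: order_trans[OF _ mono])
  have gen2: "wedge (?V s i) (?V s' i) \<noteq> 0"
    if "s \<le> t" "t < s'" "s' \<le> length xs" "fst (xs ! t) = i" for s t s' i
  proof -
    have i: "Suc i < n" using vs(1)[of t] that by auto
    have "?M s $$ (Suc i, i) \<le> ?M t $$ (Suc i, i)" "?M t $$ (Suc i, i) < ?M (Suc t) $$ (Suc i, i)"
      "?M (Suc t) $$ (Suc i, i) \<le> ?M s' $$ (Suc i, i)"
      using mono'[of s t i] strict[of t i] mono'[of "Suc t" s' i] that i by auto
    then show ?thesis using gen[of s s' i i] that i by auto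
  qed
  \<comment> \<open>A step of size \<open>e\<close> from this vector would lead to the initial one.\<close>
  let ?b = "\<lambda>e i. ?V 0 i - e *\<^sub>R ?V 0 (Suc i)"
  have g0: "wedge (?V 0 i) (?V 0 (Suc i)) \<noteq> 0" if "i < n - 1" for i
    using gen[of 0 0 i "Suc i"] that by auto
  have pos: "eventually (\<lambda>e::real. e > 0) (at_right 0)"
    by (simp add: eventually_at_right_less)
  have ev1: "eventually (\<lambda>e. \<forall>q\<in>{..length xs} \<times> {..<n} \<times> {..<n-1}. wedge (?b e (snd (snd q))) (?V (fst q) (fst (snd q))) \<noteq> 0) (at_right 0)"
  proof (rule eventually_ball_finite, simp, rule ballI)
    fix q assume q: "q \<in> {..length xs} \<times> {..<n} \<times> {..<n-1}"
    obtain s j i where q': "q = (s, j, i)" by (cases q)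
    then have a: "s \<in> {..length xs}" "j \<in> {..<n}" "i \<in> {..<n-1}" using q by auto
    have "eventually (\<lambda>e. wedge (?b e i) (?V s j) \<noteq> 0) (at_right 0)"
    proof (cases "j = i \<and> ?V s j = ?V 0 i")
      case True
      have "wedge (?b e i) (?V 0 i) = e * wedge (?V 0 i) (?V 0 (Suc i))" for e
        using wedge_commute[of "?V 0 (Suc i)" "?V 0 i"] by simp
      then have "wedge (?b e i) (?V s j) = e * wedge (?V 0 i) (?V 0 (Suc i))" for e
        using True by metis
      then show ?thesis using pos g0[of i] a by (auto elim: eventually_mono)
    next
      case False
      have "wedge (?V 0 i) (?V s j) \<noteq> 0"
      proof (cases "j = i")
        case True
        then have "?V s i \<noteq> ?V 0 i" using False by auto
        have "\<exists>t<s. fst (xs ! t) = i"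
        proof (rule ccontr)
          assume no: "\<not> ?thesis"
          have "t \<le> s \<Longrightarrow> ?V t i = ?V 0 i" for t
          proof (induction t)
            case (Suc t)
            then have tl: "t < length xs" using a by auto
            have ne: "i \<noteq> fst (xs ! t)" using no Suc_le_lessD[OF Suc.prems] by blast
            have "?V (Suc t) i = ?V t i"
              unfolding walk_take_Suc[OF tl] state_mult_elem_step[OF M(1) vs(1)[OF tl]] using ne by simp
            then show ?case using Suc by simp
          qed simp
          then show False using \<open>?V s i \<noteq> ?V 0 i\<close> by blast
        qed
        then show ?thesis using gen2[of 0 _ s i] a True by auto
      next
        case False
        then show ?thesis using gen[of 0 s i j] a by auto
      qed
      then have nz: "wedge (?b 0 i) (?V s j) \<noteq> 0" by simp
      have "((\<lambda>e. wedge (?b e i) (?V s j)) \<longlongrightarrow> wedge (?b 0 i) (?V s j)) (at_right 0)"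
        by (intro tendsto_intros)
      from eventually_same_sign[OF this nz] show ?thesis
        by (rule eventually_mono) blast
    qed
    then show "eventually (\<lambda>e. wedge (?b e (snd (snd q))) (?V (fst q) (fst (snd q))) \<noteq> 0) (at_right 0)"
      unfolding q' by simp
  qed
  let ?same = "\<lambda>i x. x \<noteq> 0 \<and> (x > 0) = (wedge (?V 0 i) (?V 0 (Suc i)) > 0)"
  have ev2: "eventually (\<lambda>e. \<forall>i\<in>{..<n-2}. ?same i (wedge (?V 0 i) (?b e (Suc i))) \<and> ?same i (wedge (?b e i) (?b e (Suc i)))) (at_right 0)"
  proof (rule eventually_ball_finite, simp, rule ballI)
    fix i assume i: "i \<in> {..<n-2}"
    have "((\<lambda>e. wedge (?V 0 i) (?b e (Suc i))) \<longlongrightarrow> wedge (?V 0 i) (?b 0 (Suc i))) (at_right 0)"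
      "((\<lambda>e. wedge (?b e i) (?b e (Suc i))) \<longlongrightarrow> wedge (?b 0 i) (?b 0 (Suc i))) (at_right 0)"
      by (intro tendsto_intros)+
    from this[THEN eventually_same_sign] g0[of i] i
    show "eventually (\<lambda>e. ?same i (wedge (?V 0 i) (?b e (Suc i))) \<and> ?same i (wedge (?b e i) (?b e (Suc i)))) (at_right 0)"
      by (simp add: eventually_conj_iff)
  qed
  have "\<exists>e. e > 0 \<and> (\<forall>q\<in>{..length xs} \<times> {..<n} \<times> {..<n-1}. wedge (?b e (snd (snd q))) (?V (fst q) (fst (snd q))) \<noteq> 0) \<and>
     (\<forall>i\<in>{..<n-2}. ?same i (wedge (?V 0 i) (?b e (Suc i))) \<and> ?same i (wedge (?b e i) (?b e (Suc i))))"
    using eventually_happens'[OF _ eventually_conj[OF pos eventually_conj[OF ev1 ev2]]] by simp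
  then obtain e where e: "e > 0"
    and e1: "\<And>s j i. s \<le> length xs \<Longrightarrow> j < n \<Longrightarrow> i < n - 1 \<Longrightarrow> wedge (?b e i) (?V s j) \<noteq> 0"
    and e2: "\<And>i. i < n - 2 \<Longrightarrow> ?same i (wedge (?V 0 i) (?b e (Suc i))) \<and> ?same i (wedge (?b e i) (?b e (Suc i)))"
    by fastforce
  show ?thesis
  proof (rule sign_changes_bound_with_bases[where b = "?b e" and \<alpha> = "\<lambda>s. snd (xs ! s)"])
    show "2 \<le> n" by (rule n)
    show "fst (xs ! s) < n - 1 \<and> snd (xs ! s) > 0 \<and> ?V (Suc s) = (?V s)(fst (xs ! s) := ?V s (fst (xs ! s)) + snd (xs ! s) *\<^sub>R ?V s (Suc (fst (xs ! s))))"
      if "s < length xs" for s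
      using vs[OF that] state_mult_elem_step[OF M(1) vs(1)[OF that]] unfolding walk_take_Suc[OF that] by auto
    show "wedge (?V s i) (?V s' j) \<noteq> 0" if "s \<le> length xs" "s' \<le> length xs" "i < n" "j < n" "i \<noteq> j" for s s' i j
      using gen that by blast
    show "wedge (?V s i) (?V s' i) \<noteq> 0" if "s \<le> t" "t < s'" "s' \<le> length xs" "fst (xs ! t) = i" for s t s' i
      using gen2 that .
    show "wedge (?b e i) (?V s j) \<noteq> 0" if "s \<le> length xs" "j < n" "i < n - 1" for s i j
      using e1 that .
    show "wedge (?b e i) (?b e (Suc i)) \<noteq> 0" "(wedge (?V 0 i) (?b e (Suc i)) > 0) = (wedge (?V 0 i) (?V 0 (Suc i)) > 0)"
      "(wedge (?b e i) (?b e (Suc i)) > 0) = (wedge (?V 0 i) (?V 0 (Suc i)) > 0)" if "i < n - 2" for i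
      using e2[OF that] by blast+
    show "(wedge (?b e i) (?V 0 i) > 0) = (wedge (?V 0 i) (?V 0 (Suc i)) > 0)" if "i < n - 1" for i
      using wedge_commute[of "?V 0 (Suc i)" "?V 0 i"] e by (simp add: zero_less_mult_iff)
    show "(wedge (?b e i) (?V 0 (Suc i)) > 0) = (wedge (?V 0 i) (?V 0 (Suc i)) > 0)" for i
      by simp
  qed
qed

text \<open>Removes the assumption of general position: \<open>A\<close> is perturbed without altering the signs that are counted.\<close>

theorem changes_le_walk:
  fixes A :: "(nat \<Rightarrow> real) \<times> (nat \<Rightarrow> real)"
  assumes n: "n \<ge> 2" and H: "unipotent n H" and v: "valid_steps n xs"
    and fin: "finite T"
    and nz: "\<And>G. G \<in> T \<Longrightarrow> lead_wedge n A G \<noteq> 0"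
    and sign_changes: "\<And>A'. (\<And>G. G \<in> T \<Longrightarrow> (lead_wedge n A' G > 0) = (lead_wedge n A G > 0)) \<Longrightarrow>
        N \<le> sign_changes (step_index xs) (walk_state n A' H xs) (length xs)"
  shows "N \<le> 2 * (n - 2)"
proof -
  let ?M = "\<lambda>s. walk n H (take s xs)"
  define S where "S = (\<lambda>(s, s', i, j). (col_fun (?M s) i, col_fun (?M s') j)) `
     {(s, s', i, j). s \<in> {..length xs} \<and> s' \<in> {..length xs} \<and> i \<in> {..<n} \<and> j \<in> {..<n} \<and>
        (i \<noteq> j \<or> (Suc i < n \<and> ?M s $$ (Suc i, i) \<noteq> ?M s' $$ (Suc i, i)))}"
  have "finite {(s, s', i, j). s \<in> {..length xs} \<and> s' \<in> {..length xs} \<and> i \<in> {..<n} \<and> j \<in> {..<n} \<and>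
        (i \<noteq> j \<or> (Suc i < n \<and> ?M s $$ (Suc i, i) \<noteq> ?M s' $$ (Suc i, i)))}"
    by (rule finite_subset[of _ "{..length xs} \<times> {..length xs} \<times> {..<n} \<times> {..<n}"]) auto
  then have finS: "finite S" unfolding S_def by (rule finite_imageI)
  define Z where "Z = (\<lambda>G. (col_fun G 0, col_fun G 1)) ` T"
  have finZ: "finite Z" using fin by (simp add: Z_def)
  have lw: "lead_wedge n A' G = wedge (plane_image n A' (col_fun G 0)) (plane_image n A' (col_fun G 1))" for A' G
    using n by (simp add: lead_wedge_def state_def)
  have Mu: "unipotent n (?M s)" for s using walk_unipotent[OF H] .
  have "\<exists>A'. (\<forall>(c, c')\<in>S. wedge (plane_image n A' c) (plane_image n A' c') \<noteq> 0) \<and>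
     (\<forall>(c, c')\<in>Z. wedge (plane_image n A' c) (plane_image n A' c') \<noteq> 0 \<and>
        (wedge (plane_image n A' c) (plane_image n A' c') > 0) = (wedge (plane_image n A c) (plane_image n A c') > 0))"
  proof (rule generic_perturbation[OF finS finZ])
    fix c c' assume "(c, c') \<in> S"
    then obtain s s' i j where "c = col_fun (?M s) i" "c' = col_fun (?M s') j" "i < n" "j < n"
      "i \<noteq> j \<or> (Suc i < n \<and> ?M s $$ (Suc i, i) \<noteq> ?M s' $$ (Suc i, i))"
      unfolding S_def by auto
    then show "\<exists>B. wedge (plane_image n B c) (plane_image n B c') \<noteq> 0"
      using unipotent_columns_separated[OF Mu Mu] by simp
  next
    fix c c' assume "(c, c') \<in> Z"
    then obtain G where "G \<in> T" "c = col_fun G 0" "c' = col_fun G 1" by (auto simp: Z_def)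
    then show "wedge (plane_image n A c) (plane_image n A c') \<noteq> 0" using nz[of G] by (simp add: lw)
  qed
  then obtain A' where A': "\<And>c c'. (c, c') \<in> S \<Longrightarrow> wedge (plane_image n A' c) (plane_image n A' c') \<noteq> 0"
    "\<And>c c'. (c, c') \<in> Z \<Longrightarrow> (wedge (plane_image n A' c) (plane_image n A' c') > 0) = (wedge (plane_image n A c) (plane_image n A c') > 0)"
    by blast
  have "(lead_wedge n A' G > 0) = (lead_wedge n A G > 0)" if "G \<in> T" for G
    unfolding lw using that by (intro A'(2)) (auto simp: Z_def)
  then have "N \<le> sign_changes (step_index xs) (walk_state n A' H xs) (length xs)"
    by (rule sign_changes)
  also have "\<dots> \<le> 2 * (n - 2)"
  proof (rule sign_changes_le_generic[OF n H v])
    fix s s' i j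
    assume a: "s \<le> length xs" "s' \<le> length xs" "i < n" "j < n"
      "i \<noteq> j \<or> (Suc i < n \<and> ?M s $$ (Suc i, i) \<noteq> ?M s' $$ (Suc i, i))"
    have "(col_fun (?M s) i, col_fun (?M s') j) \<in> S"
      unfolding S_def using a by (intro image_eqI[of _ _ "(s, s', i, j)"]) auto
    from A'(1)[OF this] show "wedge (walk_state n A' H xs s i) (walk_state n A' H xs s' j) \<noteq> 0"
      using a by (simp add: state_def)
  qed
  finally show ?thesis .
qed

text \<open>A list of unipotent matrices, each of which is the previous one times a right factor from \<open>Q\<close>.\<close>

inductive product_chain :: "nat \<Rightarrow> (real mat \<Rightarrow> bool) \<Rightarrow> real mat list \<Rightarrow> bool" for n Q where
  single: "unipotent n H \<Longrightarrow> product_chain n Q [H]"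
| snoc: "product_chain n Q Hs \<Longrightarrow> Q P \<Longrightarrow> product_chain n Q (Hs @ [last Hs * P])"

text \<open>The last step is required to concern index 0, for then \<open>last_sign\<close> reports the sign at the end of the product.\<close>

definition step_product :: "nat \<Rightarrow> real mat \<Rightarrow> bool" where
  "step_product n P \<longleftrightarrow> (\<exists>xs. valid_steps n xs \<and> xs \<noteq> [] \<and> fst (last xs) = 0 \<and> P = walk n (1\<^sub>m n) xs)"

lemma walk_mult:
  assumes "H \<in> carrier_mat n n" "G \<in> carrier_mat n n"
  shows "walk n (H * G) xs = H * walk n G xs"
  using assms(2)
proof (induction xs arbitrary: G)
  case (Cons x xs)
  obtain i a where x: "x = (i, a)" by (cases x)
  have "H * G * elem_step n i a = H * (G * elem_step n i a)"
    using assms(1) Cons.prems by (simp add: assoc_mult_mat[of _ n n _ n _ n])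
  moreover have "G * elem_step n i a \<in> carrier_mat n n"
    using Cons.prems elem_step_carrier mult_carrier_mat by blast
  ultimately show ?case using Cons.IH by (simp add: x)
qed simp

lemma lead_wedge_step0:
  assumes "H \<in> carrier_mat n n" "Suc 0 < n"
  shows "lead_wedge n A (H * elem_step n 0 a) = lead_wedge n A H"
  unfolding lead_wedge_def state_mult_elem_step[OF assms] by simp

theorem changes_product_chain_le:
  assumes n: "n \<ge> 2" and ch: "product_chain n (step_product n) Hs"
    and nz: "\<And>H. H \<in> set Hs \<Longrightarrow> lead_wedge n A H \<noteq> 0"
  shows "changes (map (\<lambda>H. lead_wedge n A H > 0) Hs) \<le> 2 * (n - 2)"
proof -
  let ?s = "\<lambda>A H. lead_wedge n A H > 0"
  have "\<exists>xs. Hs \<noteq> [] \<and> unipotent n (hd Hs) \<and> valid_steps n xs \<and> walk n (hd Hs) xs = last Hs \<and> unipotent n (last Hs) \<and>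
     (\<forall>A. changes (map (?s A) Hs) \<le> sign_changes (step_index xs) (walk_state n A (hd Hs) xs) (length xs) \<and>
       last_sign (step_index xs) (walk_state n A (hd Hs) xs) (length xs) = ?s A (last Hs))"
    using ch
  proof induction
    case (single H)
    then show ?case by (intro exI[of _ "[]"]) (simp add: valid_steps_def lead_wedge_def)
  next
    case (snoc Hs P)
    let ?H = "hd Hs"
    from snoc.IH obtain xs where xs: "Hs \<noteq> []" "unipotent n ?H" "valid_steps n xs" "walk n ?H xs = last Hs" "unipotent n (last Hs)"
      "\<And>A. changes (map (?s A) Hs) \<le> sign_changes (step_index xs) (walk_state n A ?H xs) (length xs)"
      "\<And>A. last_sign (step_index xs) (walk_state n A ?H xs) (length xs) = ?s A (last Hs)" by blast
    from snoc.hyps(2) obtain ys where ys: "valid_steps n ys" "ys \<noteq> []" "fst (last ys) = 0" "P = walk n (1\<^sub>m n) ys"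
      unfolding step_product_def by blast
    have cH: "last Hs \<in> carrier_mat n n" using xs(5) by (simp add: unipotent_def)
    have P: "last Hs * P = walk n (last Hs) ys"
      using walk_mult[OF cH one_carrier_mat[of n], of ys] cH ys(4) by simp
    let ?zs = "xs @ ys"
    have w: "walk n ?H ?zs = last Hs * P" using xs(4) P by simp
    have u: "unipotent n (last Hs * P)" unfolding P by (rule walk_unipotent[OF xs(5)])
    have hd: "hd (Hs @ [last Hs * P]) = ?H" using xs(1) by simp
    have pre: "last_sign (step_index ?zs) (walk_state n A ?H ?zs) (length xs) = last_sign (step_index xs) (walk_state n A ?H xs) (length xs)"
      "sign_changes (step_index ?zs) (walk_state n A ?H ?zs) (length xs) = sign_changes (step_index xs) (walk_state n A ?H xs) (length xs)" for A
      by (rule last_sign_sign_changes_cong; simp add: nth_append)+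
    define l where "l = length ?zs - 1"
    have l: "length ?zs = Suc l" "l < length ?zs" using ys(2) by (auto simp: l_def)
    have zl: "?zs ! l = last ys"
      using ys(2) unfolding l_def by (metis append_is_Nil_conv last_append last_conv_nth)
    have Ml: "unipotent n (walk n ?H (take l ?zs))" by (rule walk_unipotent[OF xs(2)])
    have wl: "walk n ?H (take l ?zs) * elem_step n 0 (snd (last ys)) = last Hs * P"
      using walk_take_Suc[OF l(2), of n ?H] ys(3) w unfolding zl by (simp flip: l(1))
    have ls: "last_sign (step_index ?zs) (walk_state n A ?H ?zs) (length ?zs) = ?s A (last Hs * P)" for A
    proof -
      have "last_sign (step_index ?zs) (walk_state n A ?H ?zs) (length ?zs) = ?s A (walk n ?H (take l ?zs))"
        unfolding l(1) last_sign.simps zl ys(3) by (simp add: lead_wedge_def)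
      also have "lead_wedge n A (walk n ?H (take l ?zs)) = lead_wedge n A (last Hs * P)"
        using lead_wedge_step0[of "walk n ?H (take l ?zs)" n A "snd (last ys)"] Ml n unfolding wl by (simp add: unipotent_def)
      finally show ?thesis .
    qed
    have "changes (map (?s A) (Hs @ [last Hs * P])) \<le> sign_changes (step_index ?zs) (walk_state n A ?H ?zs) (length ?zs)" for A
    proof -
      have "changes (map (?s A) (Hs @ [last Hs * P])) = changes (map (?s A) Hs) + (if ?s A (last Hs) \<noteq> ?s A (last Hs * P) then 1 else 0)"
        using changes_snoc[of "map (?s A) Hs" "?s A (last Hs * P)"] xs(1) by (simp add: last_map)
      also have "\<dots> \<le> sign_changes (step_index ?zs) (walk_state n A ?H ?zs) (length xs) +
          (if last_sign (step_index ?zs) (walk_state n A ?H ?zs) (length xs) \<noteq> last_sign (step_index ?zs) (walk_state n A ?H ?zs) (length ?zs) then 1 else 0)"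
        unfolding pre ls xs(7) using xs(6)[of A] by simp
      also have "\<dots> \<le> sign_changes (step_index ?zs) (walk_state n A ?H ?zs) (length ?zs)"
        by (rule sign_changes_ge_change) simp
      finally show ?thesis .
    qed
    moreover have "valid_steps n ?zs" using xs(3) ys(1) by (auto simp: valid_steps_def)
    ultimately show ?case
      unfolding hd using w u ls xs(2) by (intro exI[of _ ?zs]) auto
  qed
  then obtain xs where xs: "unipotent n (hd Hs)" "valid_steps n xs"
     "\<And>A. changes (map (?s A) Hs) \<le> sign_changes (step_index xs) (walk_state n A (hd Hs) xs) (length xs)" by blast
  show ?thesis
  proof (rule changes_le_walk[OF n xs(1,2), of "set Hs"])
    fix A' assume "\<And>G. G \<in> set Hs \<Longrightarrow> ?s A' G = ?s A G"
    then have eq: "map (?s A) Hs = map (?s A') Hs" by simp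
    show "changes (map (?s A) Hs) \<le> sign_changes (step_index xs) (walk_state n A' (hd Hs) xs) (length xs)"
      unfolding eq by (rule xs(3))
  qed (use nz in auto)
qed

section \<open>Total positivity and elementary steps\<close>

text \<open>Neville elimination: the last row is cleared by subtracting from each column a multiple of its right neighbour. This undoes
a run of elementary steps with descending indices.\<close>

definition strip_last :: "nat \<Rightarrow> (nat \<Rightarrow> nat \<Rightarrow> real) \<Rightarrow> nat \<Rightarrow> nat \<Rightarrow> real" where
  "strip_last n G r i = G r i - G n i / G n (Suc i) * G r (Suc i)"

text \<open>Neville elimination, row by row from below, meets positive entries only. This is the form of total positivity that suits
induction on the size.\<close>

fun tot_pos :: "nat \<Rightarrow> (nat \<Rightarrow> nat \<Rightarrow> real) \<Rightarrow> bool" where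
  "tot_pos 0 G = True"
| "tot_pos (Suc n) G = ((\<forall>i<n. G n i > 0) \<and> tot_pos n (strip_last n G))"

text \<open>The counterpart of \<open>unipotent\<close> for functions of two indices, which can be cut down to a smaller size without further ado.\<close>

definition unipotent_array :: "nat \<Rightarrow> (nat \<Rightarrow> nat \<Rightarrow> real) \<Rightarrow> bool" where
  "unipotent_array n G \<longleftrightarrow> (\<forall>r<n. G r r = 1) \<and> (\<forall>c<n. \<forall>r<c. G r c = 0)"

lemma unipotent_array_strip_last: "unipotent_array (Suc n) G \<Longrightarrow> unipotent_array n (strip_last n G)"
  by (simp add: unipotent_array_def strip_last_def)

lemma tot_pos_open:
  assumes "\<And>r i. r < n \<Longrightarrow> i < n \<Longrightarrow> ((\<lambda>x. G x r i) \<longlongrightarrow> G0 r i) F" "unipotent_array n G0" "tot_pos n G0"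
  shows "eventually (\<lambda>x. tot_pos n (G x)) F"
  using assms
proof (induction n arbitrary: G G0)
  case 0
  then show ?case by simp
next
  case (Suc n)
  have nz: "G0 n (Suc i) \<noteq> 0" if "i < n" for i
    using that Suc.prems(2,3) by (cases "Suc i = n") (auto simp: unipotent_array_def order.strict_iff_not dest: spec[of _ "Suc i"])
  have "eventually (\<lambda>x. tot_pos n (strip_last n (G x))) F"
  proof (rule Suc.IH)
    show "((\<lambda>x. strip_last n (G x) r i) \<longlongrightarrow> strip_last n G0 r i) F" if "r < n" "i < n" for r i
      unfolding strip_last_def using that nz by (intro tendsto_intros Suc.prems(1)) auto
    show "unipotent_array n (strip_last n G0)" using Suc.prems(2) by (rule unipotent_array_strip_last)
    show "tot_pos n (strip_last n G0)" using Suc.prems(3) by simp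
  qed
  moreover have "eventually (\<lambda>x. \<forall>i\<in>{..<n}. G x n i > 0) F"
  proof (rule eventually_ball_finite, simp, rule ballI)
    fix i assume "i \<in> {..<n}"
    then show "eventually (\<lambda>x. G x n i > 0) F"
      using order_tendstoD(1)[OF Suc.prems(1)[of n i], of 0] Suc.prems(3) by simp
  qed
  ultimately show ?case
    by eventually_elim simp
qed

definition colstep :: "nat \<times> real \<Rightarrow> (nat \<Rightarrow> nat \<Rightarrow> real) \<Rightarrow> nat \<Rightarrow> nat \<Rightarrow> real" where
  "colstep p G r c = (if c = fst p then G r c + snd p * G r (Suc c) else G r c)"

definition kron :: "nat \<Rightarrow> nat \<Rightarrow> real" where
  "kron r c = (if r = c then 1 else 0)"

definition colwalk :: "(nat \<Rightarrow> nat \<Rightarrow> real) \<Rightarrow> (nat \<times> real) list \<Rightarrow> nat \<Rightarrow> nat \<Rightarrow> real" where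
  "colwalk G xs = foldl (\<lambda>G p. colstep p G) G xs"

lemma colwalk_simps [simp]: "colwalk G [] = G" "colwalk G (xs @ ys) = colwalk (colwalk G xs) ys"
  "colwalk G (p # xs) = colwalk (colstep p G) xs"
  by (auto simp: colwalk_def)

lemma colwalk_outside:
  assumes "valid_steps n xs" "\<And>c. c < n \<Longrightarrow> G r c = 0" "c < n"
  shows "colwalk G xs r c = 0"
  using assms
proof (induction xs arbitrary: G)
  case (Cons p xs)
  have "Suc (fst p) < n" "valid_steps n xs" using Cons.prems by (auto simp: valid_steps_def)
  then show ?case
    using Cons.prems by (simp, intro Cons.IH) (auto simp: colstep_def)
qed simp

lemma colwalk_last_col:
  assumes "valid_steps n xs" "n \<le> c"
  shows "colwalk G xs r c = G r c"
  using assms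
proof (induction xs arbitrary: G)
  case (Cons p xs)
  have "Suc (fst p) < n" "valid_steps n xs" using Cons.prems by (auto simp: valid_steps_def)
  then show ?case
    using Cons by (auto simp: colstep_def)
qed simp

lemma colwalk_descending:
  assumes "m \<le> n" "\<And>c. c < n \<Longrightarrow> R r c = G r c - a c * G r (Suc c)" "R r n = G r n"
  shows "colwalk R (map (\<lambda>i. (i, a i)) (rev [m..<n])) r c = (if m \<le> c \<and> c \<le> n then G r c else R r c)"
  using assms(1)
proof (induction m arbitrary: c rule: inc_induct)
  case base
  then show ?case using assms(3) by auto
next
  case (step m)
  have "[m..<n] = m # [Suc m..<n]" using step.hyps by (simp add: upt_conv_Cons)
  then have "colwalk R (map (\<lambda>i. (i, a i)) (rev [m..<n])) = colstep (m, a m) (colwalk R (map (\<lambda>i. (i, a i)) (rev [Suc m..<n])))"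
    by simp
  then show ?case
    using step.hyps step.IH[of c] step.IH[of "Suc c"] assms(2)[of m] by (auto simp: colstep_def)
qed

text \<open>Reverting the elimination expresses the array by elementary steps; their coefficients are quotients of neighbouring entries of the
rows that are eliminated.\<close>

lemma tot_pos_colwalk:
  assumes "unipotent_array n G" "tot_pos n G"
  shows "\<exists>xs. valid_steps n xs \<and> (n \<ge> 2 \<longrightarrow> xs \<noteq> [] \<and> fst (last xs) = 0) \<and>
     (\<forall>r<n. \<forall>c<n. colwalk kron xs r c = G r c)"
  using assms
proof (induction n arbitrary: G)
  case 0
  then show ?case by (intro exI[of _ "[]"]) (simp add: valid_steps_def)
next
  case (Suc n)
  have "unipotent_array n (strip_last n G)" "tot_pos n (strip_last n G)"
    using Suc.prems unipotent_array_strip_last by auto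
  from Suc.IH[OF this] obtain xs where xs: "valid_steps n xs"
    "\<And>r c. r < n \<Longrightarrow> c < n \<Longrightarrow> colwalk kron xs r c = strip_last n G r c" by blast
  define a where "a i = G n i / G n (Suc i)" for i
  have p: "G n i > 0" if "i \<le> n" for i
    using that Suc.prems by (cases "i = n") (auto simp: unipotent_array_def)
  have a: "a i > 0" if "i < n" for i using p[of i] p[of "Suc i"] that by (simp add: a_def)
  let ?ys = "map (\<lambda>i. (i, a i)) (rev [0..<n])"
  let ?R = "colwalk kron xs"
  have R1: "?R r c = G r c - a c * G r (Suc c)" if "r \<le> n" "c < n" for r c
  proof (cases "r = n")
    case True
    have "colwalk kron xs n c = 0"
      using that by (intro colwalk_outside[OF xs(1)]) (auto simp: kron_def)
    then show ?thesis using p[of "Suc c"] that True by (simp add: a_def)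
  next
    case False
    then show ?thesis using xs(2)[of r c] that by (simp add: strip_last_def a_def)
  qed
  have R2: "?R r n = G r n" if "r \<le> n" for r
    using that Suc.prems(1) colwalk_last_col[OF xs(1), of n kron r] by (cases "r = n") (auto simp: unipotent_array_def kron_def)
  have eq: "colwalk kron (xs @ ?ys) r c = G r c" if "r < Suc n" "c < Suc n" for r c
    using colwalk_descending[of 0 n ?R r G a c] R1[of r] R2[of r] that by simp
  have "valid_steps (Suc n) (xs @ ?ys)"
    using xs(1) a unfolding valid_steps_def by auto
  moreover have "xs @ ?ys \<noteq> [] \<and> fst (last (xs @ ?ys)) = 0" if "Suc n \<ge> 2"
  proof -
    have "rev [0..<n] = rev [1..<n] @ [0]" using that by (simp add: upt_conv_Cons)
    then show ?thesis by simp
  qed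
  ultimately show ?case using eq by (intro exI[of _ "xs @ ?ys"]) blast
qed

lemma walk_mat_colwalk:
  assumes "valid_steps n xs"
  shows "walk n (Matrix.mat n n (\<lambda>(r, c). F r c)) xs = Matrix.mat n n (\<lambda>(r, c). colwalk F xs r c)"
  using assms
proof (induction xs arbitrary: F)
  case (Cons p xs)
  obtain i b where p: "p = (i, b)" by (cases p)
  have v: "Suc i < n" "valid_steps n xs" using Cons.prems p by (auto simp: valid_steps_def)
  have "Matrix.mat n n (\<lambda>(r, c). F r c) * elem_step n i b = Matrix.mat n n (\<lambda>(r, c). colstep p F r c)"
  proof (rule eq_matI)
    fix r c assume "r < dim_row (Matrix.mat n n (\<lambda>(r, c). colstep p F r c))" "c < dim_col (Matrix.mat n n (\<lambda>(r, c). colstep p F r c))"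
    then show "(Matrix.mat n n (\<lambda>(r, c). F r c) * elem_step n i b) $$ (r, c) = Matrix.mat n n (\<lambda>(r, c). colstep p F r c) $$ (r, c)"
      using mult_elem_step_index[of "Matrix.mat n n (\<lambda>(r, c). F r c)" n i r c b] v(1) by (auto simp: colstep_def p)
  qed (auto simp: elem_step_def)
  then show ?case using Cons.IH[OF v(2)] p by simp
qed simp

definition tot_pos_mat :: "nat \<Rightarrow> real mat \<Rightarrow> bool" where
  "tot_pos_mat n P \<longleftrightarrow> unipotent n P \<and> tot_pos n (\<lambda>r c. P $$ (r, c))"

lemma tot_pos_mat_step_product:
  assumes "n \<ge> 2" "tot_pos_mat n P"
  shows "step_product n P"
proof -
  have "unipotent_array n (\<lambda>r c. P $$ (r, c))" "tot_pos n (\<lambda>r c. P $$ (r, c))"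
    using assms(2) by (auto simp: tot_pos_mat_def unipotent_def unipotent_array_def)
  from tot_pos_colwalk[OF this] assms(1) obtain xs where xs: "valid_steps n xs" "xs \<noteq> []" "fst (last xs) = 0"
    "\<And>r c. r < n \<Longrightarrow> c < n \<Longrightarrow> colwalk kron xs r c = P $$ (r, c)" by blast
  have "1\<^sub>m n = Matrix.mat n n (\<lambda>(r, c). kron r c)"
    by (rule eq_matI) (auto simp: kron_def)
  then have "walk n (1\<^sub>m n) xs = Matrix.mat n n (\<lambda>(r, c). colwalk kron xs r c)"
    using walk_mat_colwalk[OF xs(1)] by simp
  also have "\<dots> = P"
    using assms(2) xs(4) by (intro eq_matI) (auto simp: tot_pos_mat_def unipotent_def)
  finally show ?thesis unfolding step_product_def using xs by blast
qed

lemma pos_of_deriv_pos: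
  fixes f :: "real \<Rightarrow> real"
  assumes d: "\<And>t. s < t \<Longrightarrow> t \<le> e \<Longrightarrow> (f has_real_derivative f' t) (at t within {s<..e})"
    and p: "\<And>t. s < t \<Longrightarrow> t \<le> e \<Longrightarrow> f' t > 0"
    and l: "(f \<longlongrightarrow> 0) (at_right s)" and t: "s < t" "t \<le> e"
  shows "f t > 0"
proof -
  have inc: "f u < f v" if "s < u" "u < v" "v \<le> e" for u v
  proof -
    have "\<exists>x\<in>{u<..<v}. f v - f u = (\<lambda>h. f' x * h) (v - u)"
    proof (rule mvt_simple[OF that(2)])
      fix x assume "u \<le> x" "x \<le> v"
      then have "(f has_real_derivative f' x) (at x within {u..v})"
        using that by (intro DERIV_subset[OF d]) auto
      then show "(f has_derivative (\<lambda>h. f' x * h)) (at x within {u..v})"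
        by (simp add: has_field_derivative_def)
    qed
    then obtain x where "u < x" "x < v" "f v - f u = f' x * (v - u)" by auto
    moreover have "f' x * (v - u) > 0" using p[of x] \<open>u < x\<close> \<open>x < v\<close> that by simp
    ultimately show ?thesis by simp
  qed
  define u where "u = (s + t) / 2"
  have u: "s < u" "u < t" using t by (auto simp: u_def)
  have "0 \<le> f u"
  proof (rule tendsto_upperbound[OF l])
    show "eventually (\<lambda>x. f x \<le> f u) (at_right s)"
      unfolding eventually_at_right_field
      using u t inc by (intro exI[of _ u]) (auto intro: less_imp_le)
  qed simp
  then show ?thesis using inc[OF u t(2)] by simp
qed

text \<open>A flow that starts at the identity is totally positive at all later times. The last row is positive because it starts at zero
and each entry increases at a rate given by the next one. After elimination of this row, the remaining columns again form a flow, with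
other positive rates, and the claim follows by induction. A primitive \<open>\<Phi>\<close> of the rates that vanishes at the start
is carried along in order to see that the elimination coefficients tend to zero at the start.\<close>

theorem tot_pos_flow:
  fixes G :: "real \<Rightarrow> nat \<Rightarrow> nat \<Rightarrow> real"
  assumes "s < e"
    and "\<And>t. s < t \<Longrightarrow> t \<le> e \<Longrightarrow> unipotent_array n (G t)"
    and "\<And>t r i. s < t \<Longrightarrow> t \<le> e \<Longrightarrow> r < n \<Longrightarrow> Suc i < n \<Longrightarrow>
       ((\<lambda>t. G t r i) has_real_derivative \<rho> i t * G t r (Suc i)) (at t within {s<..e})"
    and "\<And>r i. r < n \<Longrightarrow> i < n \<Longrightarrow> ((\<lambda>t. G t r i) \<longlongrightarrow> (if r = i then 1 else 0)) (at_right s)"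
    and "\<And>t i. s < t \<Longrightarrow> t \<le> e \<Longrightarrow> Suc i < n \<Longrightarrow> \<rho> i t > 0"
    and "\<And>t i. s < t \<Longrightarrow> t \<le> e \<Longrightarrow> Suc i < n \<Longrightarrow> (\<Phi> i has_real_derivative \<rho> i t) (at t within {s<..e})"
    and "\<And>i. Suc i < n \<Longrightarrow> (\<Phi> i \<longlongrightarrow> 0) (at_right s)"
    and "s < t" "t \<le> e"
  shows "tot_pos n (G t)"
  using assms(2-7) assms(8,9)
proof (induction n arbitrary: G \<rho> \<Phi> t)
  case 0
  then show ?case by simp
next
  case (Suc n)
  note un = Suc.prems(1) and der = Suc.prems(2) and lim = Suc.prems(3) and pos = Suc.prems(4)
    and derP = Suc.prems(5) and limP = Suc.prems(6)
  let ?R = "\<lambda>i t. G t n i"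
  have Rn: "?R n t = 1" if "s < t" "t \<le> e" for t using un[OF that] by (simp add: unipotent_array_def)
  have Rpos: "?R i t > 0" if "i \<le> n" "s < t" "t \<le> e" for i t
    using that
  proof (induction i arbitrary: t rule: inc_induct)
    case base
    then show ?case using Rn by simp
  next
    case (step i)
    show ?case
    proof (rule pos_of_deriv_pos[of s e "?R i" "\<lambda>t. \<rho> i t * ?R (Suc i) t"])
      show "(?R i has_real_derivative \<rho> i t * ?R (Suc i) t) (at t within {s<..e})" if "s < t" "t \<le> e" for t
        using der[OF that, of n i] step.hyps by simp
      show "\<rho> i t * ?R (Suc i) t > 0" if "s < t" "t \<le> e" for t
        using pos[OF that, of i] step.IH[OF that] step.hyps by simp
      show "(?R i \<longlongrightarrow> 0) (at_right s)" using lim[of n i] step.hyps by simp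
    qed (use step.prems in auto)
  qed
  define a where "a i t = ?R i t / ?R (Suc i) t" for i t
  have Phipos: "\<Phi> i t > 0" if "Suc i < Suc n" "s < t" "t \<le> e" for i t
    by (rule pos_of_deriv_pos[of s e "\<Phi> i" "\<rho> i"]) (use that pos derP limP in auto)
  have apos: "a i t > 0" if "i < n" "s < t" "t \<le> e" for i t
    using Rpos[of i t] Rpos[of "Suc i" t] that by (simp add: a_def)
  \<comment> \<open>The elimination coefficients are dominated by the primitives of the rates.\<close>
  have alim: "(a i \<longlongrightarrow> 0) (at_right s)" if i: "i < n" for i
  proof (cases "Suc i = n")
    case True
    have "eventually (\<lambda>t. ?R i t = a i t) (at_right s)"
      unfolding eventually_at_right_field
      using Rn \<open>s < e\<close> True by (intro exI[of _ e]) (auto simp: a_def)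
    moreover have "(?R i \<longlongrightarrow> 0) (at_right s)" using lim[of n i] i by simp
    ultimately show ?thesis by (rule Lim_transform_eventually[rotated])
  next
    case False
    then have i2: "Suc (Suc i) < Suc n" using i by simp
    have less: "a i t < \<Phi> i t" if t: "s < t" "t \<le> e" for t
    proof -
      have "0 < \<Phi> i t * ?R (Suc i) t - ?R i t"
      proof (rule pos_of_deriv_pos[of s e "\<lambda>t. \<Phi> i t * ?R (Suc i) t - ?R i t" "\<lambda>t. \<Phi> i t * (\<rho> (Suc i) t * ?R (Suc (Suc i)) t)"])
        show "((\<lambda>t. \<Phi> i t * ?R (Suc i) t - ?R i t) has_real_derivative \<Phi> i t * (\<rho> (Suc i) t * ?R (Suc (Suc i)) t)) (at t within {s<..e})"
          if "s < t" "t \<le> e" for t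
          using der[OF that, of n i] der[OF that, of n "Suc i"] derP[OF that, of i] i i2
          by (auto intro!: derivative_eq_intros simp: algebra_simps)
        show "\<Phi> i t * (\<rho> (Suc i) t * ?R (Suc (Suc i)) t) > 0" if "s < t" "t \<le> e" for t
          using Phipos[of i t] pos[OF that, of "Suc i"] Rpos[of "Suc (Suc i)" t] that i i2 by simp
        have "((\<lambda>t. \<Phi> i t * ?R (Suc i) t - ?R i t) \<longlongrightarrow> 0 * (if n = Suc i then 1 else 0) - (if n = i then 1 else 0)) (at_right s)"
          using i i2 by (intro tendsto_diff tendsto_mult limP lim) auto
        then show "((\<lambda>t. \<Phi> i t * ?R (Suc i) t - ?R i t) \<longlongrightarrow> 0) (at_right s)" using i by simp
      qed (use t in auto)
      then show ?thesis using Rpos[of "Suc i" t] i t by (simp add: a_def pos_divide_less_eq)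
    qed
    show ?thesis
    proof (rule tendsto_sandwich[of "\<lambda>_. 0" "a i" _ "\<Phi> i"])
      show "eventually (\<lambda>t. 0 \<le> a i t) (at_right s)" "eventually (\<lambda>t. a i t \<le> \<Phi> i t) (at_right s)"
        unfolding eventually_at_right_field
        using apos[OF i] less \<open>s < e\<close> by (auto intro!: exI[of _ e] less_imp_le)
      show "(\<Phi> i \<longlongrightarrow> 0) (at_right s)" using limP i by simp
    qed simp
  qed
  \<comment> \<open>The rates of the stripped flow. The derivative of \<open>a i\<close> differs from \<open>\<rho> i\<close> by \<open>\<rho>' i\<close>, so \<open>\<Phi> i - a i\<close> is a primitive of \<open>\<rho>' i\<close>.\<close>
  define \<rho>' where "\<rho>' i t = ?R i t * \<rho> (Suc i) t * ?R (Suc (Suc i)) t / (?R (Suc i) t)\<^sup>2" for i t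
  have ader: "(a i has_real_derivative \<rho> i t - \<rho>' i t) (at t within {s<..e})"
    if "Suc i < n" "s < t" "t \<le> e" for i t
  proof -
    have nz: "?R (Suc i) t \<noteq> 0" using Rpos[of "Suc i" t] that by simp
    have "(a i has_real_derivative (\<rho> i t * ?R (Suc i) t * ?R (Suc i) t - ?R i t * (\<rho> (Suc i) t * ?R (Suc (Suc i)) t)) / (?R (Suc i) t * ?R (Suc i) t)) (at t within {s<..e})"
      unfolding a_def using der[OF that(2,3), of n i] der[OF that(2,3), of n "Suc i"] that(1) nz
      by (intro DERIV_divide) auto
    moreover have "(\<rho> i t * ?R (Suc i) t * ?R (Suc i) t - ?R i t * (\<rho> (Suc i) t * ?R (Suc (Suc i)) t)) / (?R (Suc i) t * ?R (Suc i) t) = \<rho> i t - \<rho>' i t"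
      using nz by (simp add: \<rho>'_def field_simps power2_eq_square)
    ultimately show ?thesis by simp
  qed
  have "tot_pos n (strip_last n (G t))"
  proof (rule Suc.IH[of "\<lambda>t. strip_last n (G t)" \<rho>' "\<lambda>i t. \<Phi> i t - a i t"])
    show "unipotent_array n (strip_last n (G t))" if "s < t" "t \<le> e" for t using unipotent_array_strip_last[OF un[OF that]] .
    show "((\<lambda>t. strip_last n (G t) r i) has_real_derivative \<rho>' i t * strip_last n (G t) r (Suc i)) (at t within {s<..e})"
      if "s < t" "t \<le> e" "r < n" "Suc i < n" for t r i
    proof -
      have nz: "?R (Suc i) t \<noteq> 0" "?R (Suc (Suc i)) t \<noteq> 0" using Rpos[of "Suc i" t] Rpos[of "Suc (Suc i)" t] that by simp_all
      have "((\<lambda>t. G t r i - a i t * G t r (Suc i)) has_real_derivative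
          \<rho> i t * G t r (Suc i) - ((\<rho> i t - \<rho>' i t) * G t r (Suc i) + \<rho> (Suc i) t * G t r (Suc (Suc i)) * a i t)) (at t within {s<..e})"
        using der[OF that(1,2), of r i] der[OF that(1,2), of r "Suc i"] that ader[OF that(4,1,2)]
        by (intro DERIV_diff DERIV_mult) auto
      moreover have "\<rho> i t * G t r (Suc i) - ((\<rho> i t - \<rho>' i t) * G t r (Suc i) + \<rho> (Suc i) t * G t r (Suc (Suc i)) * a i t)
          = \<rho>' i t * strip_last n (G t) r (Suc i)"
        using nz by (simp add: strip_last_def \<rho>'_def a_def field_simps power2_eq_square)
      ultimately show ?thesis by (simp add: strip_last_def a_def)
    qed
    show "((\<lambda>t. strip_last n (G t) r i) \<longlongrightarrow> (if r = i then 1 else 0)) (at_right s)" if "r < n" "i < n" for r i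
    proof -
      have "((\<lambda>t. G t r i - a i t * G t r (Suc i)) \<longlongrightarrow> (if r = i then 1 else 0) - 0 * (if r = Suc i then 1 else 0)) (at_right s)"
        using that by (intro tendsto_diff tendsto_mult lim alim) auto
      then show ?thesis by (simp add: strip_last_def a_def)
    qed
    show "\<rho>' i t > 0" if "s < t" "t \<le> e" "Suc i < n" for t i
      using Rpos[of i t] Rpos[of "Suc i" t] Rpos[of "Suc (Suc i)" t] pos[OF that(1,2), of "Suc i"] that by (simp add: \<rho>'_def)
    show "((\<lambda>t. \<Phi> i t - a i t) has_real_derivative \<rho>' i t) (at t within {s<..e})" if "s < t" "t \<le> e" "Suc i < n" for t i
      using DERIV_diff[OF derP[OF that(1,2), of i] ader[OF that(3,1,2)]] that by simp
    show "((\<lambda>t. \<Phi> i t - a i t) \<longlongrightarrow> 0) (at_right s)" if "Suc i < n" for i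
      using tendsto_diff[OF limP[of i] alim[of i]] that by simp
  qed (use Suc.prems in auto)
  then show ?case using Rpos Suc.prems(7,8) by simp
qed

section \<open>Neighbourhoods of the identity\<close>

lemma unipotent_carrier: "unipotent n H \<Longrightarrow> H \<in> carrier_mat n n"
  by (simp add: unipotent_def)

lemma unipotent_one: "unipotent n (1\<^sub>m n)"
  by (auto simp: unipotent_def)

lemma tot_pos_mat_unipotent: "tot_pos_mat n P \<Longrightarrow> unipotent n P"
  by (simp add: tot_pos_mat_def)

lemma unipotent_det: "unipotent n H \<Longrightarrow> det H = 1"
  using det_lower_triangular[of n H] by (auto simp: unipotent_def prod_list_diag_prod)

lemma unipotent_inverse:
  assumes "unipotent n H"
  shows "\<exists>K. unipotent n K \<and> H * K = 1\<^sub>m n \<and> K * H = 1\<^sub>m n"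
proof -
  have H: "H \<in> carrier_mat n n" using assms by (rule unipotent_carrier)
  have "det H \<noteq> 0" using unipotent_det[OF assms] by simp
  then obtain K where K: "K \<in> carrier_mat n n" "H * K = 1\<^sub>m n" "K * H = 1\<^sub>m n"
    using H det_non_zero_imp_unit[OF H] unfolding Units_def ring_mat_def by auto
  have *: "K $$ (r, c) = (if r = c then 1 else 0)" if "r \<le> c" "c < n" for r c
    using that
  proof (induction r rule: less_induct)
    case (less r)
    have "(if r = c then 1 else 0) = (H * K) $$ (r, c)" using K less.prems by simp
    also have "\<dots> = (\<Sum>k<n. H $$ (r, k) * K $$ (k, c))" using H K less.prems by (intro mult_index) auto
    also have "\<dots> = (\<Sum>k<n. if k = r then K $$ (r, c) else 0)"
    proof (intro sum.cong refl)
      fix k assume "k \<in> {..<n}"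
      then show "H $$ (r, k) * K $$ (k, c) = (if k = r then K $$ (r, c) else 0)"
        using assms less.IH[of k] less.prems by (cases k r rule: linorder_cases) (auto simp: unipotent_def)
    qed
    also have "\<dots> = K $$ (r, c)" using less.prems by simp
    finally show ?case by simp
  qed
  have "unipotent n K" using K(1) * by (auto simp: unipotent_def)
  then show ?thesis using K by blast
qed

definition mat_tendsto :: "nat \<Rightarrow> ('a \<Rightarrow> real mat) \<Rightarrow> real mat \<Rightarrow> 'a filter \<Rightarrow> bool" where
  "mat_tendsto n f M F \<longleftrightarrow> M \<in> carrier_mat n n \<and> (\<forall>\<^sub>F x in F. f x \<in> carrier_mat n n) \<and>
     (\<forall>r<n. \<forall>c<n. ((\<lambda>x. f x $$ (r, c)) \<longlongrightarrow> M $$ (r, c)) F)"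

lemma mat_tendsto_const: "M \<in> carrier_mat n n \<Longrightarrow> mat_tendsto n (\<lambda>_. M) M F"
  by (simp add: mat_tendsto_def)

lemma mat_tendsto_mult:
  assumes "mat_tendsto n f M F" "mat_tendsto n g N F"
  shows "mat_tendsto n (\<lambda>x. f x * g x) (M * N) F"
proof -
  have c: "M \<in> carrier_mat n n" "N \<in> carrier_mat n n" using assms by (auto simp: mat_tendsto_def)
  have ev: "\<forall>\<^sub>F x in F. f x \<in> carrier_mat n n \<and> g x \<in> carrier_mat n n"
    using assms by (auto simp: mat_tendsto_def intro: eventually_conj)
  have "((\<lambda>x. (f x * g x) $$ (r, c)) \<longlongrightarrow> (M * N) $$ (r, c)) F" if rc: "r < n" "c < n" for r c
  proof -
    have "((\<lambda>x. \<Sum>k<n. f x $$ (r, k) * g x $$ (k, c)) \<longlongrightarrow> (\<Sum>k<n. M $$ (r, k) * N $$ (k, c))) F"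
      using assms rc by (intro tendsto_sum tendsto_mult) (auto simp: mat_tendsto_def)
    moreover have "\<forall>\<^sub>F x in F. (\<Sum>k<n. f x $$ (r, k) * g x $$ (k, c)) = (f x * g x) $$ (r, c)"
      using ev by eventually_elim (use rc in \<open>simp add: mult_index[of _ n]\<close>)
    ultimately show ?thesis
      unfolding mult_index[OF c rc] by (rule Lim_transform_eventually)
  qed
  moreover have "\<forall>\<^sub>F x in F. f x * g x \<in> carrier_mat n n"
    using ev by eventually_elim auto
  ultimately show ?thesis using c by (auto simp: mat_tendsto_def)
qed

text \<open>Unipotent matrices close to the identity, entry by entry.\<close>

definition unipotent_nhd :: "nat \<Rightarrow> real mat filter" where
  "unipotent_nhd n = (INF e\<in>{0<..}. principal {h. unipotent n h \<and> (\<forall>r<n. \<forall>c<n. \<bar>h $$ (r, c) - 1\<^sub>m n $$ (r, c)\<bar> < e)})"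

lemma eventually_unipotent_nhd:
  "eventually P (unipotent_nhd n) \<longleftrightarrow>
     (\<exists>e>0. \<forall>h. unipotent n h \<and> (\<forall>r<n. \<forall>c<n. \<bar>h $$ (r, c) - 1\<^sub>m n $$ (r, c)\<bar> < e) \<longrightarrow> P h)"
  unfolding unipotent_nhd_def
proof (subst eventually_INF_base)
  fix a b :: real assume ab: "a \<in> {0<..}" "b \<in> {0<..}"
  show "\<exists>x\<in>{0<..}. principal {h. unipotent n h \<and> (\<forall>r<n. \<forall>c<n. \<bar>h $$ (r, c) - 1\<^sub>m n $$ (r, c)\<bar> < x)} \<le>
      inf (principal {h. unipotent n h \<and> (\<forall>r<n. \<forall>c<n. \<bar>h $$ (r, c) - 1\<^sub>m n $$ (r, c)\<bar> < a)})
        (principal {h. unipotent n h \<and> (\<forall>r<n. \<forall>c<n. \<bar>h $$ (r, c) - 1\<^sub>m n $$ (r, c)\<bar> < b)})"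
    using ab by (intro bexI[of _ "min a b"]) auto
qed (auto simp: eventually_principal)

lemma filterlim_unipotent_nhd:
  assumes "mat_tendsto n f (1\<^sub>m n) F" "\<forall>\<^sub>F x in F. unipotent n (f x)"
  shows "filterlim f (unipotent_nhd n) F"
  unfolding filterlim_iff
proof (intro allI impI)
  fix P assume "eventually P (unipotent_nhd n)"
  then obtain e where e: "e > 0" "\<And>h. unipotent n h \<Longrightarrow> (\<forall>r<n. \<forall>c<n. \<bar>h $$ (r, c) - 1\<^sub>m n $$ (r, c)\<bar> < e) \<Longrightarrow> P h"
    unfolding eventually_unipotent_nhd by blast
  have "\<forall>\<^sub>F x in F. \<forall>q\<in>{..<n} \<times> {..<n}. \<bar>f x $$ q - 1\<^sub>m n $$ q\<bar> < e"
  proof (rule eventually_ball_finite, simp, rule ballI)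
    fix q assume "q \<in> {..<n} \<times> {..<n}"
    then have "((\<lambda>x. f x $$ q) \<longlongrightarrow> 1\<^sub>m n $$ q) F"
      using assms(1) by (cases q) (auto simp: mat_tendsto_def simp del: index_one_mat)
    from tendstoD[OF this e(1)] show "\<forall>\<^sub>F x in F. \<bar>f x $$ q - 1\<^sub>m n $$ q\<bar> < e"
      by (simp add: dist_real_def)
  qed
  with assms(2) show "\<forall>\<^sub>F x in F. P (f x)"
    by eventually_elim (rule e(2), auto simp del: index_one_mat)
qed

lemma mat_tendsto_unipotent_nhd: "mat_tendsto n (\<lambda>h. h) (1\<^sub>m n) (unipotent_nhd n)" "\<forall>\<^sub>F h in unipotent_nhd n. unipotent n h"
proof -
  show u: "\<forall>\<^sub>F h in unipotent_nhd n. unipotent n h"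
    unfolding eventually_unipotent_nhd by (rule exI[of _ 1]) simp
  have "((\<lambda>h. h $$ (r, c)) \<longlongrightarrow> 1\<^sub>m n $$ (r, c)) (unipotent_nhd n)" if "r < n" "c < n" for r c
    unfolding tendsto_iff eventually_unipotent_nhd dist_real_def using that by blast
  then show "mat_tendsto n (\<lambda>h. h) (1\<^sub>m n) (unipotent_nhd n)"
    using u by (auto simp: mat_tendsto_def unipotent_def simp del: index_one_mat elim: eventually_mono)
qed

lemma mat_tendsto_filterlim: "mat_tendsto n f M G \<Longrightarrow> filterlim h G F \<Longrightarrow> mat_tendsto n (\<lambda>x. f (h x)) M F"
  unfolding mat_tendsto_def
  using filterlim_compose[of _ _ G h F] eventually_compose_filterlim[of _ G h F] by blast

lemma eventually_unipotent_nhd_pair: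
  assumes "eventually P (unipotent_nhd n)" 
  shows "\<exists>P1 P2. eventually P1 (unipotent_nhd n) \<and> eventually P2 (unipotent_nhd n) \<and> (\<forall>h1 h2. P1 h1 \<longrightarrow> P2 h2 \<longrightarrow> P (h1 * h2))"
proof -
  let ?F = "unipotent_nhd n \<times>\<^sub>F unipotent_nhd n"
  have "mat_tendsto n (\<lambda>q. fst q * snd q) (1\<^sub>m n * 1\<^sub>m n) ?F"
    by (intro mat_tendsto_mult mat_tendsto_filterlim[OF mat_tendsto_unipotent_nhd(1)] filterlim_fst filterlim_snd)
  moreover have "\<forall>\<^sub>F q in ?F. unipotent n (fst q * snd q)"
    using eventually_compose_filterlim[OF mat_tendsto_unipotent_nhd(2) filterlim_fst]
      eventually_compose_filterlim[OF mat_tendsto_unipotent_nhd(2) filterlim_snd]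
    by eventually_elim (rule unipotent_mult)
  ultimately have "filterlim (\<lambda>q. fst q * snd q) (unipotent_nhd n) ?F"
    by (intro filterlim_unipotent_nhd) simp_all
  from eventually_compose_filterlim[OF assms this] show ?thesis
    unfolding eventually_prod_filter by auto
qed

lemma tot_pos_mat_open_two_sided:
  assumes "tot_pos_mat n G"
  shows "\<exists>P1 P2. eventually P1 (unipotent_nhd n) \<and> eventually P2 (unipotent_nhd n) \<and> (\<forall>h1 h2. P1 h1 \<longrightarrow> P2 h2 \<longrightarrow> tot_pos_mat n (h1 * G * h2))"
proof -
  let ?F = "unipotent_nhd n \<times>\<^sub>F unipotent_nhd n"
  have G: "unipotent n G" "G \<in> carrier_mat n n" using assms by (auto simp: tot_pos_mat_def unipotent_def)
  have "mat_tendsto n (\<lambda>q. fst q * G * snd q) (1\<^sub>m n * G * 1\<^sub>m n) ?F"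
    by (intro mat_tendsto_mult mat_tendsto_filterlim[OF mat_tendsto_unipotent_nhd(1)] filterlim_fst filterlim_snd mat_tendsto_const G)
  then have lim: "((\<lambda>q. (fst q * G * snd q) $$ (r, c)) \<longlongrightarrow> G $$ (r, c)) ?F" if "r < n" "c < n" for r c
    using that G by (auto simp: mat_tendsto_def)
  have "\<forall>\<^sub>F q in ?F. tot_pos n (\<lambda>r c. (fst q * G * snd q) $$ (r, c))"
    using assms by (intro tot_pos_open[of n _ "\<lambda>r c. G $$ (r, c)"] lim) (auto simp: tot_pos_mat_def unipotent_def unipotent_array_def)
  moreover have "\<forall>\<^sub>F q in ?F. unipotent n (fst q * G * snd q)"
    using eventually_compose_filterlim[OF mat_tendsto_unipotent_nhd(2) filterlim_fst]
      eventually_compose_filterlim[OF mat_tendsto_unipotent_nhd(2) filterlim_snd]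
    by eventually_elim (intro unipotent_mult G)
  ultimately have "\<forall>\<^sub>F q in ?F. tot_pos_mat n (fst q * G * snd q)"
    by eventually_elim (simp add: tot_pos_mat_def)
  then show ?thesis
    unfolding eventually_prod_filter by auto
qed

text \<open>The exponential of \<open>t\<close> times the lower shift matrix: the flow with all rates equal to 1.\<close>

definition exp_shift :: "nat \<Rightarrow> real \<Rightarrow> real mat" where
  "exp_shift n t = Matrix.mat n n (\<lambda>(r, c). if c \<le> r then t ^ (r - c) / fact (r - c) else 0)"

lemma exp_shift_unipotent: "unipotent n (exp_shift n t)"
  by (auto simp: unipotent_def exp_shift_def)

lemma exp_shift_carrier [simp]: "exp_shift n t \<in> carrier_mat n n"
  by (simp add: exp_shift_def)

lemma exp_shift_add: "exp_shift n s * exp_shift n t = exp_shift n (s + t)"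
proof (rule eq_matI)
  fix r c assume "r < dim_row (exp_shift n (s + t))" "c < dim_col (exp_shift n (s + t))"
  then have rc: "r < n" "c < n" by (auto simp: exp_shift_def)
  have "(exp_shift n s * exp_shift n t) $$ (r, c) = (\<Sum>k<n. exp_shift n s $$ (r, k) * exp_shift n t $$ (k, c))"
    using rc by (intro mult_index) auto
  also have "\<dots> = exp_shift n (s + t) $$ (r, c)"
  proof (cases "c \<le> r")
    case True
    have "(\<Sum>k<n. exp_shift n s $$ (r, k) * exp_shift n t $$ (k, c)) = (\<Sum>k\<in>{c..r}. s ^ (r - k) / fact (r - k) * (t ^ (k - c) / fact (k - c)))"
      using rc by (intro sum.mono_neutral_cong_right) (auto simp: exp_shift_def)
    also have "\<dots> = (\<Sum>i\<le>r-c. t ^ i / fact i * (s ^ (r - c - i) / fact (r - c - i)))"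
      using True by (intro sum.reindex_bij_witness[of _ "\<lambda>i. c + i" "\<lambda>k. k - c"]) (auto simp: mult.commute)
    also have "\<dots> = (t + s) ^ (r - c) / fact (r - c)"
      using exp_series_add_commuting[of t s "r - c"] by (simp add: divide_inverse mult_ac)
    finally show ?thesis using rc True by (simp add: exp_shift_def add.commute)
  next
    case False
    have "(\<Sum>k<n. exp_shift n s $$ (r, k) * exp_shift n t $$ (k, c)) = 0"
      using rc False by (intro sum.neutral) (auto simp: exp_shift_def)
    then show ?thesis using rc False by (simp add: exp_shift_def)
  qed
  finally show "(exp_shift n s * exp_shift n t) $$ (r, c) = exp_shift n (s + t) $$ (r, c)" .
qed (auto simp: exp_shift_def)

lemma exp_shift_0: "exp_shift n 0 = 1\<^sub>m n"
  by (rule eq_matI) (auto simp: exp_shift_def power_0_left)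

lemma exp_shift_deriv:
  assumes "r < n" "Suc i < n"
  shows "((\<lambda>t. exp_shift n t $$ (r, i)) has_real_derivative exp_shift n t $$ (r, Suc i)) (at t within S)"
proof (cases "i < r")
  case True
  define m where "m = r - Suc i"
  have m: "r - i = Suc m" using True by (simp add: m_def)
  have "((\<lambda>t. t ^ Suc m / fact (Suc m)) has_real_derivative (real (Suc m) * t ^ m) / fact (Suc m)) (at t within S)"
    by (auto intro!: derivative_eq_intros simp del: power_Suc fact_Suc of_nat_Suc)
  moreover have "(real (Suc m) * t ^ m) / fact (Suc m) = t ^ m / fact m"
    by (simp add: fact_Suc field_simps del: of_nat_Suc)
  ultimately show ?thesis using assms True m by (simp add: exp_shift_def m_def)
next
  case False
  then show ?thesis using assms by (cases "i = r") (auto simp: exp_shift_def)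
qed

lemma exp_shift_tendsto: "r < n \<Longrightarrow> c < n \<Longrightarrow> ((\<lambda>t. exp_shift n t $$ (r, c)) \<longlongrightarrow> exp_shift n s $$ (r, c)) (at s within S)"
  by (cases "c \<le> r") (auto simp: exp_shift_def intro!: tendsto_intros)

lemma exp_shift_filterlim:
  "filterlim (exp_shift n) (unipotent_nhd n) (at_right 0)" "filterlim (\<lambda>t. exp_shift n (- t)) (unipotent_nhd n) (at_right 0)"
proof -
  show "filterlim (exp_shift n) (unipotent_nhd n) (at_right 0)"
    by (rule filterlim_unipotent_nhd) (auto simp: mat_tendsto_def exp_shift_unipotent exp_shift_0[symmetric] exp_shift_tendsto simp del: index_one_mat)
  have "((\<lambda>t. exp_shift n (- t) $$ (r, c)) \<longlongrightarrow> exp_shift n (- 0) $$ (r, c)) (at_right 0)" if "r < n" "c < n" for r c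
    using that by (cases "c \<le> r") (auto simp: exp_shift_def intro!: tendsto_eq_intros)
  then show "filterlim (\<lambda>t. exp_shift n (- t)) (unipotent_nhd n) (at_right 0)"
    by (intro filterlim_unipotent_nhd) (auto simp: mat_tendsto_def exp_shift_unipotent exp_shift_0[symmetric] simp del: index_one_mat)
qed

lemma elem_step_filterlim:
  "filterlim (elem_step n i) (unipotent_nhd n) (at_right 0)" "filterlim (\<lambda>d. elem_step n i (- d)) (unipotent_nhd n) (at_right 0)"
proof -
  have "((\<lambda>d. elem_step n i (f d) $$ (r, c)) \<longlongrightarrow> 1\<^sub>m n $$ (r, c)) (at_right 0)"
    if "r < n" "c < n" and f: "(f \<longlongrightarrow> 0) (at_right (0::real))" for r c f
    using that by (cases "c = i \<and> r = Suc i") (auto simp: elem_step_def)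
  then have *: "filterlim (\<lambda>d. elem_step n i (f d)) (unipotent_nhd n) (at_right 0)" if "(f \<longlongrightarrow> 0) (at_right (0::real))" for f
    using that by (intro filterlim_unipotent_nhd) (auto simp: mat_tendsto_def unipotent_elem_step simp del: index_one_mat)
  show "filterlim (elem_step n i) (unipotent_nhd n) (at_right 0)" "filterlim (\<lambda>d. elem_step n i (- d)) (unipotent_nhd n) (at_right 0)"
    by (rule *, (intro tendsto_eq_intros; simp))+
qed

lemma exp_shift_tot_pos_mat:
  assumes "t > 0"
  shows "tot_pos_mat n (exp_shift n t)"
proof -
  have "tot_pos n (\<lambda>r c. exp_shift n t $$ (r, c))"
  proof (rule tot_pos_flow[of 0 t n "\<lambda>t r c. exp_shift n t $$ (r, c)" "\<lambda>_ _. 1" "\<lambda>_ t. t"])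
    show "unipotent_array n (\<lambda>r c. exp_shift n s $$ (r, c))" for s
      using exp_shift_unipotent[of n s] by (simp add: unipotent_array_def unipotent_def)
    show "((\<lambda>t. exp_shift n t $$ (r, i)) \<longlongrightarrow> (if r = i then 1 else 0)) (at_right 0)" if "r < n" "i < n" for r i
      using exp_shift_tendsto[OF that, of 0 "{0<..}"] that by (simp add: exp_shift_0)
  qed (use assms exp_shift_deriv in \<open>auto intro!: tendsto_intros\<close>)
  then show ?thesis by (simp add: tot_pos_mat_def exp_shift_unipotent)
qed

lemma elem_step_inverse: "Suc i < n \<Longrightarrow> elem_step n i (- d) * elem_step n i d = 1\<^sub>m n"
proof (rule eq_matI)
  fix r c assume "Suc i < n" "r < dim_row (1\<^sub>m n)" "c < dim_col (1\<^sub>m n)"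
  then show "(elem_step n i (- d) * elem_step n i d) $$ (r, c) = 1\<^sub>m n $$ (r, c)"
    by (simp add: mult_elem_step_index) (auto simp: elem_step_def)
qed (auto simp: elem_step_def)

section \<open>The order of vanishing of the leading wedge\<close>

text \<open>Repeated application of L'Hospital's rule, from \<open>a\<close> downwards.\<close>

lemma leading_term:
  fixes f :: "nat \<Rightarrow> real \<Rightarrow> real"
  assumes J: "is_interval J" "x \<in> J"
    and der: "\<And>i t. i < a \<Longrightarrow> t \<in> J \<Longrightarrow> (f i has_real_derivative \<rho> i t * f (Suc i) t) (at t within J)"
    and z: "\<And>i. i < a \<Longrightarrow> f i x = 0"
    and \<rho>: "\<And>i. i < a \<Longrightarrow> continuous_on J (\<rho> i)"
    and fa: "(f a \<longlongrightarrow> f a x) (at x within J)"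
    and i: "i \<le> a"
  shows "((\<lambda>t. f i t / (t - x) ^ (a - i)) \<longlongrightarrow> f a x * (\<Prod>j\<in>{i..<a}. \<rho> j x) / fact (a - i)) (at x within J)"
  using i
proof (induction i rule: inc_induct)
  case base
  then show ?case using fa by simp
next
  case (step i)
  define r where "r = a - Suc i"
  have r: "a - i = Suc r" using step.hyps by (simp add: r_def)
  have \<rho>i: "(\<rho> i \<longlongrightarrow> \<rho> i x) (at x within J)"
    using \<rho>[OF step.hyps(2)] J(2) by (simp add: continuous_on_def)
  let ?L = "\<rho> i x * (f a x * (\<Prod>j\<in>{Suc i..<a}. \<rho> j x) / fact r)"
  have "((\<lambda>t. \<rho> i t * (f (Suc i) t / (t - x) ^ r)) \<longlongrightarrow> ?L) (at x within J)"
    using step.IH unfolding r_def by (intro tendsto_mult \<rho>i)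
  then have l: "((\<lambda>t. \<rho> i t * f (Suc i) t / (t - x) ^ r) \<longlongrightarrow> ?L) (at x within J)" by simp
  have "((\<lambda>t. f i t / (t - x) ^ Suc r) \<longlongrightarrow> ?L / real (Suc r)) (at x within J)"
  proof (rule tendsto_quotient_from_deriv[OF J _ _ l])
    show "f i x = 0" using z step.hyps by simp
    show "\<rho> i x * f (Suc i) x = 0" if "r > 0" using z[of "Suc i"] step.hyps that by (simp add: r_def)
    show "\<rho> i x * f (Suc i) x = ?L" if "r = 0"
    proof -
      have "a = Suc i" using that step.hyps by (simp add: r_def)
      then show ?thesis using that by simp
    qed
  qed (use der step.hyps in auto)
  moreover have "(\<Prod>j\<in>{i..<a}. \<rho> j x) = \<rho> i x * (\<Prod>j\<in>{Suc i..<a}. \<rho> j x)"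
    using step.hyps by (simp add: prod.atLeast_Suc_lessThan)
  ultimately show ?case
    unfolding r by (simp add: fact_Suc mult_ac del: power_Suc of_nat_Suc)
qed

definition flow :: "nat \<Rightarrow> real set \<Rightarrow> (nat \<Rightarrow> real \<Rightarrow> real) \<Rightarrow> (real \<Rightarrow> real mat) \<Rightarrow> bool" where
  "flow n J \<rho> \<Gamma> \<longleftrightarrow> (\<forall>t\<in>J. unipotent n (\<Gamma> t)) \<and>
     (\<forall>i t. Suc i < n \<longrightarrow> t \<in> J \<longrightarrow> \<rho> i t > 0) \<and> (\<forall>i. Suc i < n \<longrightarrow> continuous_on J (\<rho> i)) \<and>
     (\<forall>r i t. r < n \<longrightarrow> Suc i < n \<longrightarrow> t \<in> J \<longrightarrow>
        ((\<lambda>t. \<Gamma> t $$ (r, i)) has_real_derivative \<rho> i t * \<Gamma> t $$ (r, Suc i)) (at t within J))"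

text \<open>The pivots of a sequence of plane vectors: \<open>a\<close> is the index of the first nonzero vector, \<open>b\<close> that of the first one that is not parallel
to it.\<close>

definition position :: "nat \<Rightarrow> (nat \<Rightarrow> real \<times> real) \<Rightarrow> nat \<Rightarrow> nat \<Rightarrow> bool" where
  "position n v a b \<longleftrightarrow> a < b \<and> b < n \<and> (\<forall>i<a. v i = 0) \<and> (\<forall>i<b. wedge (v a) (v i) = 0) \<and> wedge (v a) (v b) \<noteq> 0"

lemma wedge_parallel_trans:
  assumes "wedge w x = 0" "wedge w y = 0" "w \<noteq> 0"
  shows "wedge x y = 0"
proof -
  have "fst w * wedge x y = wedge w y * fst x - wedge w x * fst y" "snd w * wedge x y = wedge w y * snd x - wedge w x * snd y"
    by (simp_all add: wedge_def algebra_simps)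
  then have "fst w * wedge x y = 0" "snd w * wedge x y = 0" using assms(1,2) by simp_all
  moreover have "fst w \<noteq> 0 \<or> snd w \<noteq> 0" using assms(3) by (auto simp: prod_eq_iff)
  ultimately show ?thesis by auto
qed

lemma position_exists:
  assumes "i < n" "j < n" "wedge (v i) (v j) \<noteq> 0"
  shows "\<exists>a b. position n v a b"
proof -
  define a where "a = (LEAST i. v i \<noteq> 0)"
  have vi: "v i \<noteq> 0" using assms(3) by auto
  have a: "v a \<noteq> 0" "a \<le> i" unfolding a_def using LeastI[of "\<lambda>i. v i \<noteq> 0", OF vi] Least_le[of "\<lambda>i. v i \<noteq> 0", OF vi] by auto
  have az: "v k = 0" if "k < a" for k using not_less_Least[OF that[unfolded a_def]] by simp
  have "\<exists>k<n. wedge (v a) (v k) \<noteq> 0"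
  proof (rule ccontr)
    assume "\<not> ?thesis"
    then have "wedge (v a) (v i) = 0" "wedge (v a) (v j) = 0" using assms by auto
    from wedge_parallel_trans[OF this a(1)] assms(3) show False by simp
  qed
  then obtain k where k: "k < n" "wedge (v a) (v k) \<noteq> 0" by blast
  define b where "b = (LEAST k. wedge (v a) (v k) \<noteq> 0)"
  have b: "wedge (v a) (v b) \<noteq> 0" "b \<le> k" unfolding b_def
    using LeastI[of "\<lambda>k. wedge (v a) (v k) \<noteq> 0", OF k(2)] Least_le[of "\<lambda>k. wedge (v a) (v k) \<noteq> 0", OF k(2)] by auto
  have bz: "wedge (v a) (v l) = 0" if "l < b" for l using not_less_Least[OF that[unfolded b_def]] by simp
  have "b \<noteq> a" using b(1) by auto
  moreover have "\<not> b < a" using b(1) az by auto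
  ultimately have "a < b" by simp
  then have "position n v a b" using az b bz k(1) unfolding position_def by auto
  then show ?thesis by blast
qed

text \<open>In the basis \<open>v\<^sub>a(x), v\<^sub>b(x)\<close> of the plane let \<open>v\<^sub>i\<close> have the coordinates \<open>f\<^sub>i\<close>, \<open>g\<^sub>i\<close>. By \<open>leading_term\<close> they are of order \<open>a - i\<close> and
\<open>b - i\<close> at \<open>x\<close>, and \<open>f\<^sub>0 g\<^sub>1 - f\<^sub>1 g\<^sub>0\<close> has order \<open>a + b - 1\<close>: the leading coefficients of the two products do not cancel,
their difference being proportional to \<open>b - a\<close>. For \<open>a = 0\<close>, where this formula has no meaning for \<open>f\<^sub>1\<close>, the second product is of higher order.\<close>

lemma wedge_leading:
  assumes J: "is_interval J" "x \<in> J" and fl: "flow n J \<rho> \<Gamma>"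
    and ab: "position n (state n A (\<Gamma> x)) a b"
  shows "\<exists>C>0. ((\<lambda>t. lead_wedge n A (\<Gamma> t) / (t - x) ^ (a + b - 1)) \<longlongrightarrow>
     C * wedge (state n A (\<Gamma> x) a) (state n A (\<Gamma> x) b)) (at x within J)"
proof -
  define \<alpha> where "\<alpha> = state n A (\<Gamma> x) a"
  define \<beta> where "\<beta> = state n A (\<Gamma> x) b"
  define D where "D = wedge \<alpha> \<beta>"
  have lt: "a < b" "b < n" and za: "\<And>i. i < a \<Longrightarrow> state n A (\<Gamma> x) i = 0"
    and zb: "\<And>i. i < b \<Longrightarrow> wedge \<alpha> (state n A (\<Gamma> x) i) = 0" and D: "D \<noteq> 0"
    using ab unfolding position_def \<alpha>_def \<beta>_def D_def by auto
  \<comment> \<open>The coordinate functionals of the basis \<open>\<alpha>\<close>, \<open>\<beta>\<close>, composed with \<open>A\<close>.\<close>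
  define \<phi> where "\<phi> r = (fst A r * snd \<beta> - snd A r * fst \<beta>) / D" for r
  define \<psi> where "\<psi> r = (fst \<alpha> * snd A r - snd \<alpha> * fst A r) / D" for r
  define f where "f i t = pairing n \<phi> (col_fun (\<Gamma> t) i)" for i t
  define g where "g i t = pairing n \<psi> (col_fun (\<Gamma> t) i)" for i t
  have f_eq: "f i t = wedge (state n A (\<Gamma> t) i) \<beta> / D" and g_eq: "g i t = wedge \<alpha> (state n A (\<Gamma> t) i) / D" if "i < n" for i t
    using that by (simp_all add: f_def g_def \<phi>_def \<psi>_def pairing_def state_def plane_image_def wedge_def
        sum_divide_distrib sum_distrib_left sum_distrib_right sum_subtractf[symmetric] algebra_simps)
  have der: "((\<lambda>t. pairing n \<eta> (col_fun (\<Gamma> t) i)) has_real_derivative \<rho> i t * pairing n \<eta> (col_fun (\<Gamma> t) (Suc i))) (at t within J)"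
    if "Suc i < n" "t \<in> J" for \<eta> i t
  proof -
    have "((\<lambda>t. \<Sum>r<n. \<eta> r * \<Gamma> t $$ (r, i)) has_real_derivative (\<Sum>r<n. \<eta> r * (\<rho> i t * \<Gamma> t $$ (r, Suc i)))) (at t within J)"
      using fl that unfolding flow_def by (intro DERIV_sum DERIV_cmult) auto
    moreover have "(\<Sum>r<n. \<eta> r * (\<rho> i t * \<Gamma> t $$ (r, Suc i))) = \<rho> i t * (\<Sum>r<n. \<eta> r * \<Gamma> t $$ (r, Suc i))"
      by (simp add: sum_distrib_left mult_ac)
    ultimately show ?thesis by (simp add: pairing_def col_fun_def)
  qed
  have cont: "((\<lambda>t. pairing n \<eta> (col_fun (\<Gamma> t) i)) \<longlongrightarrow> pairing n \<eta> (col_fun (\<Gamma> x) i)) (at x within J)" if "i < n" for \<eta> i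
  proof (cases "Suc i < n")
    case True
    from DERIV_continuous[OF der[OF this J(2)]] show ?thesis by (simp add: continuous_within)
  next
    case False
    then have i: "i = n - 1" using that by simp
    have "\<Gamma> t $$ (r, i) = \<Gamma> x $$ (r, i)" if "t \<in> J" "r < n" for t r
    proof (cases "r = i")
      case True
      then show ?thesis using fl that J(2) i unfolding flow_def unipotent_def by auto
    next
      case False
      then have "r < i" "i < n" using i that by auto
      then show ?thesis using fl that J(2) unfolding flow_def unipotent_def by auto
    qed
    then have "pairing n \<eta> (col_fun (\<Gamma> t) i) = pairing n \<eta> (col_fun (\<Gamma> x) i)" if "t \<in> J" for t
      using that unfolding pairing_def col_fun_def by (intro sum.cong) auto
    then have "\<forall>\<^sub>F t in at x within J. pairing n \<eta> (col_fun (\<Gamma> x) i) = pairing n \<eta> (col_fun (\<Gamma> t) i)"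
      by (auto simp: eventually_at_filter)
    from Lim_transform_eventually[OF tendsto_const this] show ?thesis .
  qed
  have \<rho>: "continuous_on J (\<rho> i)" "\<rho> i x > 0" if "i < b" for i
    using fl that lt J(2) unfolding flow_def by auto
  have lf: "((\<lambda>t. f i t / (t - x) ^ (a - i)) \<longlongrightarrow> (\<Prod>j\<in>{i..<a}. \<rho> j x) / fact (a - i)) (at x within J)" if "i \<le> a" for i
  proof -
    have "f a x = 1" using lt D f_eq[of a x] by (simp add: D_def \<alpha>_def)
    then show ?thesis
      using leading_term[OF J, of a f \<rho> i] der cont[of a \<phi>] za f_eq \<rho> lt that by (simp add: f_def[abs_def])
  qed
  have lg: "((\<lambda>t. g i t / (t - x) ^ (b - i)) \<longlongrightarrow> (\<Prod>j\<in>{i..<b}. \<rho> j x) / fact (b - i)) (at x within J)" if "i \<le> b" for i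
  proof -
    have "g b x = 1" using lt D g_eq[of b x] by (simp add: D_def \<beta>_def)
    then show ?thesis
      using leading_term[OF J, of b g \<rho> i] der cont[of b \<psi>] zb g_eq \<rho> lt that by (simp add: g_def[abs_def])
  qed
  have lw: "lead_wedge n A (\<Gamma> t) = (f 0 t * g 1 t - f 1 t * g 0 t) * D" for t
  proof -
    have n: "0 < n" "1 < n" using lt by auto
    let ?v = "state n A (\<Gamma> t) 0" and ?w = "state n A (\<Gamma> t) 1"
    have "(wedge ?v \<beta> * wedge \<alpha> ?w - wedge ?w \<beta> * wedge \<alpha> ?v) = wedge ?v ?w * wedge \<alpha> \<beta>"
      by (simp add: wedge_def algebra_simps)
    then show ?thesis
      using D unfolding lead_wedge_def f_eq[OF n(1)] f_eq[OF n(2)] g_eq[OF n(1)] g_eq[OF n(2)]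
      by (simp add: D_def field_simps)
  qed
  have "\<exists>C>0. ((\<lambda>t. (f 0 t * g 1 t - f 1 t * g 0 t) / (t - x) ^ (a + b - 1)) \<longlongrightarrow> C) (at x within J)"
  proof (cases a)
    case 0
    have g1: "((\<lambda>t. g 1 t / (t - x) ^ (b - 1)) \<longlongrightarrow> (\<Prod>j\<in>{1..<b}. \<rho> j x) / fact (b - 1)) (at x within J)"
      using lg[of 1] lt by simp
    have g0: "((\<lambda>t. g 0 t / (t - x) ^ b) \<longlongrightarrow> (\<Prod>j\<in>{0..<b}. \<rho> j x) / fact b) (at x within J)"
      using lg[of 0] by simp
    have f0: "(f 0 \<longlongrightarrow> 1) (at x within J)" using lf[of 0] 0 by simp
    have f1: "(f 1 \<longlongrightarrow> f 1 x) (at x within J)" using cont[of 1 \<phi>] lt by (simp add: f_def[abs_def])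
    have t0: "((\<lambda>t. t - x) \<longlongrightarrow> 0) (at x within J)"
      by (intro tendsto_eq_intros) auto
    have "((\<lambda>t. f 0 t * (g 1 t / (t - x) ^ (b - 1)) - f 1 t * ((g 0 t / (t - x) ^ b) * (t - x))) \<longlongrightarrow>
        1 * ((\<Prod>j\<in>{1..<b}. \<rho> j x) / fact (b - 1)) - f 1 x * (((\<Prod>j\<in>{0..<b}. \<rho> j x) / fact b) * 0)) (at x within J)"
      by (intro tendsto_diff tendsto_mult f0 f1 g0 g1 t0)
    moreover have "\<forall>\<^sub>F t in at x within J. f 0 t * (g 1 t / (t - x) ^ (b - 1)) - f 1 t * ((g 0 t / (t - x) ^ b) * (t - x)) =
       (f 0 t * g 1 t - f 1 t * g 0 t) / (t - x) ^ (a + b - 1)"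
    proof -
      obtain b' where b': "b = Suc b'" using lt by (cases b) auto
      show ?thesis
        unfolding eventually_at_filter using 0 b' by (auto intro!: always_eventually simp: diff_divide_distrib)
    qed
    ultimately have "((\<lambda>t. (f 0 t * g 1 t - f 1 t * g 0 t) / (t - x) ^ (a + b - 1)) \<longlongrightarrow>
      (\<Prod>j\<in>{1..<b}. \<rho> j x) / fact (b - 1)) (at x within J)"
      by (simp add: tendsto_cong)
    moreover have "(\<Prod>j\<in>{1..<b}. \<rho> j x) / fact (b - 1) > 0"
      using \<rho>(2) by (intro divide_pos_pos prod_pos) auto
    ultimately show ?thesis by blast
  next
    case (Suc a')
    obtain b' where b': "b = Suc b'" using lt by (cases b) auto
    let ?R = "\<lambda>c. \<Prod>j\<in>{1..<c}. \<rho> j x"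
    have R: "(\<Prod>j\<in>{0..<Suc c}. \<rho> j x) = \<rho> 0 x * ?R (Suc c)" for c
      by (simp add: prod.atLeast_Suc_lessThan)
    have L: "((\<lambda>t. f 0 t / (t - x) ^ Suc a') \<longlongrightarrow> \<rho> 0 x * ?R a / fact (Suc a')) (at x within J)"
      "((\<lambda>t. f 1 t / (t - x) ^ a') \<longlongrightarrow> ?R a / fact a') (at x within J)"
      "((\<lambda>t. g 0 t / (t - x) ^ Suc b') \<longlongrightarrow> \<rho> 0 x * ?R b / fact (Suc b')) (at x within J)"
      "((\<lambda>t. g 1 t / (t - x) ^ b') \<longlongrightarrow> ?R b / fact b') (at x within J)"
      using lf[of 0] lf[of 1] lg[of 0] lg[of 1] unfolding Suc b' R by (simp_all del: power_Suc fact_Suc)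
    have lim: "((\<lambda>t. f 0 t / (t - x) ^ Suc a' * (g 1 t / (t - x) ^ b') - f 1 t / (t - x) ^ a' * (g 0 t / (t - x) ^ Suc b')) \<longlongrightarrow>
        \<rho> 0 x * ?R a / fact (Suc a') * (?R b / fact b') - ?R a / fact a' * (\<rho> 0 x * ?R b / fact (Suc b'))) (at x within J)"
      by (intro tendsto_diff tendsto_mult L)
    have eq1: "f 0 t / (t - x) ^ Suc a' * (g 1 t / (t - x) ^ b') - f 1 t / (t - x) ^ a' * (g 0 t / (t - x) ^ Suc b') =
       (f 0 t * g 1 t - f 1 t * g 0 t) / (t - x) ^ (a + b - 1)" for t
      by (simp add: Suc b' power_add diff_divide_distrib mult_ac)
    have eq2: "\<rho> 0 x * ?R a / fact (Suc a') * (?R b / fact b') - ?R a / fact a' * (\<rho> 0 x * ?R b / fact (Suc b')) =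
       \<rho> 0 x * ?R a * ?R b * (real b - real a) / (fact (Suc a') * fact (Suc b'))"
    proof -
      have "r * R / (p * A) * (S / B) - R / A * (r * S / (q * B)) = r * R * S * (q - p) / ((p * A) * (q * B))"
        if "A \<noteq> 0" "B \<noteq> 0" "p \<noteq> 0" "q \<noteq> 0" for r R S A B p q :: real
        using that by (simp add: field_simps)
      from this[of "fact a'" "fact b'" "real (Suc a')" "real (Suc b')"] show ?thesis
        unfolding Suc b' fact_Suc by (simp del: of_nat_Suc)
    qed
    have "\<rho> 0 x * ?R a * ?R b * (real b - real a) / (fact (Suc a') * fact (Suc b')) > 0"
      using \<rho>(2) lt Suc by (intro divide_pos_pos mult_pos_pos prod_pos) auto
    then show ?thesis using lim unfolding eq1 eq2 by blast
  qed
  then obtain C where C: "C > 0" "((\<lambda>t. (f 0 t * g 1 t - f 1 t * g 0 t) / (t - x) ^ (a + b - 1)) \<longlongrightarrow> C) (at x within J)" by blast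
  have "((\<lambda>t. (f 0 t * g 1 t - f 1 t * g 0 t) / (t - x) ^ (a + b - 1) * D) \<longlongrightarrow> C * D) (at x within J)"
    by (intro tendsto_mult C tendsto_const)
  then show ?thesis
    unfolding lw using C(1) by (auto simp: D_def \<alpha>_def \<beta>_def)
qed

section \<open>Zeros of the leading wedge along a flow\<close>

lemma ex_at_right: "\<forall>\<^sub>F t in at_right (0::real). P t \<Longrightarrow> \<exists>t. P t"
  by (rule eventually_happens') auto

lemma flow_exp_shift: "flow n UNIV (\<lambda>_ _. 1) (exp_shift n)"
  unfolding flow_def using exp_shift_deriv[of _ n] by (auto simp: exp_shift_unipotent)

lemma pairing_mult:
  assumes "H \<in> carrier_mat n n" "G \<in> carrier_mat n n" "c < n"
  shows "pairing n f (col_fun (H * G) c) = pairing n (\<lambda>k. pairing n f (col_fun H k)) (col_fun G c)"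
proof -
  have "pairing n f (col_fun (H * G) c) = (\<Sum>r<n. \<Sum>k<n. f r * H $$ (r, k) * G $$ (k, c))"
    unfolding pairing_def col_fun_def using assms
    by (intro sum.cong refl) (simp add: mult_index[of _ n] sum_distrib_left mult_ac del: index_mult_mat)
  also have "\<dots> = (\<Sum>k<n. \<Sum>r<n. f r * H $$ (r, k) * G $$ (k, c))" by (rule sum.swap)
  finally show ?thesis by (simp add: pairing_def col_fun_def sum_distrib_right)
qed

text \<open>Moves a left factor of the matrix into the linear map to the plane.\<close>

definition pull_back :: "nat \<Rightarrow> (nat \<Rightarrow> real) \<times> (nat \<Rightarrow> real) \<Rightarrow> real mat \<Rightarrow> (nat \<Rightarrow> real) \<times> (nat \<Rightarrow> real)" where
  "pull_back n A H = (\<lambda>k. pairing n (fst A) (col_fun H k), \<lambda>k. pairing n (snd A) (col_fun H k))"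

lemma state_mult:
  assumes "H \<in> carrier_mat n n" "G \<in> carrier_mat n n"
  shows "state n A (H * G) = state n (pull_back n A H) G"
  using pairing_mult[OF assms] by (auto simp: state_def plane_image_def pull_back_def)

lemma state_pull_back_one:
  assumes "H \<in> carrier_mat n n"
  shows "state n (pull_back n A H) (1\<^sub>m n) = state n A H"
  using state_mult[OF assms one_carrier_mat] assms by simp

text \<open>Immediately after a zero the leading wedge has the sign of the determinant of the two pivot vectors, by \<open>wedge_leading\<close> for
\<open>exp_shift\<close>.\<close>

lemma exp_shift_lead_sign:
  assumes "H \<in> carrier_mat n n" "position n (state n A H) a b"
  shows "\<forall>\<^sub>F t in at_right 0. lead_wedge n A (H * exp_shift n t) \<noteq> 0 \<and>
     (lead_wedge n A (H * exp_shift n t) > 0) = (wedge (state n A H a) (state n A H b) > 0)"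
proof -
  let ?B = "pull_back n A H"
  have st: "state n ?B (exp_shift n 0) = state n A H" unfolding exp_shift_0 by (rule state_pull_back_one[OF assms(1)])
  have lw: "lead_wedge n A (H * exp_shift n t) = lead_wedge n ?B (exp_shift n t)" for t
    unfolding lead_wedge_def state_mult[OF assms(1) exp_shift_carrier] ..
  obtain C where C: "C > 0" "((\<lambda>t. lead_wedge n ?B (exp_shift n t) / (t - 0) ^ (a + b - 1)) \<longlongrightarrow> C * wedge (state n A H a) (state n A H b)) (at 0)"
    using wedge_leading[OF is_interval_univ UNIV_I[of 0] flow_exp_shift[of n], of ?B, unfolded st, OF assms(2)] by auto
  have w: "wedge (state n A H a) (state n A H b) \<noteq> 0" using assms(2) by (simp add: position_def)
  have "((\<lambda>t. lead_wedge n ?B (exp_shift n t) / t ^ (a + b - 1)) \<longlongrightarrow> C * wedge (state n A H a) (state n A H b)) (at_right 0)"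
    using C(2) by (auto intro: tendsto_mono[OF at_le])
  from eventually_same_sign[OF this]
  have "\<forall>\<^sub>F t in at_right 0. lead_wedge n ?B (exp_shift n t) / t ^ (a + b - 1) \<noteq> 0 \<and>
     (lead_wedge n ?B (exp_shift n t) / t ^ (a + b - 1) > 0) = (C * wedge (state n A H a) (state n A H b) > 0)"
    using C(1) w by simp
  moreover have "\<forall>\<^sub>F t::real in at_right 0. t > 0" by (simp add: eventually_at_right_less)
  ultimately show ?thesis
  proof eventually_elim
    case (elim t)
    have "t ^ (a + b - 1) > 0" using elim by simp
    then show ?case using elim C(1) unfolding lw by (auto simp: zero_less_mult_iff zero_less_divide_iff)
  qed
qed

lemma product_chain_unipotent:
  assumes "product_chain n (tot_pos_mat n) Hs"
  shows "Hs \<noteq> [] \<and> (\<forall>H\<in>set Hs. unipotent n H)"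
  using assms by induction (auto intro: unipotent_mult tot_pos_mat_unipotent)

lemma product_chain_left_mult:
  assumes "product_chain n (tot_pos_mat n) Hs" "unipotent n X"
  shows "product_chain n (tot_pos_mat n) (map ((*) X) Hs)"
  using assms(1)
proof induction
  case (single H)
  then show ?case using assms(2) by (auto intro: product_chain.single unipotent_mult)
next
  case (snoc Hs P)
  have "Hs \<noteq> []" "unipotent n (last Hs)" using product_chain_unipotent[OF snoc.hyps(1)] by auto
  then have "X * (last Hs * P) = last (map ((*) X) Hs) * P"
    using assms(2) snoc.hyps(2) by (simp add: last_map assoc_mult_mat[of _ n n _ n _ n] mult_carrier_mat[of _ n n _ n] unipotent_carrier tot_pos_mat_unipotent)
  then show ?case using product_chain.snoc[of n "tot_pos_mat n" "map ((*) X) Hs" P] snoc by simp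
qed

lemma product_chain_append:
  assumes "product_chain n (tot_pos_mat n) Ks" "product_chain n (tot_pos_mat n) Hs" "hd Ks = last Hs * P" "tot_pos_mat n P"
  shows "product_chain n (tot_pos_mat n) (Hs @ Ks)"
  using assms
proof induction
  case (single H)
  then show ?case by (auto intro: product_chain.snoc)
next
  case (snoc Ks P')
  have "Ks \<noteq> []" using product_chain_unipotent[OF snoc.hyps(1)] by simp
  then show ?case
    using product_chain.snoc[of n "tot_pos_mat n" "Hs @ Ks" P'] snoc by simp
qed

lemma changes_append: "changes xs + changes ys \<le> changes (xs @ ys)"
proof (induction xs rule: changes.induct)
  case (1 a b xs)
  then show ?case by simp
next
  case ("2_2" v)
  then show ?case by (cases ys) auto
qed simp

text \<open>A backward step \<open>v\<^sub>i \<mapsto> v\<^sub>i - d v\<^bsub>i+1\<^esub>\<close> just before one of the pivots lowers \<open>a + b\<close> by one and reverses the sign of the determinant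
of the pivot vectors. By induction there is a chain that starts near the modified matrix and changes sign \<open>a + b - 2\<close> times; it
ends with the sign opposite to the one of \<open>H * exp_shift n t\<close>. Appending this matrix adds the missing change. The
factor from the end of the chain to it is close to \<open>exp_shift n t\<close> if \<open>d\<close> and the chain are small, hence totally positive. The predicate \<open>Q\<close>
keeps the start of the chain close to the identity.\<close>

theorem split_zero:
  assumes H: "H \<in> carrier_mat n n" and "position n (state n A H) a b" and "eventually Q (unipotent_nhd n)"
  shows "\<forall>\<^sub>F t in at_right 0. \<exists>hs. product_chain n (tot_pos_mat n) hs \<and> last hs = exp_shift n t \<and> Q (hd hs) \<and>
     (\<forall>h\<in>set hs. lead_wedge n A (H * h) \<noteq> 0) \<and>
     a + b - 1 \<le> changes (map (\<lambda>h. lead_wedge n A (H * h) > 0) hs) \<and>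
     (lead_wedge n A (H * exp_shift n t) > 0) = (wedge (state n A H a) (state n A H b) > 0)"
  using assms
proof (induction "a + b" arbitrary: H a b Q rule: less_induct)
  case less
  note H = less.prems(1) and pos = less.prems(2) and Q = less.prems(3)
  have ab: "a < b" "b < n" using pos by (auto simp: position_def)
  have sgn: "\<forall>\<^sub>F t in at_right 0. lead_wedge n A (H * exp_shift n t) \<noteq> 0 \<and>
     (lead_wedge n A (H * exp_shift n t) > 0) = (wedge (state n A H a) (state n A H b) > 0)"
    by (rule exp_shift_lead_sign[OF H pos])
  have tp: "\<forall>\<^sub>F t::real in at_right 0. t > 0" by (simp add: eventually_at_right_less)
  have QEt: "\<forall>\<^sub>F t in at_right 0. Q (exp_shift n t)"
    by (rule eventually_compose_filterlim[OF Q exp_shift_filterlim(1)])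
  show ?case
  proof (cases "a = 0 \<and> b = 1")
    case True
    show ?thesis
      using sgn QEt
    proof eventually_elim
      case (elim t)
      then show ?case using True
        by (intro exI[of _ "[exp_shift n t]"]) (auto intro: product_chain.single exp_shift_unipotent)
    qed
  next
    case False
    \<comment> \<open>Move the second pivot forward if there is room, and the first one otherwise.\<close>
    define i where "i = (if b = Suc a then a - 1 else b - 1)"
    define a' where "a' = (if b = Suc a then a - 1 else a)"
    define b' where "b' = (if b = Suc a then b else b - 1)"
    have i: "Suc i < n" and sum': "a' + b' < a + b" "a + b - 1 = Suc (a' + b' - 1)"
      using ab False by (auto simp: i_def a'_def b'_def split: if_splits)
    have st': "state n A (H * elem_step n i (- d)) = (state n A H)(i := state n A H i - d *\<^sub>R state n A H (Suc i))" for d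
      using state_mult_elem_step[OF H i, of A "- d"] by simp
    have pos': "position n (state n A (H * elem_step n i (- d))) a' b'"
      and sg': "wedge (state n A (H * elem_step n i (- d)) a') (state n A (H * elem_step n i (- d)) b') = - d * wedge (state n A H a) (state n A H b)"
      if d: "d > 0" for d
    proof -
      let ?v = "state n A H"
      have za: "?v k = 0" if "k < a" for k using pos that by (simp add: position_def)
      have zb: "wedge (?v a) (?v k) = 0" if "k < b" for k using pos that by (simp add: position_def)
      have nz: "wedge (?v a) (?v b) \<noteq> 0" using pos by (simp add: position_def)
      show "wedge (state n A (H * elem_step n i (- d)) a') (state n A (H * elem_step n i (- d)) b') = - d * wedge (?v a) (?v b)"
      proof (cases "b = Suc a")
        case True
        then show ?thesis using False ab za unfolding st' by (auto simp: i_def a'_def b'_def)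
      next
        case F: False
        then have "a \<noteq> i" "Suc i = b" "b' = i" using ab by (auto simp: i_def b'_def)
        then show ?thesis using F zb[of i] ab unfolding st' by (auto simp: a'_def)
      qed
      then have nz': "wedge (state n A (H * elem_step n i (- d)) a') (state n A (H * elem_step n i (- d)) b') \<noteq> 0"
        using nz d by simp
      show "position n (state n A (H * elem_step n i (- d))) a' b'"
      proof (cases "b = Suc a")
        case True
        have "a > 0" using False True by auto
        then show ?thesis
          unfolding position_def using True nz' ab za zb st'
          by (auto simp: i_def a'_def b'_def less_Suc_eq)
      next
        case F: False
        then show ?thesis
          unfolding position_def using F nz' ab za zb st'
          by (auto simp: i_def a'_def b'_def)
      qed
    qed
    obtain P1 P2 where P12: "eventually P1 (unipotent_nhd n)" "eventually P2 (unipotent_nhd n)" "\<And>h1 h2. P1 h1 \<Longrightarrow> P2 h2 \<Longrightarrow> Q (h1 * h2)"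
      using eventually_unipotent_nhd_pair[OF Q] by blast
    show ?thesis
      using sgn tp
    proof eventually_elim
      case (elim t)
      obtain R1 R2 where R12: "eventually R1 (unipotent_nhd n)" "eventually R2 (unipotent_nhd n)" "\<And>h1 h2. R1 h1 \<Longrightarrow> R2 h2 \<Longrightarrow> tot_pos_mat n (h1 * exp_shift n t * h2)"
        using tot_pos_mat_open_two_sided[OF exp_shift_tot_pos_mat[OF elim(2), of n]] by blast
      have R2_1: "R2 (1\<^sub>m n)" using R12(2) unfolding eventually_unipotent_nhd using unipotent_one by auto
      obtain S1 S2 where S12: "eventually S1 (unipotent_nhd n)" "eventually S2 (unipotent_nhd n)" "\<And>h1 h2. S1 h1 \<Longrightarrow> S2 h2 \<Longrightarrow> R1 (h1 * h2)"
        using eventually_unipotent_nhd_pair[OF R12(1)] by blast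
      have "\<forall>\<^sub>F d in at_right 0. d > 0 \<and> P1 (elem_step n i (- d)) \<and> S2 (elem_step n i d)"
        by (intro eventually_conj tp eventually_compose_filterlim[OF P12(1) elem_step_filterlim(2)]
            eventually_compose_filterlim[OF S12(2) elem_step_filterlim(1)])
      from ex_at_right[OF this] obtain d where d: "d > 0" "P1 (elem_step n i (- d))" "S2 (elem_step n i d)"
        by blast
      let ?X = "elem_step n i (- d)"
      have H': "H * ?X \<in> carrier_mat n n" using H by simp
      from less.hyps[OF sum'(1) H' pos'[OF d(1)] P12(2)]
      have "\<forall>\<^sub>F t' in at_right 0. (\<exists>hs. product_chain n (tot_pos_mat n) hs \<and> last hs = exp_shift n t' \<and> P2 (hd hs) \<and>
         (\<forall>h\<in>set hs. lead_wedge n A (H * ?X * h) \<noteq> 0) \<and>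
         a' + b' - 1 \<le> changes (map (\<lambda>h. lead_wedge n A (H * ?X * h) > 0) hs) \<and>
         (lead_wedge n A (H * ?X * exp_shift n t') > 0) = (wedge (state n A (H * ?X) a') (state n A (H * ?X) b') > 0)) \<and> S1 (exp_shift n (- t'))"
        by (intro eventually_conj eventually_compose_filterlim[OF S12(1) exp_shift_filterlim(2)])
      from ex_at_right[OF this] obtain t' hs where hs: "product_chain n (tot_pos_mat n) hs" "last hs = exp_shift n t'" "P2 (hd hs)"
         "\<And>h. h \<in> set hs \<Longrightarrow> lead_wedge n A (H * ?X * h) \<noteq> 0"
         "a' + b' - 1 \<le> changes (map (\<lambda>h. lead_wedge n A (H * ?X * h) > 0) hs)"
         "(lead_wedge n A (H * ?X * exp_shift n t') > 0) = (wedge (state n A (H * ?X) a') (state n A (H * ?X) b') > 0)" "S1 (exp_shift n (- t'))"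
        by blast
      have ne: "hs \<noteq> []" and hc: "\<And>h. h \<in> set hs \<Longrightarrow> h \<in> carrier_mat n n" using product_chain_unipotent[OF hs(1)] unipotent_carrier by auto
      \<comment> \<open>The factor that leads from the end of the chain to the flow at time \<open>t\<close>.\<close>
      let ?P = "exp_shift n (- t') * elem_step n i d * exp_shift n t"
      let ?gs = "map ((*) ?X) hs"
      have P: "tot_pos_mat n ?P"
        using R12(3)[OF S12(3)[OF hs(7) d(3)] R2_1] right_mult_one_mat[of ?P n n] by (simp add: mult_carrier_mat[of _ n n _ n])
      have join: "last ?gs * ?P = exp_shift n t"
      proof -
        have "last ?gs = ?X * exp_shift n t'" using ne hs(2) by (simp add: last_map)
        then have "last ?gs * ?P = ?X * (exp_shift n t' * exp_shift n (- t')) * elem_step n i d * exp_shift n t"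
          by (simp add: assoc_mult_mat[of _ n n _ n _ n] mult_carrier_mat[of _ n n _ n])
        also have "exp_shift n t' * exp_shift n (- t') = 1\<^sub>m n" by (simp add: exp_shift_add exp_shift_0)
        also have "?X * 1\<^sub>m n * elem_step n i d = 1\<^sub>m n" using elem_step_inverse[OF i] right_mult_one_mat[of ?X n n] by simp
        finally show ?thesis using left_mult_one_mat[of "exp_shift n t" n n] by simp
      qed
      have ch: "product_chain n (tot_pos_mat n) (?gs @ [exp_shift n t])"
        using product_chain.snoc[OF product_chain_left_mult[OF hs(1) unipotent_elem_step] P, of i "- d"] unfolding join .
      have eq: "lead_wedge n A (H * (?X * h)) = lead_wedge n A (H * ?X * h)" if "h \<in> set hs" for h
        using hc[OF that] H by (simp add: assoc_mult_mat[of _ n n _ n _ n] mult_carrier_mat[of _ n n _ n])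
      have mapeq: "map (\<lambda>h. lead_wedge n A (H * h) > 0) ?gs = map (\<lambda>h. lead_wedge n A (H * ?X * h) > 0) hs"
        using eq by simp
      have lst: "last (map (\<lambda>h. lead_wedge n A (H * h) > 0) ?gs) \<noteq> (lead_wedge n A (H * exp_shift n t) > 0)"
      proof -
        have "wedge (state n A H a) (state n A H b) \<noteq> 0" using pos by (simp add: position_def)
        then have "(- d * wedge (state n A H a) (state n A H b) > 0) \<noteq> (wedge (state n A H a) (state n A H b) > 0)"
          using d(1) by (auto simp: mult_less_0_iff zero_less_mult_iff)
        then show ?thesis
          unfolding mapeq using hs(2,6) ne sg'[OF d(1)] elim(1) by (simp add: last_map)
      qed
      let ?f = "\<lambda>h. lead_wedge n A (H * h) > 0"
      have "map ?f ?gs \<noteq> []" using ne by simp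
      from changes_snoc[OF this, of "?f (exp_shift n t)"] have "changes (map ?f ?gs @ [?f (exp_shift n t)]) = changes (map ?f ?gs) + 1"
        unfolding if_P[OF lst] .
      moreover have "map ?f (?gs @ [exp_shift n t]) = map ?f ?gs @ [?f (exp_shift n t)]"
        unfolding map_append list.map ..
      ultimately have "changes (map ?f (?gs @ [exp_shift n t])) = changes (map (\<lambda>h. lead_wedge n A (H * ?X * h) > 0) hs) + 1"
        unfolding mapeq by metis
      then have "a + b - 1 \<le> changes (map ?f (?gs @ [exp_shift n t]))"
        unfolding sum'(2) using hs(5) by linarith
      moreover have "Q (hd (?gs @ [exp_shift n t]))"
        using ne P12(3)[OF d(2) hs(3)] by (simp add: hd_map)
      moreover have "\<forall>h\<in>set (?gs @ [exp_shift n t]). lead_wedge n A (H * h) \<noteq> 0"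
        using eq hs(4) elim(1) by auto
      moreover have "last (?gs @ [exp_shift n t]) = exp_shift n t" by simp
      ultimately show ?case using ch elim(1) by blast
    qed
  qed
qed

lemma flow_tot_pos_mat:
  assumes fl: "flow n J \<rho> \<Gamma>" and J: "is_interval J" and st: "s \<in> J" "e \<in> J" "s < e"
    and K: "unipotent n K" "K * \<Gamma> s = 1\<^sub>m n"
  shows "tot_pos_mat n (K * \<Gamma> e)"
proof -
  have sub: "{s..e} \<subseteq> J" using J st by (metis (no_types, lifting) atLeastAtMost_iff is_interval_1 subsetI)
  have G: "unipotent n (\<Gamma> t)" if "t \<in> {s..e}" for t using fl that sub unfolding flow_def by auto
  have Gc: "\<Gamma> t \<in> carrier_mat n n" if "t \<in> {s..e}" for t using G[OF that] by (rule unipotent_carrier)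
  have Kc: "K \<in> carrier_mat n n" using K(1) by (rule unipotent_carrier)
  have der: "((\<lambda>t. (K * \<Gamma> t) $$ (r, i)) has_real_derivative \<rho> i t * (K * \<Gamma> t) $$ (r, Suc i)) (at t within {s..e})"
    if t: "t \<in> {s..e}" and ri: "r < n" "Suc i < n" for t r i
  proof -
    have "((\<lambda>t. \<Sum>k<n. K $$ (r, k) * \<Gamma> t $$ (k, i)) has_real_derivative (\<Sum>k<n. K $$ (r, k) * (\<rho> i t * \<Gamma> t $$ (k, Suc i)))) (at t within {s..e})"
      using fl that sub unfolding flow_def by (intro DERIV_sum DERIV_cmult DERIV_subset[OF _ sub]) auto
    moreover have "(\<Sum>k<n. K $$ (r, k) * (\<rho> i t * \<Gamma> t $$ (k, Suc i))) = \<rho> i t * (K * \<Gamma> t) $$ (r, Suc i)"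
      using mult_index[OF Kc Gc[OF t] ri] by (simp add: sum_distrib_left mult_ac)
    ultimately have "((\<lambda>t. \<Sum>k<n. K $$ (r, k) * \<Gamma> t $$ (k, i)) has_real_derivative \<rho> i t * (K * \<Gamma> t) $$ (r, Suc i)) (at t within {s..e})"
      by simp
    then show ?thesis
      by (rule has_field_derivative_transform_within[where d = 1])
        (use t mult_index[OF Kc Gc, of _ r i] ri in \<open>auto simp del: index_mult_mat\<close>)
  qed
  define \<Phi> where "\<Phi> i t = integral {s..t} (\<rho> i)" for i t
  have derP: "(\<Phi> i has_real_derivative \<rho> i t) (at t within {s..e})" if "t \<in> {s..e}" "Suc i < n" for i t
    unfolding \<Phi>_def
  proof (rule integral_has_real_derivative[OF _ that(1)])
    show "continuous_on {s..e} (\<rho> i)"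
      using fl that(2) sub unfolding flow_def by (auto intro: continuous_on_subset)
  qed
  have un: "unipotent n (K * \<Gamma> t)" if "t \<in> {s..e}" for t using unipotent_mult[OF K(1) G[OF that]] .
  have atr: "at s within {s..e} = at_right s"
    using st(3) by (rule at_within_Icc_at_right)
  have "tot_pos n (\<lambda>r c. (K * \<Gamma> e) $$ (r, c))"
  proof (rule tot_pos_flow[of s e n "\<lambda>t r c. (K * \<Gamma> t) $$ (r, c)" \<rho> \<Phi>])
    show "unipotent_array n (\<lambda>r c. (K * \<Gamma> t) $$ (r, c))" if "s < t" "t \<le> e" for t
      using un[of t] that by (auto simp: unipotent_def unipotent_array_def)
    show "((\<lambda>t. (K * \<Gamma> t) $$ (r, i)) has_real_derivative \<rho> i t * (K * \<Gamma> t) $$ (r, Suc i)) (at t within {s<..e})"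
      if "s < t" "t \<le> e" "r < n" "Suc i < n" for t r i
      using that by (intro DERIV_subset[OF der]) auto
    show "((\<lambda>t. (K * \<Gamma> t) $$ (r, i)) \<longlongrightarrow> (if r = i then 1 else 0)) (at_right s)" if ri: "r < n" "i < n" for r i
    proof (cases "Suc i < n")
      case True
      have "((\<lambda>t. (K * \<Gamma> t) $$ (r, i)) \<longlongrightarrow> (K * \<Gamma> s) $$ (r, i)) (at_right s)"
        using DERIV_continuous[OF der[of s r i]] True ri st(3) unfolding atr[symmetric] by (simp add: continuous_within)
      then show ?thesis using K(2) ri by simp
    next
      case False
      have "(K * \<Gamma> t) $$ (r, i) = (if r = i then 1 else 0)" if "t \<in> {s..e}" for t
      proof (cases "r = i")
        case True
        then show ?thesis using un[OF that] ri by (simp add: unipotent_def)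
      next
        case F: False
        then have "r < i" using False ri by simp
        then show ?thesis using un[OF that] ri F by (simp add: unipotent_def)
      qed
      then have "\<forall>\<^sub>F t in at_right s. (if r = i then 1 else 0) = (K * \<Gamma> t) $$ (r, i)"
        unfolding atr[symmetric] by (simp add: eventually_at_filter)
      from Lim_transform_eventually[OF tendsto_const this] show ?thesis .
    qed
    show "\<rho> i t > 0" if "s < t" "t \<le> e" "Suc i < n" for t i
      using fl that sub unfolding flow_def by (meson atLeastAtMost_iff less_imp_le subsetD)
    show "(\<Phi> i has_real_derivative \<rho> i t) (at t within {s<..e})" if "s < t" "t \<le> e" "Suc i < n" for t i
      using that by (intro DERIV_subset[OF derP]) auto
    show "(\<Phi> i \<longlongrightarrow> 0) (at_right s)" if "Suc i < n" for i
      using DERIV_continuous[OF derP[of s i]] that st(3) unfolding atr[symmetric] by (simp add: continuous_within \<Phi>_def)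
  qed (use st in auto)
  then show ?thesis using un[of e] st by (simp add: tot_pos_mat_def)
qed

text \<open>The chains that \<open>split_zero\<close> provides at the zeros are strung together from left to right. The factor that connects two of them
is close to \<open>\<Gamma>(z)\<^sup>-\<^sup>1 \<Gamma>(x)\<close>, hence totally positive, so the result is a chain of totally positive factors to which the
bound on sign changes applies.\<close>

theorem flow_zeros_bound:
  assumes n: "n \<ge> 2" and J: "is_interval J" and fl: "flow n J \<rho> \<Gamma>"
    and F: "finite F" "F \<subseteq> J"
    and pos: "\<And>x. x \<in> F \<Longrightarrow> position n (state n A (\<Gamma> x)) (a x) (b x)"
  shows "(\<Sum>x\<in>F. a x + b x - 1) \<le> 2 * (n - 2)"
proof -
  have Gu: "unipotent n (\<Gamma> x)" if "x \<in> J" for x using fl that unfolding flow_def by auto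
  have "F \<noteq> {} \<Longrightarrow> \<forall>\<^sub>F t in at_right 0. \<exists>Hs. product_chain n (tot_pos_mat n) Hs \<and> last Hs = \<Gamma> (Max F) * exp_shift n t \<and>
     (\<forall>H\<in>set Hs. lead_wedge n A H \<noteq> 0) \<and> (\<Sum>x\<in>F. a x + b x - 1) \<le> changes (map (\<lambda>H. lead_wedge n A H > 0) Hs)"
    using F pos
  proof (induction F rule: finite_linorder_max_induct)
    case empty
    then show ?case by simp
  next
    case (insert x F)
    have xJ: "x \<in> J" using insert.prems by simp
    have Gx: "\<Gamma> x \<in> carrier_mat n n" using Gu[OF xJ] by (rule unipotent_carrier)
    have px: "position n (state n A (\<Gamma> x)) (a x) (b x)" using insert.prems by simp
    have Mx: "Max (insert x F) = x"
      using insert.hyps by (intro Max_eqI) (auto intro: less_imp_le)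
    have xF: "x \<notin> F" using insert.hyps by auto
    have chx: "\<forall>\<^sub>F t in at_right 0. \<exists>Hs. product_chain n (tot_pos_mat n) Hs \<and> last Hs = \<Gamma> x * exp_shift n t \<and> (\<exists>h. Q h \<and> unipotent n h \<and> hd Hs = \<Gamma> x * h) \<and>
     (\<forall>H\<in>set Hs. lead_wedge n A H \<noteq> 0) \<and> a x + b x - 1 \<le> changes (map (\<lambda>H. lead_wedge n A H > 0) Hs)"
      if "eventually Q (unipotent_nhd n)" for Q
      using split_zero[OF Gx px that]
    proof eventually_elim
      case (elim t)
      then obtain hs where hs: "product_chain n (tot_pos_mat n) hs" "last hs = exp_shift n t" "Q (hd hs)"
         "\<And>h. h \<in> set hs \<Longrightarrow> lead_wedge n A (\<Gamma> x * h) \<noteq> 0"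
         "a x + b x - 1 \<le> changes (map (\<lambda>h. lead_wedge n A (\<Gamma> x * h) > 0) hs)" by blast
      have ne: "hs \<noteq> []" "unipotent n (hd hs)" using product_chain_unipotent[OF hs(1)] by auto
      show ?case
        using product_chain_left_mult[OF hs(1) Gu[OF xJ]] hs ne
        by (intro exI[of _ "map ((*) (\<Gamma> x)) hs"]) (auto simp: last_map hd_map o_def)
    qed
    show ?case
    proof (cases "F = {}")
      case True
      have "eventually (\<lambda>_. True) (unipotent_nhd n)" by simp
      have one: "(\<Sum>x\<in>insert x F. a x + b x - 1) = a x + b x - 1" using True by simp
      from chx[OF \<open>eventually (\<lambda>_. True) (unipotent_nhd n)\<close>] show ?thesis
        unfolding Mx one by (rule eventually_mono) blast
    next
      case False
      define z where "z = Max F"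
      have zF: "z \<in> F" unfolding z_def using insert.hyps(1) False by (rule Max_in)
      then have z: "z \<in> F" "z < x" "z \<in> J" using insert.hyps(2) insert.prems(2) by auto
      have IH: "\<forall>\<^sub>F t in at_right 0. \<exists>Hs. product_chain n (tot_pos_mat n) Hs \<and> last Hs = \<Gamma> z * exp_shift n t \<and>
     (\<forall>H\<in>set Hs. lead_wedge n A H \<noteq> 0) \<and> (\<Sum>x\<in>F. a x + b x - 1) \<le> changes (map (\<lambda>H. lead_wedge n A H > 0) Hs)"
        unfolding z_def by (rule insert.IH[OF False]) (use insert.prems in auto)
      obtain K where K: "unipotent n K" "\<Gamma> z * K = 1\<^sub>m n" "K * \<Gamma> z = 1\<^sub>m n" using unipotent_inverse[OF Gu[OF z(3)]] by blast
      have c: "K \<in> carrier_mat n n" "\<Gamma> z \<in> carrier_mat n n" using K Gu[OF z(3)] unipotent_carrier by auto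
      obtain P1 P2 where P12: "eventually P1 (unipotent_nhd n)" "eventually P2 (unipotent_nhd n)"
        "\<And>h1 h2. P1 h1 \<Longrightarrow> P2 h2 \<Longrightarrow> tot_pos_mat n (h1 * (K * \<Gamma> x) * h2)"
        using tot_pos_mat_open_two_sided[OF flow_tot_pos_mat[OF fl J z(3) xJ z(2) K(1,3)]] by blast
      have "\<forall>\<^sub>F t in at_right 0. P1 (exp_shift n (- t)) \<and> (\<exists>Hs. product_chain n (tot_pos_mat n) Hs \<and> last Hs = \<Gamma> z * exp_shift n t \<and>
     (\<forall>H\<in>set Hs. lead_wedge n A H \<noteq> 0) \<and> (\<Sum>x\<in>F. a x + b x - 1) \<le> changes (map (\<lambda>H. lead_wedge n A H > 0) Hs))"
        by (intro eventually_conj IH eventually_compose_filterlim[OF P12(1) exp_shift_filterlim(2)])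
      from ex_at_right[OF this] obtain t0 Hs where Hs: "P1 (exp_shift n (- t0))" "product_chain n (tot_pos_mat n) Hs" "last Hs = \<Gamma> z * exp_shift n t0"
        "\<And>H. H \<in> set Hs \<Longrightarrow> lead_wedge n A H \<noteq> 0" "(\<Sum>x\<in>F. a x + b x - 1) \<le> changes (map (\<lambda>H. lead_wedge n A H > 0) Hs)"
        by blast
      show ?thesis
        using chx[OF P12(2)]
      proof eventually_elim
        case (elim t)
        then obtain Ks h where Ks: "product_chain n (tot_pos_mat n) Ks" "last Ks = \<Gamma> x * exp_shift n t" "P2 h" "unipotent n h" "hd Ks = \<Gamma> x * h"
          "\<And>H. H \<in> set Ks \<Longrightarrow> lead_wedge n A H \<noteq> 0" "a x + b x - 1 \<le> changes (map (\<lambda>H. lead_wedge n A H > 0) Ks)" by blast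
        let ?P = "exp_shift n (- t0) * (K * \<Gamma> x) * h"
        have hc: "h \<in> carrier_mat n n" using Ks(4) by (rule unipotent_carrier)
        have "last Hs * ?P = \<Gamma> z * (exp_shift n t0 * exp_shift n (- t0)) * (K * \<Gamma> x) * h"
          unfolding Hs(3) using c hc Gx by (simp add: assoc_mult_mat[of _ n n _ n _ n] mult_carrier_mat[of _ n n _ n])
        also have "exp_shift n t0 * exp_shift n (- t0) = 1\<^sub>m n" by (simp add: exp_shift_add exp_shift_0)
        also have "\<Gamma> z * 1\<^sub>m n * (K * \<Gamma> x) * h = (\<Gamma> z * K) * \<Gamma> x * h"
          using c hc Gx by (simp add: assoc_mult_mat[of _ n n _ n _ n] mult_carrier_mat[of _ n n _ n])
        also have "\<dots> = hd Ks" using K(2) Gx Ks(5) by simp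
        finally have hdK: "hd Ks = last Hs * ?P" ..
        have "product_chain n (tot_pos_mat n) (Hs @ Ks)"
          by (rule product_chain_append[OF Ks(1) Hs(2) hdK P12(3)[OF Hs(1) Ks(3)]])
        moreover have "last (Hs @ Ks) = \<Gamma> (Max (insert x F)) * exp_shift n t"
          unfolding Mx using Ks(2) product_chain_unipotent[OF Ks(1)] by simp
        moreover have "(\<Sum>x\<in>insert x F. a x + b x - 1) \<le> changes (map (\<lambda>H. lead_wedge n A H > 0) (Hs @ Ks))"
          using changes_append[of "map (\<lambda>H. lead_wedge n A H > 0) Hs" "map (\<lambda>H. lead_wedge n A H > 0) Ks"] Hs(5) Ks(7) insert.hyps(1) xF by simp
        ultimately show ?case using Hs(4) Ks(6) by (intro exI[of _ "Hs @ Ks"]) auto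
      qed
    qed
  qed
  note main = this
  show ?thesis
  proof (cases "F = {}")
    case False
    from ex_at_right[OF main[OF this]] obtain Hs where
      Hs: "product_chain n (tot_pos_mat n) Hs" "\<forall>H\<in>set Hs. lead_wedge n A H \<noteq> 0"
        "(\<Sum>x\<in>F. a x + b x - 1) \<le> changes (map (\<lambda>H. lead_wedge n A H > 0) Hs)" by auto
    have "product_chain n (step_product n) Hs"
      using Hs(1) by induction (auto intro: product_chain.intros tot_pos_mat_step_product[OF n])
    from changes_product_chain_le[OF n this, of A] Hs show ?thesis by auto
  qed simp
qed

section \<open>Existence of solutions of linear equations\<close>

text \<open>The primitive that vanishes at \<open>d\<close>, on both sides of \<open>d\<close>.\<close>

definition antideriv :: "real \<Rightarrow> (real \<Rightarrow> real) \<Rightarrow> real \<Rightarrow> real" where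
  "antideriv d f t = (if d \<le> t then integral {d..t} f else - integral {t..d} f)"

lemma interval_subset: "is_interval I \<Longrightarrow> a \<in> I \<Longrightarrow> b \<in> I \<Longrightarrow> {a..b} \<subseteq> (I :: real set)"
  by (meson atLeastAtMost_iff is_interval_1 subsetI)

lemma antideriv_eq:
  assumes "continuous_on {a..b} f" "d \<in> {a..b}" "t \<in> {a..b}"
  shows "antideriv d f t = integral {a..t} f - integral {a..d} f"
proof -
  have int: "f integrable_on {u..v}" if "a \<le> u" "v \<le> b" for u v
    using assms(1) that by (intro integrable_continuous_real continuous_on_subset[OF assms(1)]) auto
  show ?thesis
  proof (cases "d \<le> t")
    case True
    then show ?thesis
      using Henstock_Kurzweil_Integration.integral_combine[of a d t f] int[of a t] assms by (simp add: antideriv_def)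
  next
    case False
    then show ?thesis
      using Henstock_Kurzweil_Integration.integral_combine[of a t d f] int[of a d] assms by (simp add: antideriv_def)
  qed
qed

lemma antideriv_d [simp]: "antideriv d f d = 0"
  by (simp add: antideriv_def)

text \<open>Reduces local statements on an arbitrary interval to compact ones.\<close>

lemma interval_nbhd:
  fixes I :: "real set"
  assumes I: "is_interval I" and d: "d \<in> I" and t: "t \<in> I"
  shows "\<exists>a b. a \<in> I \<and> b \<in> I \<and> d \<in> {a..b} \<and> t \<in> {a..b} \<and> at t within I = at t within {a..b}"
proof -
  define a where "a = (if \<exists>u\<in>I. u < min d t then SOME u. u \<in> I \<and> u < min d t else min d t)"
  define b where "b = (if \<exists>u\<in>I. u > max d t then SOME u. u \<in> I \<and> u > max d t else max d t)"
  have a: "a \<in> I" "a \<le> d" "a \<le> t" "a < t \<or> (\<forall>u\<in>I. t \<le> u)"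
  proof -
    consider "\<exists>u\<in>I. u < min d t" | "\<not> (\<exists>u\<in>I. u < min d t)" by blast
    then have "a \<in> I \<and> a \<le> d \<and> a \<le> t \<and> (a < t \<or> (\<forall>u\<in>I. t \<le> u))"
    proof cases
      case 1
      then have "\<exists>u. u \<in> I \<and> u < min d t" by blast
      from someI_ex[OF this] 1 show ?thesis unfolding a_def by auto
    next
      case 2
      then have am: "a = min d t" unfolding a_def by (rule if_not_P)
      show ?thesis
      proof (cases "d < t")
        case True then show ?thesis using am d by simp
      next
        case False
        then have "\<forall>u\<in>I. t \<le> u" using 2 by (auto simp: min_def not_less split: if_splits)
        then show ?thesis using False am t by simp
      qed
    qed
    then show "a \<in> I" "a \<le> d" "a \<le> t" "a < t \<or> (\<forall>u\<in>I. t \<le> u)" by auto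
  qed
  have b: "b \<in> I" "d \<le> b" "t \<le> b" "t < b \<or> (\<forall>u\<in>I. u \<le> t)"
  proof -
    consider "\<exists>u\<in>I. u > max d t" | "\<not> (\<exists>u\<in>I. u > max d t)" by blast
    then have "b \<in> I \<and> d \<le> b \<and> t \<le> b \<and> (t < b \<or> (\<forall>u\<in>I. u \<le> t))"
    proof cases
      case 1
      then have "\<exists>u. u \<in> I \<and> u > max d t" by blast
      from someI_ex[OF this] 1 show ?thesis unfolding b_def by auto
    next
      case 2
      then have bm: "b = max d t" unfolding b_def by (rule if_not_P)
      show ?thesis
      proof (cases "t < d")
        case True then show ?thesis using bm d by simp
      next
        case False
        then have "\<forall>u\<in>I. u \<le> t" using 2 by (auto simp: max_def not_less split: if_splits)
        then show ?thesis using False bm t by simp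
      qed
    qed
    then show "b \<in> I" "d \<le> b" "t \<le> b" "t < b \<or> (\<forall>u\<in>I. u \<le> t)" by auto
  qed
  have sub: "{a..b} \<subseteq> I" using interval_subset[OF I a(1) b(1)] .
  have "at t within I = at t within {a..b}"
  proof (rule at_within_nhd)
    let ?l = "if a < t then a else t - 1" and ?r = "if t < b then b else t + 1"
    show "t \<in> {?l<..<?r}" by auto
    show "I \<inter> {?l<..<?r} - {t} = {a..b} \<inter> {?l<..<?r} - {t}"
    proof -
      have "a \<le> x" if "x \<in> I" "?l < x" for x using a that by (cases "a < t") auto
      moreover have "x \<le> b" if "x \<in> I" "x < ?r" for x using b that by (cases "t < b") auto
      ultimately show ?thesis using sub by (auto simp del: if_split)
    qed
  qed simp
  then show ?thesis using a b by (intro exI[of _ a] exI[of _ b]) auto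
qed

lemma antideriv_deriv:
  assumes I: "is_interval I" and f: "continuous_on I f" and d: "d \<in> I" and t: "t \<in> I"
  shows "(antideriv d f has_real_derivative f t) (at t within I)"
proof -
  obtain a b where ab: "a \<in> I" "b \<in> I" "d \<in> {a..b}" "t \<in> {a..b}" "at t within I = at t within {a..b}"
    using interval_nbhd[OF I d t] by blast
  have sub: "{a..b} \<subseteq> I" using interval_subset[OF I ab(1,2)] .
  have c: "continuous_on {a..b} f" using f sub by (rule continuous_on_subset)
  have "((\<lambda>t. integral {a..t} f - integral {a..d} f) has_real_derivative f t) (at t within {a..b})"
    using integral_has_real_derivative[OF c, of t] ab by (auto intro!: derivative_eq_intros)
  then have "(antideriv d f has_real_derivative f t) (at t within {a..b})"
    by (rule has_field_derivative_transform_within[where d = 1]) (use antideriv_eq[OF c] ab in auto)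
  then show ?thesis using ab(5) by simp
qed

lemma antideriv_continuous:
  assumes "is_interval I" "continuous_on I f" "d \<in> I"
  shows "continuous_on I (antideriv d f)"
  using antideriv_deriv[OF assms] by (rule DERIV_continuous_on)

lemma antideriv_pow_continuous:
  assumes "is_interval I" "continuous_on I f" "d \<in> I"
  shows "continuous_on I ((antideriv d ^^ i) f)"
  by (induction i) (auto intro: antideriv_continuous assms)

lemma antideriv_linear:
  assumes I: "is_interval I" and c: "continuous_on I f" "continuous_on I g" and d: "d \<in> I" "t \<in> I"
  shows "antideriv d (\<lambda>s. f s - g s) t = antideriv d f t - antideriv d g t"
proof -
  have "{d..t} \<subseteq> I" "{t..d} \<subseteq> I" using interval_subset[OF I] d by auto
  then have "f integrable_on {d..t}" "f integrable_on {t..d}" "g integrable_on {d..t}" "g integrable_on {t..d}"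
    using c by (auto intro!: integrable_continuous_real intro: continuous_on_subset)
  then show ?thesis by (simp add: antideriv_def integral_diff)
qed

lemma antideriv_cong:
  assumes "is_interval I" "d \<in> I" "t \<in> I" "\<And>s. s \<in> I \<Longrightarrow> f s = g s"
  shows "antideriv d f t = antideriv d g t"
proof -
  have "{d..t} \<subseteq> I" "{t..d} \<subseteq> I" using interval_subset assms by auto
  then show ?thesis using assms(4) by (auto simp: antideriv_def intro!: Henstock_Kurzweil_Integration.integral_cong)
qed

lemma antideriv_pow_linear:
  assumes "is_interval I" "continuous_on I f" "continuous_on I g" "d \<in> I" "t \<in> I"
  shows "(antideriv d ^^ i) (\<lambda>s. f s - g s) t = (antideriv d ^^ i) f t - (antideriv d ^^ i) g t"
  using assms(5)
proof (induction i arbitrary: t)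
  case (Suc i)
  have "(antideriv d ^^ Suc i) (\<lambda>s. f s - g s) t = antideriv d (\<lambda>s. (antideriv d ^^ i) f s - (antideriv d ^^ i) g s) t"
    using antideriv_cong[OF assms(1,4) Suc.prems Suc.IH] by simp
  also have "\<dots> = (antideriv d ^^ Suc i) f t - (antideriv d ^^ Suc i) g t"
    using antideriv_linear[OF assms(1) antideriv_pow_continuous[OF assms(1,2,4)] antideriv_pow_continuous[OF assms(1,3,4)] assms(4) Suc.prems]
    by simp
  finally show ?case .
qed simp

text \<open>With respect to the weight \<open>exp (L \<bar>s - d\<bar>)\<close>, integration is a contraction by the factor \<open>1 / L\<close>.\<close>

lemma antideriv_bound:
  assumes c: "continuous_on {a..b} f" and d: "d \<in> {a..b}" and L: "L > 0"
    and bd: "\<And>s. s \<in> {a..b} \<Longrightarrow> \<bar>f s\<bar> \<le> K * exp (L * \<bar>s - d\<bar>)" and t: "t \<in> {a..b}"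
  shows "\<bar>antideriv d f t\<bar> \<le> K / L * exp (L * \<bar>t - d\<bar>)"
proof -
  have K: "K \<ge> 0" using bd[OF d] by simp
  have D: "(antideriv d f has_real_derivative f s) (at s within {a..b})" if "s \<in> {a..b}" for s
    using antideriv_deriv[OF is_interval_cc c d that] .
  have ca: "continuous_on {a..b} (antideriv d f)" using antideriv_continuous[OF is_interval_cc c d] .
  have Di: "(antideriv d f has_vector_derivative f s) (at s)" if "a < s" "s < b" for s
    using D[of s] that by (simp add: at_within_Icc_at has_real_derivative_iff_has_vector_derivative)
  have E: "K / L * exp (L * \<bar>t - d\<bar>) - K / L \<le> K / L * exp (L * \<bar>t - d\<bar>)" using K L by simp
  consider "t = d" | "d < t" | "t < d" by linarith
  then show ?thesis
  proof cases
    case 1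
    then show ?thesis using K L by simp
  next
    case 2
    have "norm (antideriv d f t - antideriv d f d) \<le> K / L * exp (L * (t - d)) - K / L * exp (L * (d - d))"
    proof (rule differentiable_bound_general[OF 2, where f' = f and \<phi>' = "\<lambda>s. K * exp (L * (s - d))"])
      show "continuous_on {d..t} (antideriv d f)" using ca by (rule continuous_on_subset) (use d t in auto)
      show "continuous_on {d..t} (\<lambda>s. K / L * exp (L * (s - d)))" by (intro continuous_intros)
      show "(antideriv d f has_vector_derivative f s) (at s)" if "d < s" "s < t" for s using Di that d t by auto
      show "((\<lambda>s. K / L * exp (L * (s - d))) has_vector_derivative K * exp (L * (s - d))) (at s)" for s
        unfolding has_real_derivative_iff_has_vector_derivative[symmetric] using L
        by (auto intro!: derivative_eq_intros)
      show "norm (f s) \<le> K * exp (L * (s - d))" if "d < s" "s < t" for s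
        using bd[of s] that d t by auto
    qed
    then show ?thesis using 2 E by simp
  next
    case 3
    have "norm (antideriv d f d - antideriv d f t) \<le> - (K / L * exp (L * (d - d))) - - (K / L * exp (L * (d - t)))"
    proof (rule differentiable_bound_general[OF 3, where f' = f and \<phi>' = "\<lambda>s. K * exp (L * (d - s))" and \<phi> = "\<lambda>s. - (K / L * exp (L * (d - s)))"])
      show "continuous_on {t..d} (antideriv d f)" using ca by (rule continuous_on_subset) (use d t in auto)
      show "continuous_on {t..d} (\<lambda>s. - (K / L * exp (L * (d - s))))" by (intro continuous_intros)
      show "(antideriv d f has_vector_derivative f s) (at s)" if "t < s" "s < d" for s using Di that d t by auto
      show "((\<lambda>s. - (K / L * exp (L * (d - s)))) has_vector_derivative K * exp (L * (d - s))) (at s)" for s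
        unfolding has_real_derivative_iff_has_vector_derivative[symmetric] using L
        by (auto intro!: derivative_eq_intros)
      show "norm (f s) \<le> K * exp (L * (d - s))" if "t < s" "s < d" for s
        using bd[of s] that d t by auto
    qed
    then show ?thesis using 3 E by simp
  qed
qed

lemma antideriv_pow_bound:
  assumes c: "continuous_on {a..b} f" and d: "d \<in> {a..b}" and L: "L > 0"
    and bd: "\<And>s. s \<in> {a..b} \<Longrightarrow> \<bar>f s\<bar> \<le> K * exp (L * \<bar>s - d\<bar>)" and t: "t \<in> {a..b}"
  shows "\<bar>(antideriv d ^^ i) f t\<bar> \<le> K / L ^ i * exp (L * \<bar>t - d\<bar>)"
  using t
proof (induction i arbitrary: t)
  case 0
  then show ?case using bd by simp
next
  case (Suc i)
  from antideriv_bound[OF antideriv_pow_continuous[OF is_interval_cc c d] d L Suc.IH Suc.prems]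
  show ?case by (simp add: mult.commute)
qed

text \<open>If \<open>y\<close> has vanishing Taylor data at \<open>d\<close> and \<open>z\<close> is its \<open>n\<close>-th derivative, then \<open>y\<close> solves the homogeneous equation iff
\<open>z = picard n p d z\<close>; other Taylor data contribute an inhomogeneous term.\<close>

definition picard :: "nat \<Rightarrow> (nat \<Rightarrow> real \<Rightarrow> real) \<Rightarrow> real \<Rightarrow> (real \<Rightarrow> real) \<Rightarrow> real \<Rightarrow> real" where
  "picard n p d z t = - (\<Sum>i=1..n. p i t * (antideriv d ^^ i) z t)"

lemma picard_continuous:
  assumes "is_interval I" "d \<in> I" "\<And>i. i \<in> {1..n} \<Longrightarrow> continuous_on I (p i)" "continuous_on I z"
  shows "continuous_on I (picard n p d z)"
  unfolding picard_def by (intro continuous_intros antideriv_pow_continuous assms) auto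

text \<open>On a compact segment the coefficients are bounded, and a large weight makes up for them.\<close>

lemma picard_contraction:
  assumes p: "\<And>i. i \<in> {1..n} \<Longrightarrow> continuous_on {a..b} (p i)" and d: "d \<in> {a..b}"
  shows "\<exists>L>0. \<forall>z K. continuous_on {a..b} z \<longrightarrow> (\<forall>s\<in>{a..b}. \<bar>z s\<bar> \<le> K * exp (L * \<bar>s - d\<bar>)) \<longrightarrow>
     (\<forall>t\<in>{a..b}. \<bar>picard n p d z t\<bar> \<le> K / 2 * exp (L * \<bar>t - d\<bar>))"
proof -
  have "\<exists>M. \<forall>t\<in>{a..b}. \<bar>p i t\<bar> \<le> M" if "i \<in> {1..n}" for i
  proof -
    have "compact (p i ` {a..b})" by (rule compact_continuous_image[OF p[OF that] compact_Icc])
    then have "bounded (p i ` {a..b})" by (rule compact_imp_bounded)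
    then show ?thesis unfolding bounded_iff by auto
  qed
  then obtain M where M: "\<And>i t. i \<in> {1..n} \<Longrightarrow> t \<in> {a..b} \<Longrightarrow> \<bar>p i t\<bar> \<le> M i" by metis
  define L where "L = 1 + 2 * (\<Sum>i=1..n. \<bar>M i\<bar>)"
  have L1: "L \<ge> 1" unfolding L_def by (simp add: sum_nonneg)
  have "\<bar>picard n p d z t\<bar> \<le> K / 2 * exp (L * \<bar>t - d\<bar>)"
    if c: "continuous_on {a..b} z" and bd: "\<forall>s\<in>{a..b}. \<bar>z s\<bar> \<le> K * exp (L * \<bar>s - d\<bar>)" and t: "t \<in> {a..b}" for z K t
  proof -
    have "\<bar>z d\<bar> \<le> K * exp (L * \<bar>d - d\<bar>)" using bd d by blast
    then have K: "K \<ge> 0" by simp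
    let ?e = "exp (L * \<bar>t - d\<bar>)"
    have "\<bar>picard n p d z t\<bar> \<le> (\<Sum>i=1..n. \<bar>p i t * (antideriv d ^^ i) z t\<bar>)"
      unfolding picard_def by (simp add: sum_abs)
    also have "\<dots> \<le> (\<Sum>i=1..n. \<bar>M i\<bar> * (K / L * ?e))"
    proof (rule sum_mono)
      fix i assume i: "i \<in> {1..n}"
      have "\<bar>(antideriv d ^^ i) z t\<bar> \<le> K / L ^ i * ?e"
        by (rule antideriv_pow_bound[OF c d _ _ t]) (use L1 bd in auto)
      also have "\<dots> \<le> K / L * ?e"
      proof (rule mult_right_mono)
        have "L ^ 1 \<le> L ^ i" by (rule power_increasing) (use i L1 in auto)
        then show "K / L ^ i \<le> K / L" using K L1 by (intro divide_left_mono) auto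
      qed simp
      finally have "\<bar>(antideriv d ^^ i) z t\<bar> \<le> K / L * ?e" .
      moreover have "\<bar>p i t\<bar> \<le> \<bar>M i\<bar>" using M[OF i t] by simp
      ultimately show "\<bar>p i t * (antideriv d ^^ i) z t\<bar> \<le> \<bar>M i\<bar> * (K / L * ?e)"
        unfolding abs_mult by (intro mult_mono) auto
    qed
    also have "\<dots> = (\<Sum>i=1..n. \<bar>M i\<bar>) / L * (K * ?e)"
      by (simp add: sum_distrib_right[symmetric] sum_divide_distrib[symmetric])
    also have "\<dots> \<le> 1 / 2 * (K * ?e)"
    proof (rule mult_right_mono)
      have "(\<Sum>i=1..n. \<bar>M i\<bar>) \<le> 1 / 2 * L" unfolding L_def by simp
      then show "(\<Sum>i=1..n. \<bar>M i\<bar>) / L \<le> 1 / 2" using L1 by (subst pos_divide_le_eq) auto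
    qed (use K in simp)
    finally show ?thesis by simp
  qed
  then show ?thesis using L1 by (intro exI[of _ L]) auto
qed

lemma picard_linear:
  assumes "is_interval I" "d \<in> I" "t \<in> I" "continuous_on I f" "continuous_on I g"
  shows "picard n p d (\<lambda>s. f s - g s) t = picard n p d f t - picard n p d g t"
  unfolding picard_def antideriv_pow_linear[OF assms(1,4,5,2,3)]
  by (simp add: right_diff_distrib sum_subtractf)

text \<open>The Neumann series converges geometrically in the weighted norm of each compact segment around \<open>d\<close>, hence locally uniformly on
the whole interval.\<close>

lemma volterra_solution:
  assumes I: "is_interval I" and d: "d \<in> I" and p: "\<And>i. i \<in> {1..n} \<Longrightarrow> continuous_on I (p i)" and g: "continuous_on I g"
  shows "\<exists>z. continuous_on I z \<and> (\<forall>t\<in>I. z t = g t + picard n p d z t)"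
proof -
  define z where "z m = (picard n p d ^^ m) g" for m
  have zc: "continuous_on I (z m)" for m
    by (induction m) (auto simp: z_def g intro: picard_continuous[OF I d p])
  define Z where "Z t = (\<Sum>m. z m t)" for t
  have main: "continuous_on {a..b} Z \<and> (\<exists>L>0. \<exists>K. \<forall>t\<in>{a..b}. \<forall>N. \<bar>Z t - (\<Sum>m<N. z m t)\<bar> \<le> K * (1/2) ^ N * exp (L * \<bar>t - d\<bar>) \<and>
      \<bar>picard n p d (\<lambda>s. Z s - (\<Sum>m<N. z m s)) t\<bar> \<le> K * (1/2) ^ N * exp (L * \<bar>t - d\<bar>))"
    if ab: "a \<in> I" "b \<in> I" "d \<in> {a..b}" for a b
  proof -
    have sub: "{a..b} \<subseteq> I" using interval_subset[OF I ab(1,2)] .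
    obtain L where L: "L > 0" "\<And>z K t. continuous_on {a..b} z \<Longrightarrow> (\<forall>s\<in>{a..b}. \<bar>z s\<bar> \<le> K * exp (L * \<bar>s - d\<bar>)) \<Longrightarrow>
       t \<in> {a..b} \<Longrightarrow> \<bar>picard n p d z t\<bar> \<le> K / 2 * exp (L * \<bar>t - d\<bar>)"
      using picard_contraction[of n a b p d] p ab sub continuous_on_subset by metis
    have zc': "continuous_on {a..b} (z m)" for m using zc sub by (rule continuous_on_subset)
    have "bounded (g ` {a..b})"
      using g sub by (intro compact_imp_bounded compact_continuous_image) (auto intro: continuous_on_subset)
    then obtain G where "\<forall>x\<in>g ` {a..b}. norm x \<le> G" unfolding bounded_iff ..
    then have G: "\<bar>g t\<bar> \<le> G" if "t \<in> {a..b}" for t using that by simp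
    have G0: "G \<ge> 0" using G[OF ab(3)] by simp
    have zb: "\<forall>t\<in>{a..b}. \<bar>z m t\<bar> \<le> G * (1/2) ^ m * exp (L * \<bar>t - d\<bar>)" for m
    proof (induction m)
      case 0
      show ?case
      proof
        fix t assume t: "t \<in> {a..b}"
        have "1 \<le> exp (L * \<bar>t - d\<bar>)" using L(1) by simp
        then have "G * 1 \<le> G * exp (L * \<bar>t - d\<bar>)" using G0 by (intro mult_left_mono) auto
        then show "\<bar>z 0 t\<bar> \<le> G * (1/2) ^ 0 * exp (L * \<bar>t - d\<bar>)" using G[OF t] by (simp add: z_def)
      qed
    next
      case (Suc m)
      from L(2)[OF zc' Suc] show ?case by (simp add: z_def)
    qed
    define E where "E = exp (L * (b - a))"
    have E: "exp (L * \<bar>t - d\<bar>) \<le> E" if "t \<in> {a..b}" for t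
      using that ab L(1) unfolding E_def by (auto intro!: mult_left_mono)
    have zb': "norm (z m t) \<le> G * (1/2) ^ m * E" if "t \<in> {a..b}" for m t
    proof -
      have "G * (1/2) ^ m * exp (L * \<bar>t - d\<bar>) \<le> G * (1/2) ^ m * E"
        using E[OF that] G0 by (intro mult_left_mono) auto
      then show ?thesis using zb[of m] that by force
    qed
    have sumE: "summable (\<lambda>m. G * (1/2) ^ m * E)"
      by (intro summable_mult summable_mult2 summable_geometric) auto
    have ul: "uniform_limit {a..b} (\<lambda>N t. \<Sum>m<N. z m t) Z sequentially"
      unfolding Z_def by (rule Weierstrass_m_test[OF zb' sumE])
    have Zc: "continuous_on {a..b} Z"
      by (rule uniform_limit_theorem[OF _ ul]) (auto intro!: always_eventually continuous_on_sum zc')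
    have tail: "\<bar>Z t - (\<Sum>m<N. z m t)\<bar> \<le> 2 * G * (1/2) ^ N * exp (L * \<bar>t - d\<bar>)" if t: "t \<in> {a..b}" for t N
    proof -
      let ?e = "exp (L * \<bar>t - d\<bar>)"
      have sz: "summable (\<lambda>m. norm (z m t))"
        by (rule summable_comparison_test'[OF sumE]) (use zb' t in auto)
      have s1: "summable (\<lambda>m. z (m + N) t)"
        using summable_norm_cancel[OF sz] by (subst summable_iff_shift)
      have gs: "(\<lambda>m. G * (1/2) ^ N * ?e * (1/2) ^ m) sums (G * (1/2) ^ N * ?e * (1 / (1 - 1/2)))"
        by (intro sums_mult geometric_sums) simp
      have "Z t - (\<Sum>m<N. z m t) = (\<Sum>m. z (m + N) t)"
        unfolding Z_def using suminf_minus_initial_segment[OF summable_norm_cancel[OF sz]] by simp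
      also have "\<bar>\<dots>\<bar> \<le> (\<Sum>m. G * (1/2) ^ N * ?e * (1/2) ^ m)"
      proof -
        have "norm (\<Sum>m. z (m + N) t) \<le> (\<Sum>m. G * (1/2) ^ N * ?e * (1/2) ^ m)"
        proof (rule norm_suminf_le)
          show "summable (\<lambda>m. G * (1/2) ^ N * ?e * (1/2) ^ m)" using gs by (rule sums_summable)
          show "norm (z (m + N) t) \<le> G * (1/2) ^ N * ?e * (1/2) ^ m" for m
            using zb[of "m + N"] t by (simp add: power_add mult_ac)
        qed
        then show ?thesis by simp
      qed
      also have "\<dots> = 2 * G * (1/2) ^ N * ?e" using sums_unique[OF gs] by simp
      finally show ?thesis .
    qed
    have sc: "continuous_on {a..b} (\<lambda>s. Z s - (\<Sum>m<N. z m s))" for N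
      by (intro continuous_intros Zc zc')
    have "\<bar>picard n p d (\<lambda>s. Z s - (\<Sum>m<N. z m s)) t\<bar> \<le> 2 * G * (1/2) ^ N * exp (L * \<bar>t - d\<bar>)" if t: "t \<in> {a..b}" for t N
    proof -
      have "\<bar>picard n p d (\<lambda>s. Z s - (\<Sum>m<N. z m s)) t\<bar> \<le> 2 * G * (1/2) ^ N / 2 * exp (L * \<bar>t - d\<bar>)"
        by (rule L(2)[OF sc _ t]) (use tail in blast)
      also have "\<dots> \<le> 2 * G * (1/2) ^ N * exp (L * \<bar>t - d\<bar>)"
        using G0 by (intro mult_right_mono) auto
      finally show ?thesis .
    qed
    then show ?thesis using Zc L(1) tail by blast
  qed
  have Zc: "continuous_on I Z"
  proof -
    have "continuous (at t within I) Z" if t: "t \<in> I" for t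
    proof -
      obtain a b where ab: "a \<in> I" "b \<in> I" "d \<in> {a..b}" "t \<in> {a..b}" "at t within I = at t within {a..b}"
        using interval_nbhd[OF I d t] by blast
      show ?thesis
        using main[OF ab(1-3)] ab(4) unfolding ab(5) by (simp add: continuous_on_eq_continuous_within)
    qed
    then show ?thesis by (simp add: continuous_on_eq_continuous_within)
  qed
  have "Z t = g t + picard n p d Z t" if t: "t \<in> I" for t
  proof -
    obtain a b where ab: "a \<in> I" "b \<in> I" "d \<in> {a..b}" "t \<in> {a..b}"
      using interval_nbhd[OF I d t] by blast
    from main[OF ab(1-3)] obtain L K where "\<forall>t\<in>{a..b}. \<forall>N. \<bar>Z t - (\<Sum>m<N. z m t)\<bar> \<le> K * (1/2) ^ N * exp (L * \<bar>t - d\<bar>) \<and>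
      \<bar>picard n p d (\<lambda>s. Z s - (\<Sum>m<N. z m s)) t\<bar> \<le> K * (1/2) ^ N * exp (L * \<bar>t - d\<bar>)" by blast
    from this[rule_format, OF ab(4)] have b: "\<bar>Z t - (\<Sum>m<N. z m t)\<bar> \<le> K * (1/2) ^ N * exp (L * \<bar>t - d\<bar>)"
      "\<bar>picard n p d (\<lambda>s. Z s - (\<Sum>m<N. z m s)) t\<bar> \<le> K * (1/2) ^ N * exp (L * \<bar>t - d\<bar>)" for N
      by blast+
    have step: "(\<Sum>m<Suc N. z m t) = g t + picard n p d (\<lambda>s. \<Sum>m<N. z m s) t" for N
    proof (induction N)
      case 0
      have "antideriv d (\<lambda>s. 0) = (\<lambda>s. 0)"
        by (simp add: antideriv_def fun_eq_iff)
      then have "(antideriv d ^^ i) (\<lambda>s. 0) = (\<lambda>s. 0)" for i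
        by (induction i) simp_all
      then show ?case by (simp add: z_def picard_def)
    next
      case (Suc N)
      have lin: "picard n p d (\<lambda>s. (\<Sum>m<Suc N. z m s) - z N s) t = picard n p d (\<lambda>s. \<Sum>m<Suc N. z m s) t - picard n p d (z N) t"
        by (rule picard_linear[OF I d t _ zc]) (intro continuous_intros zc)
      have "picard n p d (\<lambda>s. \<Sum>m<Suc N. z m s) t = picard n p d (\<lambda>s. \<Sum>m<N. z m s) t + z (Suc N) t"
        using lin by (simp add: z_def)
      then show ?case using Suc by simp
    qed
    have lin: "picard n p d (\<lambda>s. Z s - (\<Sum>m<N. z m s)) t = picard n p d Z t - picard n p d (\<lambda>s. \<Sum>m<N. z m s) t" for N
      by (rule picard_linear[OF I d t Zc]) (intro continuous_intros zc)
    have "\<bar>Z t - (g t + picard n p d Z t)\<bar> \<le> 2 * (K * (1/2) ^ N * exp (L * \<bar>t - d\<bar>))" for N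
    proof -
      have "Z t - (g t + picard n p d Z t) = (Z t - (\<Sum>m<Suc N. z m t)) - picard n p d (\<lambda>s. Z s - (\<Sum>m<N. z m s)) t"
        unfolding step lin by simp
      moreover have "\<bar>Z t - (\<Sum>m<Suc N. z m t)\<bar> \<le> K * (1/2) ^ N * exp (L * \<bar>t - d\<bar>)"
      proof -
        have "0 \<le> K * exp (L * \<bar>t - d\<bar>)" using b(1)[of 0] by simp
        then have "0 \<le> K" by (simp add: zero_le_mult_iff)
        then have "K * (1/2) ^ Suc N * exp (L * \<bar>t - d\<bar>) \<le> K * (1/2) ^ N * exp (L * \<bar>t - d\<bar>)"
          by (intro mult_right_mono mult_left_mono) auto
        then show ?thesis using b(1)[of "Suc N"] by linarith
      qed
      ultimately show ?thesis using b(2)[of N] by linarith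
    qed
    moreover have "(\<lambda>N. 2 * (K * (1/2) ^ N * exp (L * \<bar>t - d\<bar>))) \<longlonglongrightarrow> 2 * (K * 0 * exp (L * \<bar>t - d\<bar>))"
      by (intro tendsto_intros LIMSEQ_realpow_zero) auto
    ultimately have "\<bar>Z t - (g t + picard n p d Z t)\<bar> \<le> 0"
      by (intro tendsto_lowerbound[where f = "\<lambda>N. 2 * (K * (1/2) ^ N * exp (L * \<bar>t - d\<bar>))" and F = sequentially]) auto
    then show ?thesis by simp
  qed
  then show ?thesis using Zc by blast
qed

text \<open>The \<open>j\<close>-th derivative of the polynomial with Taylor data \<open>\<eta> 0, \<dots>, \<eta> (n - 1)\<close> at \<open>d\<close>.\<close>

definition taylor_part :: "nat \<Rightarrow> (nat \<Rightarrow> real) \<Rightarrow> real \<Rightarrow> nat \<Rightarrow> real \<Rightarrow> real" where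
  "taylor_part n \<eta> d j t = (\<Sum>k<n. if j \<le> k then \<eta> k * (t - d) ^ (k - j) / fact (k - j) else 0)"

lemma taylor_part_deriv: "(taylor_part n \<eta> d j has_real_derivative taylor_part n \<eta> d (Suc j) t) (at t within S)"
proof -
  have "((\<lambda>t. if j \<le> k then \<eta> k * (t - d) ^ (k - j) / fact (k - j) else 0) has_real_derivative
     (if Suc j \<le> k then \<eta> k * (t - d) ^ (k - Suc j) / fact (k - Suc j) else 0)) (at t within S)" for k
  proof (cases "Suc j \<le> k")
    case True
    define m where "m = k - Suc j"
    have m: "k - j = Suc m" using True by (simp add: m_def)
    have 1: "((\<lambda>t. t - d) has_real_derivative 1) (at t within S)" by (auto intro!: derivative_eq_intros)
    have "((\<lambda>t. \<eta> k * (t - d) ^ Suc m / fact (Suc m)) has_real_derivative (\<eta> k * (real (Suc m) * (t - d) ^ m)) / fact (Suc m)) (at t within S)"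
      using DERIV_cdivide[OF DERIV_cmult[OF DERIV_power[OF 1, of "Suc m"], of "\<eta> k"], of "fact (Suc m)"] by simp
    moreover have "(\<eta> k * (real (Suc m) * (t - d) ^ m)) / fact (Suc m) = \<eta> k * (t - d) ^ m / fact m"
      by (simp add: fact_Suc del: of_nat_Suc)
    ultimately show ?thesis using True m by (simp add: m_def)
  next
    case False
    then show ?thesis by (cases "j = k") auto
  qed
  then show ?thesis unfolding taylor_part_def[abs_def] by (intro DERIV_sum)
qed

lemma taylor_part_d: "j < n \<Longrightarrow> taylor_part n \<eta> d j d = \<eta> j"
proof -
  assume j: "j < n"
  have "taylor_part n \<eta> d j d = (\<Sum>k<n. if k = j then \<eta> j else 0)"
    unfolding taylor_part_def by (intro sum.cong) (auto simp: power_0_left)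
  then show ?thesis using j by simp
qed

lemma taylor_part_n: "n \<le> j \<Longrightarrow> taylor_part n \<eta> d j t = 0"
  unfolding taylor_part_def by (intro sum.neutral) auto

text \<open>The solution is the Taylor polynomial of its data plus an iterated primitive of a solution of a Volterra equation.\<close>

theorem linear_ode_existence:
  assumes I: "is_interval I" and d: "d \<in> I" and p: "\<And>i. i \<in> {1..n} \<Longrightarrow> continuous_on I (p i)"
  shows "\<exists>Y. (\<forall>j<n. \<forall>x\<in>I. (Y j has_real_derivative Y (Suc j) x) (at x within I)) \<and>
     (\<forall>x\<in>I. Y n x + (\<Sum>i=1..n. p i x * Y (n - i) x) = 0) \<and> (\<forall>j<n. Y j d = \<eta> j)"
proof -
  let ?q = "taylor_part n \<eta> d"
  define g where "g t = - (\<Sum>i=1..n. p i t * ?q (n - i) t)" for t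
  have qc: "continuous_on I (?q j)" for j
    by (rule DERIV_continuous_on) (rule taylor_part_deriv)
  have gc: "continuous_on I g"
    unfolding g_def by (intro continuous_intros p qc) auto
  have "\<exists>z. continuous_on I z \<and> (\<forall>t\<in>I. z t = g t + picard n p d z t)"
    by (rule volterra_solution[OF I d _ gc]) (rule p)
  then obtain z where z: "continuous_on I z" "\<And>t. t \<in> I \<Longrightarrow> z t = g t + picard n p d z t"
    by blast
  define Y where "Y j t = ?q j t + (antideriv d ^^ (n - j)) z t" for j t
  have "(Y j has_real_derivative Y (Suc j) x) (at x within I)" if "j < n" "x \<in> I" for j x
  proof -
    have e: "n - j = Suc (n - Suc j)" using that by simp
    have "((antideriv d ^^ (n - j)) z has_real_derivative (antideriv d ^^ (n - Suc j)) z x) (at x within I)"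
      unfolding e funpow.simps o_def by (rule antideriv_deriv[OF I antideriv_pow_continuous[OF I z(1) d] d that(2)])
    from DERIV_add[OF taylor_part_deriv this] show ?thesis unfolding Y_def[abs_def] .
  qed
  moreover have "Y n x + (\<Sum>i=1..n. p i x * Y (n - i) x) = 0" if "x \<in> I" for x
  proof -
    have "(\<Sum>i=1..n. p i x * Y (n - i) x) = - g x - picard n p d z x"
      unfolding g_def picard_def Y_def by (simp add: distrib_left sum.distrib)
    then show ?thesis using z(2)[OF that] by (simp add: Y_def taylor_part_n)
  qed
  moreover have "Y j d = \<eta> j" if "j < n" for j
  proof -
    have "n - j = Suc (n - Suc j)" using that by simp
    then have "(antideriv d ^^ (n - j)) z d = 0" by simp
    then show ?thesis using that by (simp add: Y_def taylor_part_d)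
  qed
  ultimately show ?thesis by blast
qed

section \<open>Quasi-derivatives\<close>

text \<open>\<open>k\<close> times continuously differentiable on \<open>J\<close>, with one-sided derivatives at the ends.\<close>

primrec Ck :: "real set \<Rightarrow> nat \<Rightarrow> (real \<Rightarrow> real) \<Rightarrow> bool" where
  "Ck J 0 f = continuous_on J f"
| "Ck J (Suc k) f = (\<exists>f'. (\<forall>x\<in>J. (f has_real_derivative f' x) (at x within J)) \<and> Ck J k f')"

lemma Ck_mono: "Ck J (Suc k) f \<Longrightarrow> Ck J k f"
proof (induction k arbitrary: f)
  case 0
  then show ?case by (auto intro: DERIV_continuous_on)
next
  case (Suc k)
  then obtain f' where "\<forall>x\<in>J. (f has_real_derivative f' x) (at x within J)" "Ck J (Suc k) f'" by auto
  then show ?case using Suc.IH[of f'] by auto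
qed

lemma Ck_le: "m \<le> k \<Longrightarrow> Ck J k f \<Longrightarrow> Ck J m f"
  by (induction k rule: dec_induct) (auto dest: Ck_mono simp del: Ck.simps)

lemma Ck_continuous: "Ck J k f \<Longrightarrow> continuous_on J f"
  using Ck_le[of 0 k J f] by simp

lemma Ck_const: "Ck J k (\<lambda>_. c)"
proof (induction k arbitrary: c)
  case (Suc k)
  show ?case using Suc[of 0] by (auto intro!: exI[of _ "\<lambda>_. 0"])
qed simp

lemma Ck_add: "Ck J k f \<Longrightarrow> Ck J k g \<Longrightarrow> Ck J k (\<lambda>x. f x + g x)"
proof (induction k arbitrary: f g)
  case (Suc k)
  then obtain f' g' where "\<forall>x\<in>J. (f has_real_derivative f' x) (at x within J)" "Ck J k f'"
    "\<forall>x\<in>J. (g has_real_derivative g' x) (at x within J)" "Ck J k g'" by auto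
  then show ?case using Suc.IH[of f' g'] by (auto intro!: exI[of _ "\<lambda>x. f' x + g' x"] DERIV_add)
qed (simp add: continuous_on_add)

lemma Ck_mult: "Ck J k f \<Longrightarrow> Ck J k g \<Longrightarrow> Ck J k (\<lambda>x. f x * g x)"
proof (induction k arbitrary: f g)
  case (Suc k)
  then obtain f' g' where fg: "\<forall>x\<in>J. (f has_real_derivative f' x) (at x within J)" "Ck J k f'"
    "\<forall>x\<in>J. (g has_real_derivative g' x) (at x within J)" "Ck J k g'" by auto
  have "Ck J k f" "Ck J k g" using Suc.prems Ck_mono by blast+
  then have "Ck J k (\<lambda>x. f' x * g x + g' x * f x)"
    using fg Suc.IH by (intro Ck_add) auto
  then show ?case using fg by (auto intro!: exI[of _ "\<lambda>x. f' x * g x + g' x * f x"] DERIV_mult)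
qed (simp add: continuous_on_mult)

lemma Ck_inverse:
  assumes "\<And>x. x \<in> J \<Longrightarrow> u x \<noteq> 0"
  shows "Ck J k u \<Longrightarrow> Ck J k (\<lambda>x. inverse (u x))"
proof (induction k)
  case 0
  then show ?case using assms by (auto intro!: continuous_on_inverse)
next
  case (Suc k)
  then obtain u' where u': "\<forall>x\<in>J. (u has_real_derivative u' x) (at x within J)" "Ck J k u'" by auto
  have i: "Ck J k (\<lambda>x. inverse (u x))" using Suc Ck_mono by blast
  have "Ck J k (\<lambda>x. (-1) * (inverse (u x) * u' x * inverse (u x)))"
    by (intro Ck_mult Ck_const i u')
  moreover have "((\<lambda>x. inverse (u x)) has_real_derivative (-1) * (inverse (u x) * u' x * inverse (u x))) (at x within J)" if "x \<in> J" for x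
    using DERIV_inverse'[of u "u' x" x J] u' that assms by auto
  ultimately have "\<exists>f'. (\<forall>x\<in>J. ((\<lambda>x. inverse (u x)) has_real_derivative f' x) (at x within J)) \<and> Ck J k f'"
    by (intro exI[of _ "\<lambda>x. (-1) * (inverse (u x) * u' x * inverse (u x))"] conjI ballI)
  then show ?case by simp
qed

text \<open>For smooth functions this says that the Wronskians of all initial pieces have no zeros. The formulation by orders of zeros is the one
that disconjugacy provides and that passes to quotients.\<close>

definition wronski_property :: "real set \<Rightarrow> nat \<Rightarrow> (nat \<Rightarrow> real \<Rightarrow> real) \<Rightarrow> bool" where
  "wronski_property J n F \<longleftrightarrow> (\<forall>x\<in>J. \<forall>j\<in>{1..n}. \<forall>c. vanishes_to_order J (\<lambda>t. \<Sum>i<j. c i * F i t) x j \<longrightarrow> (\<forall>i<j. c i = 0))"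

lemma wronski_propertyD:
  "wronski_property J n F \<Longrightarrow> x \<in> J \<Longrightarrow> 1 \<le> j \<Longrightarrow> j \<le> n \<Longrightarrow>
   vanishes_to_order J (\<lambda>t. \<Sum>i<j. c i * F i t) x j \<Longrightarrow> i < j \<Longrightarrow> c i = 0"
  unfolding wronski_property_def by fastforce

lemma constant_sign:
  fixes u :: "real \<Rightarrow> real"
  assumes "is_interval J" "continuous_on J u" "\<And>x. x \<in> J \<Longrightarrow> u x \<noteq> 0"
  shows "\<exists>e\<in>{1, -1}. \<forall>x\<in>J. e * u x > 0"
proof (rule ccontr)
  assume "\<not> ?thesis"
  then obtain x y where xy: "x \<in> J" "y \<in> J" "u x \<le> 0" "u y \<ge> 0" by (auto simp: not_less)
  have "connected (u ` J)"
    using assms(1,2) by (intro connected_continuous_image) (simp_all add: is_interval_connected)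
  then have "0 \<in> u ` J"
    using xy connected_contains_Icc[of "u ` J" "u x" "u y"] by force
  then show False using assms(3) by auto
qed

text \<open>Polya's factorization: divide all functions by the first one, differentiate, and repeat. The property is inherited since a combination
of the derivatives \<open>(F\<^sub>i / F\<^sub>0)'\<close> with a zero of order \<open>j\<close> at \<open>x\<close> integrates to a combination of the \<open>F\<^sub>i\<close>, one of them \<open>F\<^sub>0\<close>, with a zero of
order \<open>j + 1\<close>. The signs \<open>\<epsilon>\<close> make the divisors \<open>\<rho>\<close> positive.\<close>

theorem quasi_derivatives:
  assumes J: "is_interval J"
    and F: "\<And>i. i < n \<Longrightarrow> Ck J (n - 1) (F i)" and W: "wronski_property J n F"
  shows "\<exists>\<epsilon> \<rho> \<Phi>. (\<forall>j. \<epsilon> j \<in> {1, -1 :: real}) \<and> (\<forall>i<n. Ck J (n - 1 - i) (\<rho> i) \<and> (\<forall>t\<in>J. \<rho> i t > 0)) \<and>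
     (\<forall>j<n. \<forall>t\<in>J. \<epsilon> j * F j t = \<rho> 0 t * \<Phi> 0 j t) \<and>
     (\<forall>i j. \<forall>t\<in>J. Suc i < n \<longrightarrow> j < n \<longrightarrow> (\<Phi> i j has_real_derivative \<rho> (Suc i) t * \<Phi> (Suc i) j t) (at t within J)) \<and>
     (\<forall>i<n. \<forall>t. \<Phi> i i t = 1 \<and> (\<forall>j<i. \<Phi> i j t = 0))"
  using F W
proof (induction n arbitrary: F)
  case 0
  show ?case by (rule exI[of _ "\<lambda>_. 1"]) auto
next
  case (Suc n)
  have Fc: "continuous_on J (F i)" if "i < Suc n" for i
    using Suc.prems(1)[OF that] by (rule Ck_continuous)
  have u0: "F 0 x \<noteq> 0" if x: "x \<in> J" for x
  proof
    assume "F 0 x = 0"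
    moreover have "(F 0 \<longlongrightarrow> F 0 x) (at x within J)" using Fc[of 0] x by (simp add: continuous_on_def)
    ultimately have "vanishes_to_order J (\<lambda>t. \<Sum>i<1. (1::real) * F i t) x 1"
      by (simp add: vanishes_to_order_def)
    from wronski_propertyD[OF Suc.prems(2) x _ _ this, of 0] show False by simp
  qed
  have "\<exists>e\<in>{1, -1}. \<forall>x\<in>J. e * F 0 x > 0"
    by (rule constant_sign[OF J Fc[of 0] u0]) auto
  then obtain e where e: "e \<in> {1, -1 :: real}" "\<And>x. x \<in> J \<Longrightarrow> e * F 0 x > 0" by blast
  define G where "G j t = F (Suc j) t * inverse (F 0 t)" for j t
  have GC: "Ck J n (G j)" if "j < n" for j
    unfolding G_def[abs_def] using Suc.prems(1)[of "Suc j"] Suc.prems(1)[of 0] that u0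
    by (intro Ck_mult Ck_inverse) auto
  have "\<exists>F'. \<forall>j<n. (\<forall>x\<in>J. (G j has_real_derivative F' j x) (at x within J)) \<and> Ck J (n - 1) (F' j)"
  proof (cases n)
    case (Suc m)
    have "\<exists>f'. (\<forall>x\<in>J. (G j has_real_derivative f' x) (at x within J)) \<and> Ck J (n - 1) f'" if "j < n" for j
      using GC[OF that] Suc by simp
    then show ?thesis by metis
  qed simp
  then obtain F' where F': "\<And>j x. j < n \<Longrightarrow> x \<in> J \<Longrightarrow> (G j has_real_derivative F' j x) (at x within J)"
    "\<And>j. j < n \<Longrightarrow> Ck J (n - 1) (F' j)" by blast
  have W': "wronski_property J n F'"
    unfolding wronski_property_def
  proof (intro ballI allI impI)
    fix x j c i assume x: "x \<in> J" and j: "j \<in> {1..n}" and v: "vanishes_to_order J (\<lambda>t. \<Sum>i<j. c i * F' i t) x j" and i: "i < j"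
    define k where "k = (\<Sum>i<j. c i * G i x)"
    define y where "y t = (\<Sum>i<j. c i * G i t) - k" for t
    have v': "(\<Sum>i<j. c i * F' i x) = 0" "((\<lambda>t. (\<Sum>i<j. c i * F' i t) / (t - x) ^ (j - 1)) \<longlongrightarrow> 0) (at x within J)"
      using v j by (auto simp: vanishes_to_order_def)
    have "((\<lambda>t. y t / (t - x) ^ Suc (j - 1)) \<longlongrightarrow> 0 / real (Suc (j - 1))) (at x within J)"
    proof (rule tendsto_quotient_from_deriv[OF J x _ _ v'(2)])
      show "y x = 0" by (simp add: y_def k_def)
      show "(y has_real_derivative (\<Sum>i<j. c i * F' i t)) (at t within J)" if "t \<in> J" for t
      proof -
        have "((\<lambda>t. (\<Sum>i<j. c i * G i t) - k) has_real_derivative (\<Sum>i<j. c i * F' i t) - 0) (at t within J)"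
          using F'(1)[OF _ that] j by (intro DERIV_diff DERIV_sum DERIV_cmult DERIV_const) auto
        then show ?thesis by (simp add: y_def[abs_def])
      qed
    qed (use v' in auto)
    then have yl: "((\<lambda>t. y t / (t - x) ^ j) \<longlongrightarrow> 0) (at x within J)" using j by (cases j) simp_all
    \<comment> \<open>The constant of integration becomes the coefficient of \<open>F 0\<close>.\<close>
    define c' where "c' i = (case i of 0 \<Rightarrow> - k | Suc i \<Rightarrow> c i)" for i
    have eq: "(\<Sum>i<Suc j. c' i * F i t) = F 0 t * y t" if "t \<in> J" for t
    proof -
      have "(\<Sum>i<Suc j. c' i * F i t) = - k * F 0 t + (\<Sum>i<j. c i * F (Suc i) t)"
        by (simp add: sum.lessThan_Suc_shift c'_def del: sum.lessThan_Suc)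
      also have "(\<Sum>i<j. c i * F (Suc i) t) = F 0 t * (\<Sum>i<j. c i * G i t)"
        using u0[OF that] by (auto simp: sum_distrib_left G_def intro!: sum.cong)
      finally show ?thesis by (simp add: y_def algebra_simps)
    qed
    have "((\<lambda>t. F 0 t * (y t / (t - x) ^ j)) \<longlongrightarrow> F 0 x * 0) (at x within J)"
      using Fc[of 0] x by (intro tendsto_mult yl) (simp add: continuous_on_def)
    moreover have "\<forall>\<^sub>F t in at x within J. F 0 t * (y t / (t - x) ^ j) = (\<Sum>i<Suc j. c' i * F i t) / (t - x) ^ j"
      unfolding eventually_at_filter using eq by (intro always_eventually) (simp del: sum.lessThan_Suc)
    ultimately have "((\<lambda>t. (\<Sum>i<Suc j. c' i * F i t) / (t - x) ^ j) \<longlongrightarrow> 0) (at x within J)"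
      by (auto dest: tendsto_cong simp del: sum.lessThan_Suc divide_cancel_right mult_cancel_left)
    moreover have "(\<Sum>i<Suc j. c' i * F i x) = 0" unfolding eq[OF x] by (simp add: y_def k_def)
    ultimately have "vanishes_to_order J (\<lambda>t. \<Sum>i<Suc j. c' i * F i t) x (Suc j)"
      by (simp add: vanishes_to_order_def del: sum.lessThan_Suc)
    from wronski_propertyD[OF Suc.prems(2) x _ _ this, of "Suc i"] have "c' (Suc i) = 0"
      using i j by simp
    then show "c i = 0" by (simp add: c'_def)
  qed
  have "\<exists>\<epsilon>' \<rho>' \<Phi>'. (\<forall>j. \<epsilon>' j \<in> {1, -1 :: real}) \<and>
     (\<forall>i<n. Ck J (n - 1 - i) (\<rho>' i) \<and> (\<forall>t\<in>J. \<rho>' i t > 0)) \<and>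
     (\<forall>j<n. \<forall>t\<in>J. \<epsilon>' j * F' j t = \<rho>' 0 t * \<Phi>' 0 j t) \<and>
     (\<forall>i j. \<forall>t\<in>J. Suc i < n \<longrightarrow> j < n \<longrightarrow> (\<Phi>' i j has_real_derivative \<rho>' (Suc i) t * \<Phi>' (Suc i) j t) (at t within J)) \<and>
     (\<forall>i<n. \<forall>t. \<Phi>' i i t = 1 \<and> (\<forall>j<i. \<Phi>' i j t = 0))"
    by (rule Suc.IH[OF _ W']) (rule F'(2))
  then obtain \<epsilon>' \<rho>' \<Phi>' where IH0: "\<forall>j. \<epsilon>' j \<in> {1, -1 :: real}"
     "\<forall>i<n. Ck J (n - 1 - i) (\<rho>' i) \<and> (\<forall>t\<in>J. \<rho>' i t > 0)"
     "\<forall>j<n. \<forall>t\<in>J. \<epsilon>' j * F' j t = \<rho>' 0 t * \<Phi>' 0 j t"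
     "\<forall>i j. \<forall>t\<in>J. Suc i < n \<longrightarrow> j < n \<longrightarrow> (\<Phi>' i j has_real_derivative \<rho>' (Suc i) t * \<Phi>' (Suc i) j t) (at t within J)"
     "\<forall>i<n. \<forall>t. \<Phi>' i i t = 1 \<and> (\<forall>j<i. \<Phi>' i j t = 0)"
    by (elim exE conjE)
  have IH: "\<And>j. \<epsilon>' j \<in> {1, -1 :: real}"
      "\<And>i. i < n \<Longrightarrow> Ck J (n - 1 - i) (\<rho>' i)" "\<And>i t. i < n \<Longrightarrow> t \<in> J \<Longrightarrow> \<rho>' i t > 0"
      "\<And>j t. j < n \<Longrightarrow> t \<in> J \<Longrightarrow> \<epsilon>' j * F' j t = \<rho>' 0 t * \<Phi>' 0 j t"
      "\<And>i j t. t \<in> J \<Longrightarrow> Suc i < n \<Longrightarrow> j < n \<Longrightarrow> (\<Phi>' i j has_real_derivative \<rho>' (Suc i) t * \<Phi>' (Suc i) j t) (at t within J)"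
      "\<And>i t. i < n \<Longrightarrow> \<Phi>' i i t = 1" "\<And>i j t. i < n \<Longrightarrow> j < i \<Longrightarrow> \<Phi>' i j t = 0"
    using IH0 by blast+
  define \<epsilon> where "\<epsilon> j = (case j of 0 \<Rightarrow> e | Suc j \<Rightarrow> e * \<epsilon>' j)" for j
  define \<rho> where "\<rho> i = (case i of 0 \<Rightarrow> (\<lambda>t. e * F 0 t) | Suc i \<Rightarrow> \<rho>' i)" for i
  define \<Phi> where "\<Phi> i j = (case i of 0 \<Rightarrow> (case j of 0 \<Rightarrow> (\<lambda>t. 1) | Suc j \<Rightarrow> (\<lambda>t. \<epsilon>' j * G j t))
     | Suc i \<Rightarrow> (case j of 0 \<Rightarrow> (\<lambda>t. 0) | Suc j \<Rightarrow> \<Phi>' i j))" for i j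
  show ?case
  proof (rule exI[of _ \<epsilon>], rule exI[of _ \<rho>], rule exI[of _ \<Phi>], intro conjI allI impI ballI)
    show "\<epsilon> j \<in> {1, -1}" for j using e(1) IH(1)[of "j - 1"] by (cases j) (auto simp: \<epsilon>_def)
    show "Ck J (Suc n - 1 - i) (\<rho> i)" if "i < Suc n" for i
    proof (cases i)
      case 0
      have "Ck J n (\<lambda>t. e * F 0 t)" using Suc.prems(1)[of 0] by (intro Ck_mult Ck_const) simp
      then show ?thesis using 0 by (simp add: \<rho>_def)
    next
      case (Suc i')
      then show ?thesis using IH(2)[of i'] that by (simp add: \<rho>_def)
    qed
    show "\<rho> i t > 0" if "i < Suc n" "t \<in> J" for i t
      using that e(2) IH(3) by (cases i) (auto simp: \<rho>_def)
    show "\<epsilon> j * F j t = \<rho> 0 t * \<Phi> 0 j t" if "j < Suc n" "t \<in> J" for j t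
      using that u0[OF that(2)] by (cases j) (simp_all add: \<rho>_def \<Phi>_def \<epsilon>_def G_def)
    show "(\<Phi> i j has_real_derivative \<rho> (Suc i) t * \<Phi> (Suc i) j t) (at t within J)"
      if "t \<in> J" "Suc i < Suc n" "j < Suc n" for i j t
    proof (cases i)
      case 0
      show ?thesis
      proof (cases j)
        case 0
        then show ?thesis using \<open>i = 0\<close> by (simp add: \<Phi>_def)
      next
        case (Suc j')
        have "((\<lambda>t. \<epsilon>' j' * G j' t) has_real_derivative \<epsilon>' j' * F' j' t) (at t within J)"
          using F'(1)[of j' t] that Suc by (intro DERIV_cmult) auto
        then show ?thesis using 0 Suc IH(4)[of j' t] that by (simp add: \<Phi>_def \<rho>_def)
      qed
    next
      case (Suc i')
      then show ?thesis using IH(5)[of t i' "j - 1"] that by (cases j) (auto simp: \<Phi>_def \<rho>_def)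
    qed
    show "\<Phi> i i t = 1" if "i < Suc n" for i t using that IH(6) by (cases i) (auto simp: \<Phi>_def)
    show "\<Phi> i j t = 0" if "i < Suc n" "j < i" for i j t using that IH(7) by (cases i; cases j) (auto simp: \<Phi>_def)
  qed
qed

text \<open>Ordinary derivatives are recovered from the quasi-derivatives by the product rule; differentiating \<open>B q q * \<phi> q\<close> produces
the new diagonal coefficient \<open>B q q * \<rho> (q + 1)\<close>.\<close>

theorem derivatives_from_quasi_derivatives:
  assumes \<rho>: "\<And>i. i < n \<Longrightarrow> Ck J (n - 1 - i) (\<rho> i)" "\<And>i t. i < n \<Longrightarrow> t \<in> J \<Longrightarrow> \<rho> i t > 0"
    and m: "m < n"
  shows "\<exists>B. (\<forall>t. B 0 0 t = \<rho> 0 t) \<and> (\<forall>q\<le>m. (\<forall>i. Ck J (n - 1 - q) (B q i)) \<and> (\<forall>t\<in>J. B q q t > 0) \<and> (\<forall>i>q. \<forall>t. B q i t = 0)) \<and>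
     (\<forall>q<m. \<forall>\<phi>. (\<forall>i t. t \<in> J \<longrightarrow> Suc i < n \<longrightarrow> (\<phi> i has_real_derivative \<rho> (Suc i) t * \<phi> (Suc i) t) (at t within J)) \<longrightarrow>
       (\<forall>t\<in>J. ((\<lambda>t. \<Sum>i\<le>q. B q i t * \<phi> i t) has_real_derivative (\<Sum>i\<le>Suc q. B (Suc q) i t * \<phi> i t)) (at t within J)))"
  using m
proof (induction m)
  case 0
  show ?case
    using \<rho>[of 0] 0 Ck_const[of J "n - 1" 0]
    by (intro exI[of _ "\<lambda>q i. if i = 0 then \<rho> 0 else (\<lambda>_. 0)"]) auto
next
  case (Suc m)
  from Suc.IH[OF Suc_lessD[OF Suc.prems]] obtain B where B0: "\<forall>t. B 0 0 t = \<rho> 0 t"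
    "\<forall>q\<le>m. (\<forall>i. Ck J (n - 1 - q) (B q i)) \<and> (\<forall>t\<in>J. B q q t > 0) \<and> (\<forall>i>q. \<forall>t. B q i t = 0)"
     "\<forall>q<m. \<forall>\<phi>. (\<forall>i t. t \<in> J \<longrightarrow> Suc i < n \<longrightarrow> (\<phi> i has_real_derivative \<rho> (Suc i) t * \<phi> (Suc i) t) (at t within J)) \<longrightarrow>
       (\<forall>t\<in>J. ((\<lambda>t. \<Sum>i\<le>q. B q i t * \<phi> i t) has_real_derivative (\<Sum>i\<le>Suc q. B (Suc q) i t * \<phi> i t)) (at t within J))"
    by (elim exE conjE)
  have B: "\<And>t. B 0 0 t = \<rho> 0 t" "\<And>q i. q \<le> m \<Longrightarrow> Ck J (n - 1 - q) (B q i)" "\<And>q t. q \<le> m \<Longrightarrow> t \<in> J \<Longrightarrow> B q q t > 0"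
     "\<And>q i t. q \<le> m \<Longrightarrow> q < i \<Longrightarrow> B q i t = 0"
     "\<And>q \<phi> t. q < m \<Longrightarrow> (\<forall>i t. t \<in> J \<longrightarrow> Suc i < n \<longrightarrow> (\<phi> i has_real_derivative \<rho> (Suc i) t * \<phi> (Suc i) t) (at t within J)) \<Longrightarrow> t \<in> J \<Longrightarrow>
       ((\<lambda>t. \<Sum>i\<le>q. B q i t * \<phi> i t) has_real_derivative (\<Sum>i\<le>Suc q. B (Suc q) i t * \<phi> i t)) (at t within J)"
    using B0 by blast+
  have nm: "n - 1 - m = Suc (n - 1 - Suc m)" using Suc.prems by simp
  have "\<exists>D. (\<forall>x\<in>J. (B m i has_real_derivative D x) (at x within J)) \<and> Ck J (n - 1 - Suc m) D" for i
    using B(2)[of m i] unfolding nm by simp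
  then obtain D where D: "\<And>i x. x \<in> J \<Longrightarrow> (B m i has_real_derivative D i x) (at x within J)" "\<And>i. Ck J (n - 1 - Suc m) (D i)"
    using that[of "\<lambda>i. SOME D. (\<forall>x\<in>J. (B m i has_real_derivative D x) (at x within J)) \<and> Ck J (n - 1 - Suc m) D"] someI_ex by (metis (mono_tags, lifting))
  \<comment> \<open>The coefficients of the derivative of the combination of order \<open>m\<close>, by the product rule.\<close>
  define C where "C i t = (if i \<le> m then D i t else 0) + (case i of 0 \<Rightarrow> 0 | Suc i' \<Rightarrow> if i \<le> Suc m then B m i' t * \<rho> i t else 0)" for i t
  have CC: "Ck J (n - 1 - Suc m) (C i)" for i
  proof -
    have "Ck J (n - 1 - Suc m) (\<lambda>t. if i \<le> m then D i t else 0)"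
      using D(2)[of i] Ck_const[of J "n - 1 - Suc m" 0] by (cases "i \<le> m") simp_all
    moreover have "Ck J (n - 1 - Suc m) (\<lambda>t. case i of 0 \<Rightarrow> 0 | Suc i' \<Rightarrow> if i \<le> Suc m then B m i' t * \<rho> i t else 0)"
    proof (cases i)
      case 0
      then show ?thesis using Ck_const[of J "n - 1 - Suc m" 0] by simp
    next
      case (Suc i')
      show ?thesis
      proof (cases "i \<le> Suc m")
        case True
        have "Ck J (n - 1 - Suc m) (\<lambda>t. B m i' t * \<rho> i t)"
        proof (rule Ck_mult)
          show "Ck J (n - 1 - Suc m) (B m i')" by (rule Ck_le[OF _ B(2)[of m i']]) auto
          show "Ck J (n - 1 - Suc m) (\<rho> i)" by (rule Ck_le[OF _ \<rho>(1)[of i]]) (use True Suc.prems in auto)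
        qed
        then show ?thesis using Suc True by simp
      next
        case False
        then show ?thesis using Suc Ck_const[of J "n - 1 - Suc m" 0] by simp
      qed
    qed
    ultimately show ?thesis unfolding C_def[abs_def] by (rule Ck_add)
  qed
  have step: "((\<lambda>t. \<Sum>i\<le>m. B m i t * \<phi> i t) has_real_derivative (\<Sum>i\<le>Suc m. C i t * \<phi> i t)) (at t within J)"
    if \<phi>: "\<And>i t. t \<in> J \<Longrightarrow> Suc i < n \<Longrightarrow> (\<phi> i has_real_derivative \<rho> (Suc i) t * \<phi> (Suc i) t) (at t within J)" and t: "t \<in> J" for \<phi> t
  proof -
    have "((\<lambda>t. \<Sum>i\<le>m. B m i t * \<phi> i t) has_real_derivative (\<Sum>i\<le>m. D i t * \<phi> i t + \<rho> (Suc i) t * \<phi> (Suc i) t * B m i t)) (at t within J)"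
      using D(1)[OF t] \<phi>[OF t] Suc.prems by (intro DERIV_sum DERIV_mult) auto
    moreover have "(\<Sum>i\<le>Suc m. C i t * \<phi> i t) = (\<Sum>i\<le>Suc m. (if i \<le> m then D i t * \<phi> i t else 0)) +
        (\<Sum>i\<le>Suc m. case i of 0 \<Rightarrow> 0 | Suc i' \<Rightarrow> B m i' t * \<rho> i t * \<phi> i t)"
      unfolding sum.distrib[symmetric]
      by (intro sum.cong) (auto simp: C_def distrib_right split: nat.split)
    moreover have "(\<Sum>i\<le>Suc m. (if i \<le> m then D i t * \<phi> i t else 0)) = (\<Sum>i\<le>m. D i t * \<phi> i t)"
      by simp
    moreover have "(\<Sum>i\<le>Suc m. case i of 0 \<Rightarrow> 0 | Suc i' \<Rightarrow> B m i' t * \<rho> i t * \<phi> i t) = (\<Sum>i\<le>m. B m i t * \<rho> (Suc i) t * \<phi> (Suc i) t)"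
      by (simp add: sum.atMost_Suc_shift del: sum.atMost_Suc)
    ultimately show ?thesis by (simp add: sum.distrib mult_ac)
  qed
  define B' where "B' q = (if q = Suc m then C else B q)" for q
  have "B' 0 0 t = \<rho> 0 t" for t by (simp add: B'_def B(1))
  moreover have "Ck J (n - 1 - q) (B' q i)" if "q \<le> Suc m" for q i
    using that CC[of i] B(2)[of q i] by (cases "q = Suc m") (auto simp: B'_def)
  moreover have "B' q q t > 0" if "q \<le> Suc m" "t \<in> J" for q t
    using that B(3)[of q t] B(3)[of m t] \<rho>(2)[of "Suc m" t] Suc.prems by (cases "q = Suc m") (auto simp: B'_def C_def)
  moreover have "B' q i t = 0" if "q \<le> Suc m" "q < i" for q i t
    using that B(4)[of q i t] by (cases "q = Suc m") (auto simp: B'_def C_def split: nat.split)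
  moreover have "((\<lambda>t. \<Sum>i\<le>q. B' q i t * \<phi> i t) has_real_derivative (\<Sum>i\<le>Suc q. B' (Suc q) i t * \<phi> i t)) (at t within J)"
    if "q < Suc m" "\<forall>i t. t \<in> J \<longrightarrow> Suc i < n \<longrightarrow> (\<phi> i has_real_derivative \<rho> (Suc i) t * \<phi> (Suc i) t) (at t within J)" "t \<in> J" for q \<phi> t
    using that B(5)[of q \<phi> t] step[of \<phi> t] by (cases "q = m") (auto simp: B'_def simp del: sum.atMost_Suc)
  ultimately show ?case by (intro exI[of _ B']) blast
qed

section \<open>Solutions of disconjugate equations\<close>

text \<open>A function together with its derivatives, in place of iterated derivatives within a set.\<close>

definition jet :: "nat \<Rightarrow> real set \<Rightarrow> (nat \<Rightarrow> real \<Rightarrow> real) \<Rightarrow> bool" where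
  "jet n I Y \<longleftrightarrow> (\<forall>j<n. \<forall>x\<in>I. (Y j has_real_derivative Y (Suc j) x) (at x within I))"

definition solution_jet :: "nat \<Rightarrow> (nat \<Rightarrow> real \<Rightarrow> real) \<Rightarrow> real set \<Rightarrow> (nat \<Rightarrow> real \<Rightarrow> real) \<Rightarrow> bool" where
  "solution_jet n p I Y \<longleftrightarrow> jet n I Y \<and> (\<forall>x\<in>I. Y n x + (\<Sum>i=1..n. p i x * Y (n - i) x) = 0)"

lemma jetD: "jet n I Y \<Longrightarrow> j < n \<Longrightarrow> x \<in> I \<Longrightarrow> (Y j has_real_derivative Y (Suc j) x) (at x within I)"
  by (simp add: jet_def)

lemma jet_continuous: "jet n I Y \<Longrightarrow> j < n \<Longrightarrow> continuous_on I (Y j)"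
  by (rule DERIV_continuous_on) (rule jetD)

lemma jet_subset: "jet n I Y \<Longrightarrow> J \<subseteq> I \<Longrightarrow> jet n J Y"
  unfolding jet_def using has_field_derivative_subset by blast

lemma jet_sum: "(\<And>i. i \<in> A \<Longrightarrow> jet n I (Y i)) \<Longrightarrow> jet n I (\<lambda>j t. \<Sum>i\<in>A. c i * Y i j t)"
  unfolding jet_def by (intro allI impI ballI DERIV_sum DERIV_cmult) auto

lemma solution_jet_sum:
  assumes "\<And>i. i \<in> A \<Longrightarrow> solution_jet n p I (Y i)"
  shows "solution_jet n p I (\<lambda>j t. \<Sum>i\<in>A. c i * Y i j t)"
  unfolding solution_jet_def
proof (intro conjI jet_sum ballI)
  fix x assume x: "x \<in> I"
  have "(\<Sum>r=1..n. p r x * (\<Sum>i\<in>A. c i * Y i (n - r) x)) = (\<Sum>i\<in>A. c i * (\<Sum>r=1..n. p r x * Y i (n - r) x))"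
    unfolding sum_distrib_left by (subst sum.swap) (simp add: mult_ac)
  then have "(\<Sum>i\<in>A. c i * Y i n x) + (\<Sum>r=1..n. p r x * (\<Sum>i\<in>A. c i * Y i (n - r) x)) =
     (\<Sum>i\<in>A. c i * (Y i n x + (\<Sum>r=1..n. p r x * Y i (n - r) x)))"
    by (simp add: distrib_left sum.distrib)
  also have "\<dots> = 0" using assms x by (simp add: solution_jet_def)
  finally show "(\<Sum>i\<in>A. c i * Y i n x) + (\<Sum>r=1..n. p r x * (\<Sum>i\<in>A. c i * Y i (n - r) x)) = 0" .
qed (use assms in \<open>auto simp: solution_jet_def\<close>)

lemma solution_jet_diff:
  assumes "solution_jet n p I Y" "solution_jet n p I Z"
  shows "solution_jet n p I (\<lambda>j t. Y j t - Z j t)"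
  using solution_jet_sum[of UNIV n p I "\<lambda>s. if s then Y else Z" "\<lambda>s. if s then 1 else -1"] assms
  by (simp add: UNIV_bool)

lemma at_within_interval_nontrivial:
  fixes I :: "real set"
  assumes "is_interval I" "interior I \<noteq> {}" "x \<in> I"
  shows "at x within I \<noteq> bot"
proof -
  obtain a where a: "a \<in> I" "a \<noteq> x"
    using assms by (metis ex_in_conv interior_singleton is_singletonI' is_singleton_the_elem)
  then have "x islimpt I"
    using assms by (intro connected_imp_perfect) (auto simp: is_interval_connected)
  then show ?thesis by (simp add: trivial_limit_within)
qed

lemma iter_deriv_jet:
  assumes I: "is_interval I" "interior I \<noteq> {}" and Y: "jet n I Y"
  shows "j \<le> n \<Longrightarrow> x \<in> I \<Longrightarrow> iter_deriv I j (Y 0) x = Y j x"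
proof (induction j arbitrary: x)
  case (Suc j)
  have "(Y j has_real_derivative Y (Suc j) x) (at x within I)" using Y Suc.prems by (intro jetD) auto
  then have "(iter_deriv I j (Y 0) has_real_derivative Y (Suc j) x) (at x within I)"
    by (rule has_field_derivative_transform_within[where d = 1]) (use Suc in auto)
  then show ?case
    unfolding iter_deriv_Suc using at_within_interval_nontrivial[OF I Suc.prems(2)]
    by (intro vector_derivative_within) (auto simp: has_real_derivative_iff_has_vector_derivative)
qed simp

lemma iter_deriv_jet_differentiable:
  assumes I: "is_interval I" "interior I \<noteq> {}" and Y: "jet n I Y" and j: "j < n"
  shows "iter_deriv I j (Y 0) differentiable_on I"
proof -
  have "(iter_deriv I j (Y 0) has_real_derivative Y (Suc j) x) (at x within I)" if x: "x \<in> I" for x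
    using jetD[OF Y j x] by (rule has_field_derivative_transform_within[where d = 1])
      (use x j iter_deriv_jet[OF I Y] in auto)
  then show ?thesis by (auto simp: differentiable_on_def real_differentiable_def)
qed

lemma is_solution_jet:
  assumes I: "is_interval I" "interior I \<noteq> {}" and Y: "solution_jet n p I Y"
  shows "is_solution n p I (Y 0)"
  using Y iter_deriv_jet[OF I, of n Y] iter_deriv_jet_differentiable[OF I, of n Y]
  by (auto simp: is_solution_def solution_jet_def)

lemma solution_jet_iter_deriv:
  assumes I: "is_interval I" "interior I \<noteq> {}" and y: "is_solution n p I y"
  shows "solution_jet n p I (\<lambda>j. iter_deriv I j y)"
  unfolding solution_jet_def jet_def
proof (intro conjI allI impI ballI)
  fix j x assume "j < n" "x \<in> I"
  then show "(iter_deriv I j y has_real_derivative iter_deriv I (Suc j) y x) (at x within I)"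
    using iter_deriv_Suc_has_derivative[OF I, of x "iter_deriv I j y"] y
    by (simp add: is_solution_def iter_deriv_Suc)
qed (use y in \<open>simp add: is_solution_def\<close>)

lemma vanishes_jet:
  assumes I: "is_interval I" "interior I \<noteq> {}" and Y: "jet n I Y" and x: "x \<in> I" and m: "m \<le> n"
  shows "vanishes_to_order I (Y 0) x m \<longleftrightarrow> (\<forall>j<m. Y j x = 0)"
proof -
  have "vanishes_to_order I (Y 0) x m \<longleftrightarrow> (\<forall>j<m. iter_deriv I j (Y 0) x = 0)"
    by (rule vanishes_to_order_iff_derivs[OF I x iter_deriv_jet_differentiable[OF I Y]]) (use m in auto)
  then show ?thesis using iter_deriv_jet[OF I Y _ x] m by auto
qed

lemma jet_zero:
  assumes I: "is_interval I" "interior I \<noteq> {}" and Y: "jet n I Y" and z: "\<And>x. x \<in> I \<Longrightarrow> Y 0 x = 0"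
    and j: "j \<le> n" and x: "x \<in> I"
  shows "Y j x = 0"
  using j x
proof (induction j arbitrary: x)
  case (Suc j)
  have 1: "(Y j has_real_derivative Y (Suc j) x) (at x within I)" using Y Suc.prems by (intro jetD) auto
  have "((\<lambda>_. 0) has_real_derivative 0) (at x within I)" by simp
  then have 2: "(Y j has_real_derivative 0) (at x within I)"
    by (rule has_field_derivative_transform_within[where d = 1]) (use Suc in auto)
  show ?case
    using vector_derivative_within[OF at_within_interval_nontrivial[OF I Suc.prems(2)]] 1 2
    unfolding has_real_derivative_iff_has_vector_derivative by metis
qed (use z in simp)

text \<open>Disconjugacy as it is used below: \<open>n\<close> zeros, distributed over finitely many points, force a solution to vanish.\<close>

lemma disconjugate_zeros:
  assumes I: "is_interval I" "interior I \<noteq> {}" and dis: "disconjugate n p I" and Y: "solution_jet n p I Y"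
    and F: "finite F" "F \<subseteq> I" and n: "0 < n" "n \<le> (\<Sum>x\<in>F. m x)" "\<And>x. x \<in> F \<Longrightarrow> m x \<le> n"
    and z: "\<And>x j. x \<in> F \<Longrightarrow> j < m x \<Longrightarrow> Y j x = 0" and t: "t \<in> I"
  shows "Y 0 t = 0"
proof (rule ccontr)
  assume "Y 0 t \<noteq> 0"
  then have "zero_count I (Y 0) \<le> enat (n - 1)"
    using dis is_solution_jet[OF I Y] t by (auto simp: disconjugate_def)
  moreover have "(\<Sum>x\<in>F. zero_mult I (Y 0) x) \<le> zero_count I (Y 0)"
    unfolding zero_count_def using F by (intro SUP_upper) auto
  moreover have "(\<Sum>x\<in>F. enat (m x)) \<le> (\<Sum>x\<in>F. zero_mult I (Y 0) x)"
  proof (rule sum_mono)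
    fix x assume x: "x \<in> F"
    have "vanishes_to_order I (Y 0) x (m x)"
      using vanishes_jet[OF I, of n Y x "m x"] Y F n(3)[OF x] z x by (auto simp: solution_jet_def)
    then show "enat (m x) \<le> zero_mult I (Y 0) x"
      unfolding zero_mult_def by (intro SUP_upper) auto
  qed
  moreover have "(\<Sum>x\<in>F. enat (m x)) = enat (\<Sum>x\<in>F. m x)"
    using F(1) by (induction F) (auto simp: zero_enat_def)
  ultimately have "enat (\<Sum>x\<in>F. m x) \<le> enat (n - 1)" by (metis order_trans)
  then show False using n by simp
qed

text \<open>Rolle's theorem with multiplicities: between neighbouring zeros of the function there is one of its derivative, and a zero of
multiplicity \<open>m\<close> leaves one of multiplicity \<open>m - 1\<close>. Thus the number of zeros drops at most by one with each derivative.\<close>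

theorem hermite_rolle:
  fixes f :: "nat \<Rightarrow> real \<Rightarrow> real"
  assumes "\<And>r. r \<le> i \<Longrightarrow> continuous_on {u..v} (f r)"
    and "\<And>r t. r < i \<Longrightarrow> u < t \<Longrightarrow> t < v \<Longrightarrow> (f r has_real_derivative f (Suc r) t) (at t)"
    and "finite F" "F \<subseteq> {u..v}" "i < (\<Sum>q\<in>F. m q)"
    and "\<And>q r. q \<in> F \<Longrightarrow> r < m q \<Longrightarrow> r \<le> i \<Longrightarrow> f r q = 0"
  shows "\<exists>\<xi>\<in>{u..v}. f i \<xi> = 0"
  using assms
proof (induction i arbitrary: f F m)
  case 0
  then obtain q where "q \<in> F" "m q \<noteq> 0" by (metis less_irrefl sum.neutral)
  then show ?case using "0.prems"(4,6) by (intro bexI[of _ q]) auto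
next
  case (Suc i)
  define G where "G = {q\<in>F. m q \<noteq> 0}"
  have G: "finite G" "G \<subseteq> {u..v}" using Suc.prems(3,4) by (auto simp: G_def)
  have Gs: "(\<Sum>q\<in>G. m q) = (\<Sum>q\<in>F. m q)" unfolding G_def using Suc.prems(3) by (intro sum.mono_neutral_left) auto
  then have Gne: "G \<noteq> {}" using Suc.prems(5) by auto
  define H where "H = G - {Max G}"
  have gap: "\<exists>z. q < z \<and> z \<in> {u..v} \<and> f 1 z = 0 \<and> (\<forall>q'\<in>G. q < q' \<longrightarrow> z < q')" if "q \<in> H" for q
  proof -
    define s where "s = Min {q'\<in>G. q < q'}"
    have q: "q \<in> G" "q \<noteq> Max G" using that by (auto simp: H_def)
    then have "q < Max G" using G(1) by (simp add: order.not_eq_order_implies_strict)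
    then have ne: "{q'\<in>G. q < q'} \<noteq> {}" using Max_in[OF G(1) Gne] by blast
    have s: "s \<in> G" "q < s" using Min_in[OF _ ne] G(1) by (auto simp: s_def)
    have sl: "s \<le> q'" if "q' \<in> G" "q < q'" for q' using that G(1) unfolding s_def by (intro Min_le) auto
    have I: "q \<in> {u..v}" "s \<in> {u..v}" using q s G by auto
    have z: "f 0 q = 0" "f 0 s = 0" using Suc.prems(6)[of _ 0] q s by (auto simp: G_def)
    have "\<exists>z. q < z \<and> z < s \<and> f 1 z = 0"
    proof (rule ccontr)
      assume neg: "\<not> ?thesis"
      have "\<exists>z>q. z < s \<and> (f 0 has_real_derivative 0) (at z)"
      proof -
        have "\<exists>z>q. z < s \<and> DERIV (f 0) z :> 0"
        proof (rule Rolle[OF s(2)])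
          show "f 0 q = f 0 s" using z by simp
          show "continuous_on {q..s} (f 0)"
            by (rule continuous_on_subset[OF Suc.prems(1)[of 0]]) (use I in auto)
          show "f 0 differentiable (at x)" if "q < x" "x < s" for x
            using Suc.prems(2)[of 0 x] that I by (auto simp: real_differentiable_def)
        qed
        then show ?thesis .
      qed
      then obtain z where z: "q < z" "z < s" "(f 0 has_real_derivative 0) (at z)" by blast
      have "(f 0 has_real_derivative f 1 z) (at z)" using Suc.prems(2)[of 0 z] z I by auto
      then have "f 1 z = 0" using z(3) DERIV_unique by blast
      then show False using neg z by blast
    qed
    then obtain z where "q < z" "z < s" "f 1 z = 0" by blast
    then show ?thesis using sl I by (intro exI[of _ z]) force
  qed
  obtain z where z: "\<And>q. q \<in> H \<Longrightarrow> q < z q" "\<And>q. q \<in> H \<Longrightarrow> z q \<in> {u..v}" "\<And>q. q \<in> H \<Longrightarrow> f 1 (z q) = 0"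
     "\<And>q q'. q \<in> H \<Longrightarrow> q' \<in> G \<Longrightarrow> q < q' \<Longrightarrow> z q < q'"
    using gap by metis
  have HG: "H \<subseteq> G" "finite H" using G(1) by (auto simp: H_def)
  have inj: "inj_on z H"
  proof (rule inj_onI)
    fix q q' assume q: "q \<in> H" "q' \<in> H" "z q = z q'"
    show "q = q'"
    proof (rule ccontr)
      assume "q \<noteq> q'"
      then consider "q < q'" | "q' < q" by linarith
      then show False
      proof cases
        case 1
        then show False using z(4)[of q q'] z(1)[of q'] q HG by force
      next
        case 2
        then show False using z(4)[of q' q] z(1)[of q] q HG by force
      qed
    qed
  qed
  have disj: "G \<inter> z ` H = {}" using z(1,4) by fastforce
  \<comment> \<open>Multiplicities for the derivative: the \<open>z q\<close> are the new zeros in the gaps.\<close>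
  define m' where "m' q = (if q \<in> G then m q - 1 else 1)" for q
  have cH: "Suc (card H) = card G" unfolding H_def using G(1) Gne by (intro card_Suc_Diff1) auto
  have "(\<Sum>q\<in>G \<union> z ` H. m' q) = (\<Sum>q\<in>G. m' q) + (\<Sum>q\<in>z ` H. m' q)"
    using G HG disj by (intro sum.union_disjoint) auto
  moreover have "(\<Sum>q\<in>z ` H. m' q) = (\<Sum>q\<in>z ` H. 1)"
    by (intro sum.cong) (use disj in \<open>auto simp: m'_def\<close>)
  moreover have "(\<Sum>q\<in>z ` H. (1::nat)) = card H" by (simp add: card_image[OF inj])
  moreover have "(\<Sum>q\<in>G. m' q) + card G = (\<Sum>q\<in>G. m q)"
  proof -
    have "(\<Sum>q\<in>G. m' q) + card G = (\<Sum>q\<in>G. m' q + 1)" by (simp only: sum.distrib card_eq_sum)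
    also have "\<dots> = (\<Sum>q\<in>G. m q)" by (intro sum.cong) (auto simp: m'_def G_def)
    finally show ?thesis .
  qed
  ultimately have "i < (\<Sum>q\<in>G \<union> z ` H. m' q)" using Suc.prems(5) Gs cH by linarith
  then have "\<exists>\<xi>\<in>{u..v}. (\<lambda>r. f (Suc r)) i \<xi> = 0"
  proof (rule Suc.IH[rotated 4])
    show "f (Suc r) q = 0" if "q \<in> G \<union> z ` H" "r < m' q" "r \<le> i" for q r
    proof (cases "q \<in> G")
      case True
      then show ?thesis using Suc.prems(6)[of q "Suc r"] that by (auto simp: m'_def G_def)
    next
      case False
      then show ?thesis using that z(3) by (auto simp: m'_def)
    qed
  qed (use Suc.prems(1,2) G HG z(2) in auto)
  then show ?case by simp
qed

lemma common_subsequence: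
  fixes f :: "nat \<Rightarrow> nat \<Rightarrow> real"
  assumes "\<And>r m. r < N \<Longrightarrow> \<bar>f r m\<bar> \<le> B"
  shows "\<exists>\<sigma> l. strict_mono (\<sigma> :: nat \<Rightarrow> nat) \<and> (\<forall>r<N. (\<lambda>m. f r (\<sigma> m)) \<longlonglongrightarrow> l r)"
  using assms
proof (induction N)
  case 0
  show ?case by (intro exI[of _ id]) (auto simp: strict_mono_def)
next
  case (Suc N)
  then obtain \<sigma> l where \<sigma>: "strict_mono (\<sigma> :: nat \<Rightarrow> nat)" "\<And>r. r < N \<Longrightarrow> (\<lambda>m. f r (\<sigma> m)) \<longlonglongrightarrow> l r"
    by (metis less_SucI)
  have "bounded (range (\<lambda>m. f N (\<sigma> m)))"
    using Suc.prems by (auto simp: bounded_iff intro!: exI[of _ B])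
  from bounded_imp_convergent_subsequence[OF this]
  obtain l' \<tau> where \<tau>: "strict_mono (\<tau> :: nat \<Rightarrow> nat)" "((\<lambda>m. f N (\<sigma> m)) \<circ> \<tau>) \<longlonglongrightarrow> l'" by blast
  have "(\<lambda>m. f r ((\<sigma> \<circ> \<tau>) m)) \<longlonglongrightarrow> (l(N := l')) r" if "r < Suc N" for r
  proof (cases "r = N")
    case True
    then show ?thesis using \<tau>(2) by (simp add: o_def)
  next
    case False
    then show ?thesis using LIMSEQ_subseq_LIMSEQ[OF \<sigma>(2)[of r] \<tau>(1)] that by (simp add: o_def)
  qed
  then show ?case using strict_mono_o[OF \<sigma>(1) \<tau>(1)] by blast
qed

lemma taylor_part_linear:
  "taylor_part n (\<lambda>r. \<Sum>i\<in>A. c i * w i r) d k t = (\<Sum>i\<in>A. c i * taylor_part n (w i) d k t)"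
proof -
  have "taylor_part n (\<lambda>r. \<Sum>i\<in>A. c i * w i r) d k t =
    (\<Sum>r<n. \<Sum>i\<in>A. c i * (if k \<le> r then w i r * (t - d) ^ (r - k) / fact (r - k) else 0))"
    unfolding taylor_part_def
    by (intro sum.cong refl) (auto simp: sum_distrib_left sum_distrib_right sum_divide_distrib mult_ac)
  then show ?thesis unfolding taylor_part_def sum_distrib_left by (subst (asm) sum.swap) 
qed

text \<open>A polynomial of degree less than \<open>n\<close> is determined by its Taylor data at any point.\<close>

lemma taylor_part_reexpand:
  "taylor_part n (\<lambda>r. taylor_part n \<eta> e r d) d k t = taylor_part n \<eta> e k t"
proof -
  define D where "D k t = taylor_part n (\<lambda>r. taylor_part n \<eta> e r d) d k t - taylor_part n \<eta> e k t" for k t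
  have D': "(D k has_real_derivative D (Suc k) t) (at t)" for k t
    unfolding D_def[abs_def] by (intro DERIV_diff taylor_part_deriv)
  have "\<forall>t. D (n - m) t = 0" for m
  proof (induction m)
    case 0
    show ?case by (simp add: D_def taylor_part_n)
  next
    case (Suc m)
    show ?case
    proof (cases "m < n")
      case True
      then have "Suc (n - Suc m) = n - m" by simp
      then have "\<forall>t. DERIV (D (n - Suc m)) t :> 0" using D'[of "n - Suc m"] Suc by simp
      then have "D (n - Suc m) t = D (n - Suc m) d" for t by (rule DERIV_isconst_all)
      moreover have "D (n - Suc m) d = 0" using True by (simp add: D_def taylor_part_d)
      ultimately show ?thesis by simp
    next
      case False
      then show ?thesis using Suc by simp
    qed
  qed
  from this[of "n - k"] have "D k t = 0"
    by (cases "k \<le> n") (auto simp: D_def taylor_part_n)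
  then show ?thesis by (simp add: D_def)
qed

lemma glue_deriv:
  assumes f: "(f has_real_derivative D) (at_left d)" and g: "(g has_real_derivative D) (at_right d)" and eq: "f d = g d"
  shows "((\<lambda>t. if t \<le> d then f t else g t) has_real_derivative D) (at d)"
  unfolding has_field_derivative_iff
proof (rule filterlim_split_at)
  have "((\<lambda>t. (f t - f d) / (t - d)) \<longlongrightarrow> D) (at_left d)" using f by (simp add: has_field_derivative_iff)
  then show "((\<lambda>t. ((if t \<le> d then f t else g t) - (if d \<le> d then f d else g d)) / (t - d)) \<longlongrightarrow> D) (at_left d)"
    by (rule Lim_transform_within[where d = 1]) auto
  have "((\<lambda>t. (g t - g d) / (t - d)) \<longlongrightarrow> D) (at_right d)" using g by (simp add: has_field_derivative_iff)
  then show "((\<lambda>t. ((if t \<le> d then f t else g t) - (if d \<le> d then f d else g d)) / (t - d)) \<longlongrightarrow> D) (at_right d)"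
    by (rule Lim_transform_within[where d = 1]) (use eq in auto)
qed

lemma taylor_part_tendsto:
  assumes "\<And>r. r < n \<Longrightarrow> (\<lambda>m. a m r) \<longlonglongrightarrow> A r" and "\<xi> \<longlonglongrightarrow> d" and "k < n"
  shows "(\<lambda>m. taylor_part n (a m) d k (\<xi> m)) \<longlonglongrightarrow> A k"
proof -
  have "(\<lambda>m. if k \<le> q then a m q * (\<xi> m - d) ^ (q - k) / fact (q - k) else 0) \<longlonglongrightarrow>
    (if k \<le> q then A q * (d - d) ^ (q - k) / fact (q - k) else 0)" if "q < n" for q
  proof (cases "k \<le> q")
    case True
    have "(\<lambda>m. a m q * (\<xi> m - d) ^ (q - k) / fact (q - k)) \<longlonglongrightarrow> A q * (d - d) ^ (q - k) / fact (q - k)"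
      by (intro tendsto_divide tendsto_mult tendsto_power tendsto_diff tendsto_const assms(1,2) that) simp
    then show ?thesis using True by simp
  qed simp
  then have "(\<lambda>m. taylor_part n (a m) d k (\<xi> m)) \<longlonglongrightarrow> taylor_part n A d k d"
    unfolding taylor_part_def by (intro tendsto_sum) auto
  then show ?thesis using assms(3) by (simp add: taylor_part_d)
qed

text \<open>A solution on \<open>[c, d]\<close> is continued beyond \<open>d\<close> by its Taylor polynomial, which keeps the derivatives of order less than \<open>n\<close>
continuous. If the result has \<open>n\<close> zeros at \<open>x \<le> d\<close> and \<open>e > d\<close>, then Rolle's theorem finds a zero of each of these
derivatives in between; it belongs to the solution or to the polynomial.\<close>

lemma glued_zero:
  assumes I: "is_interval I" and S: "jet n I S" and T: "T = taylor_part n (\<lambda>r. S r d) d"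
    and c: "c \<in> I" "d \<in> I" "c < d" and x: "x \<in> {c..d}" and e: "d < e"
    and z: "\<And>r. r < j \<Longrightarrow> S r x = 0" "\<And>r. r < n - j \<Longrightarrow> T r e = 0" and j: "j \<le> n" and i: "i < n"
  shows "\<exists>\<xi>\<in>{x..e}. S i (min \<xi> d) * T i \<xi> = 0"
proof -
  define G where "G r t = (if t \<le> d then S r t else T r t)" for r t
  have sub: "{c..d} \<subseteq> I" using interval_subset[OF I c(1,2)] .
  have SJ: "jet n {c..d} S" using jet_subset[OF S sub] .
  have eq: "S r d = T r d" if "r < n" for r using that by (simp add: T taylor_part_d)
  have "\<exists>\<xi>\<in>{x..e}. G i \<xi> = 0"
  proof (rule hermite_rolle[where F = "{x, e}" and m = "\<lambda>q. if q = x then j else n - j"])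
    show "continuous_on {x..e} (G r)" if "r \<le> i" for r
      unfolding G_def[abs_def]
    proof (rule continuous_on_cases_le[where h = "\<lambda>t. t"])
      show "continuous_on {t \<in> {x..e}. t \<le> d} (S r)"
        by (rule continuous_on_subset[OF jet_continuous[OF S]]) (use that i x sub in auto)
      show "continuous_on {t \<in> {x..e}. d \<le> t} (T r)"
        by (rule DERIV_continuous_on) (simp add: T, rule taylor_part_deriv)
    qed (use eq that i in auto)
    show "(G r has_real_derivative G (Suc r) t) (at t)" if "r < i" "x < t" "t < e" for r t
    proof -
      consider "t < d" | "t = d" | "t > d" by linarith
      then show ?thesis
      proof cases
        case 1
        have "(S r has_real_derivative S (Suc r) t) (at t)"
          using jetD[OF SJ, of r t] that i 1 x by (simp add: at_within_Icc_at)
        then have "(G r has_real_derivative S (Suc r) t) (at t)"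
          by (rule has_field_derivative_transform_within_open[where S = "{..<d}"]) (use 1 in \<open>auto simp: G_def\<close>)
        then show ?thesis using 1 by (simp add: G_def)
      next
        case 2
        have "(S r has_real_derivative S (Suc r) d) (at_left d)"
          using jetD[OF SJ, of r d] that i c by (simp add: at_within_Icc_at_left)
        moreover have "(T r has_real_derivative S (Suc r) d) (at_right d)"
          using taylor_part_deriv[of n "\<lambda>r. S r d" d r d "{d<..}"] eq[of "Suc r"] that i by (simp add: T)
        ultimately have "((\<lambda>t. if t \<le> d then S r t else T r t) has_real_derivative S (Suc r) d) (at d)"
          using eq[of r] that i by (intro glue_deriv) auto
        then show ?thesis using 2 by (simp add: G_def[abs_def])
      next
        case 3
        have "(T r has_real_derivative T (Suc r) t) (at t)" unfolding T by (rule taylor_part_deriv)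
        then have "(G r has_real_derivative T (Suc r) t) (at t)"
          by (rule has_field_derivative_transform_within_open[where S = "{d<..}"]) (use 3 in \<open>auto simp: G_def\<close>)
        then show ?thesis using 3 by (simp add: G_def)
      qed
    qed
    show "i < (\<Sum>q\<in>{x, e}. if q = x then j else n - j)" using x e i j by auto
    show "G r q = 0" if "q \<in> {x, e}" "r < (if q = x then j else n - j)" for q r
      using that z x e by (auto simp: G_def split: if_splits)
  qed (use x e in auto)
  then show ?thesis by (auto simp: G_def min_def split: if_splits)
qed

text \<open>A compactness argument. If the claim fails for a sequence \<open>e\<^sub>m\<close> that tends to \<open>d\<close> from the right, normalize the Taylor data \<open>a\<^sub>m\<close> of the
offending solutions and pass to limits \<open>a\<close> of the data and \<open>x\<close> of the zeros of order \<open>j\<close>. If \<open>x \<noteq> d\<close>, the limit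
solution has zeros of order \<open>j\<close> at \<open>x\<close> and \<open>n - j\<close> at \<open>d\<close>, which disconjugacy excludes. If \<open>x = d\<close>, the zeros found by \<open>glued_zero\<close>
converge to \<open>d\<close>, so that all Taylor data of the limit vanish. Both contradict the normalization.\<close>

lemma eventually_no_zeros:
  assumes I: "is_interval I" "interior I \<noteq> {}" and dis: "disconjugate n p I"
    and b: "\<And>i. i < n \<Longrightarrow> solution_jet n p I (b i)" "\<And>i j. i < n \<Longrightarrow> j < n \<Longrightarrow> b i j d = (if i = j then 1 else 0)"
    and c: "c \<in> I" "d \<in> I" "c < d" and j: "1 \<le> j" "j \<le> n"
  shows "\<forall>\<^sub>F e in at_right d. \<forall>x\<in>{c..d}. \<forall>a. (\<forall>k<n - j. taylor_part n a d k e = 0) \<longrightarrow>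
    (\<forall>r<j. (\<Sum>i<n. a i * b i r x) = 0) \<longrightarrow> (\<forall>i<n. a i = 0)"
proof (rule ccontr)
  assume neg: "\<not> ?thesis"
  have sub: "{c..d} \<subseteq> I" using interval_subset[OF I(1) c(1,2)] .
  have sol_d: "(\<Sum>i<n. a i * b i r d) = a r" if "r < n" for a r
  proof -
    have "(\<Sum>i<n. a i * b i r d) = (\<Sum>i<n. if i = r then a r else 0)"
      by (intro sum.cong) (use that b(2) in auto)
    then show ?thesis using that by simp
  qed
  have "\<exists>e x a. d < e \<and> e < d + 1 / real (Suc m) \<and> x \<in> {c..d} \<and> (\<forall>k<n - j. taylor_part n a d k e = 0) \<and>
    (\<forall>r<j. (\<Sum>i<n. a i * b i r x) = 0) \<and> (\<Sum>i<n. \<bar>a i\<bar>) = 1" for m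
  proof -
    have "\<not> (\<forall>e>d. e < d + 1 / real (Suc m) \<longrightarrow> (\<forall>x\<in>{c..d}. \<forall>a. (\<forall>k<n - j. taylor_part n a d k e = 0) \<longrightarrow>
      (\<forall>r<j. (\<Sum>i<n. a i * b i r x) = 0) \<longrightarrow> (\<forall>i<n. a i = 0)))"
    proof
      assume *: "\<forall>e>d. e < d + 1 / real (Suc m) \<longrightarrow> (\<forall>x\<in>{c..d}. \<forall>a. (\<forall>k<n - j. taylor_part n a d k e = 0) \<longrightarrow>
        (\<forall>r<j. (\<Sum>i<n. a i * b i r x) = 0) \<longrightarrow> (\<forall>i<n. a i = 0))"
      show False
        by (rule notE[OF neg]) (unfold eventually_at_right_field, rule exI[of _ "d + 1 / real (Suc m)"], rule conjI, simp, rule *)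
    qed
    then obtain e x a where e: "d < e" "e < d + 1 / real (Suc m)" "x \<in> {c..d}" "\<forall>k<n - j. taylor_part n a d k e = 0"
       "\<forall>r<j. (\<Sum>i<n. a i * b i r x) = 0" "\<not> (\<forall>i<n. a i = 0)" by blast
    define N where "N = (\<Sum>i<n. \<bar>a i\<bar>)"
    have "N \<noteq> 0" using e(6) unfolding N_def by (subst sum_nonneg_eq_0_iff) auto
    moreover have "N \<ge> 0" unfolding N_def by (intro sum_nonneg) auto
    ultimately have N: "N > 0" by simp
    have "taylor_part n (\<lambda>i. inverse N * a i) d k e = 0" if "k < n - j" for k
      using taylor_part_linear[of n "\<lambda>_. inverse N" "\<lambda>_. a" "{0::nat}" d k e] e(4) that by simp
    moreover have "(\<Sum>i<n. inverse N * a i * b i r x) = 0" if "r < j" for r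
      using e(5) that by (simp add: mult.assoc sum_distrib_left[symmetric])
    moreover have "(\<Sum>i<n. \<bar>inverse N * a i\<bar>) = 1"
      using N by (simp add: abs_mult sum_distrib_left[symmetric] N_def[symmetric])
    ultimately show ?thesis using e(1-3)
      by (intro exI[of _ e] exI[of _ x] exI[of _ "\<lambda>i. inverse N * a i"]) auto
  qed
  then have "\<exists>w. \<forall>m. d < fst (w m) \<and> fst (w m) < d + 1 / real (Suc m) \<and> fst (snd (w m)) \<in> {c..d} \<and>
    (\<forall>k<n - j. taylor_part n (snd (snd (w m))) d k (fst (w m)) = 0) \<and>
    (\<forall>r<j. (\<Sum>i<n. snd (snd (w m)) i * b i r (fst (snd (w m)))) = 0) \<and> (\<Sum>i<n. \<bar>snd (snd (w m)) i\<bar>) = 1"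
    by (intro choice allI) (simp only: split_paired_Ex fst_conv snd_conv)
  then obtain w where w: "\<forall>m. d < fst (w m) \<and> fst (w m) < d + 1 / real (Suc m) \<and> fst (snd (w m)) \<in> {c..d} \<and>
    (\<forall>k<n - j. taylor_part n (snd (snd (w m))) d k (fst (w m)) = 0) \<and>
    (\<forall>r<j. (\<Sum>i<n. snd (snd (w m)) i * b i r (fst (snd (w m)))) = 0) \<and> (\<Sum>i<n. \<bar>snd (snd (w m)) i\<bar>) = 1"
    by (rule exE)
  define e where "e m = fst (w m)" for m
  define x where "x m = fst (snd (w m))" for m
  define a where "a m = snd (snd (w m))" for m
  have ex: "\<And>m. d < e m" "\<And>m. e m < d + 1 / real (Suc m)" "\<And>m. x m \<in> {c..d}"
    "\<And>m k. k < n - j \<Longrightarrow> taylor_part n (a m) d k (e m) = 0"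
    "\<And>m r. r < j \<Longrightarrow> (\<Sum>i<n. a m i * b i r (x m)) = 0" "\<And>m. (\<Sum>i<n. \<bar>a m i\<bar>) = 1"
    using w unfolding e_def x_def a_def by simp_all
  \<comment> \<open>The points \<open>x m\<close> are treated as a further component, of index \<open>n\<close>, of the data.\<close>
  have "\<exists>\<sigma> l. strict_mono (\<sigma> :: nat \<Rightarrow> nat) \<and> (\<forall>r<Suc n. (\<lambda>m. (if r < n then a (\<sigma> m) r else x (\<sigma> m))) \<longlonglongrightarrow> l r)"
  proof (rule common_subsequence[where f = "\<lambda>r m. if r < n then a m r else x m" and B = "1 + \<bar>c\<bar> + \<bar>d\<bar>"])
    fix r m assume "r < Suc n"
    have "\<bar>a m r\<bar> \<le> 1" if "r < n"
      using member_le_sum[of r "{..<n}" "\<lambda>i. \<bar>a m i\<bar>"] that ex(6)[of m] by simp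
    then show "\<bar>if r < n then a m r else x m\<bar> \<le> 1 + \<bar>c\<bar> + \<bar>d\<bar>" using ex(3)[of m] by auto
  qed
  then obtain \<sigma> A where \<sigma>: "strict_mono (\<sigma> :: nat \<Rightarrow> nat)" and lim: "\<And>r. r < Suc n \<Longrightarrow> (\<lambda>m. (if r < n then a (\<sigma> m) r else x (\<sigma> m))) \<longlonglongrightarrow> A r"
    by blast
  have al: "(\<lambda>m. a (\<sigma> m) r) \<longlonglongrightarrow> A r" if "r < n" for r using lim[of r] that by simp
  have xl: "(\<lambda>m. x (\<sigma> m)) \<longlonglongrightarrow> A n" using lim[of n] by simp
  have el: "(\<lambda>m. e (\<sigma> m)) \<longlonglongrightarrow> d"
  proof -
    have "e \<longlonglongrightarrow> d"
    proof (rule tendsto_sandwich[of "\<lambda>_. d" _ _ "\<lambda>m. d + 1 / real (Suc m)"])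
      have "(\<lambda>m. d + 1 / real (Suc m)) \<longlonglongrightarrow> d + 0" by (intro tendsto_add tendsto_const lim_inverse_n'[THEN LIMSEQ_Suc])
      then show "(\<lambda>m. d + 1 / real (Suc m)) \<longlonglongrightarrow> d" by simp
    qed (use ex(1,2) in \<open>auto intro!: always_eventually less_imp_le\<close>)
    from LIMSEQ_subseq_LIMSEQ[OF this \<sigma>] show ?thesis by (simp add: o_def)
  qed
  have x0: "A n \<in> {c..d}" by (rule closed_sequentially[OF closed_atLeastAtMost _ xl]) (rule ex(3))
  have sl: "(\<lambda>m. \<Sum>i<n. a (\<sigma> m) i * b i r (\<xi> m)) \<longlonglongrightarrow> (\<Sum>i<n. A i * b i r t)"
    if "r < n" "\<xi> \<longlonglongrightarrow> t" "t \<in> I" "\<And>m. \<xi> m \<in> I" for r \<xi> t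
  proof (intro tendsto_sum tendsto_mult)
    fix i assume "i \<in> {..<n}"
    then have i: "i < n" by simp
    then show "(\<lambda>m. a (\<sigma> m) i) \<longlonglongrightarrow> A i" by (rule al)
    have "continuous_on I (b i r)" using b(1)[OF i] that(1) by (auto simp: solution_jet_def intro: jet_continuous)
    then show "(\<lambda>m. b i r (\<xi> m)) \<longlonglongrightarrow> b i r t"
      by (rule continuous_on_tendsto_compose[OF _ that(2,3)]) (simp add: that(4))
  qed
  have A1: "(\<Sum>i<n. \<bar>A i\<bar>) = 1"
  proof -
    have "(\<lambda>m. \<Sum>i<n. \<bar>a (\<sigma> m) i\<bar>) \<longlonglongrightarrow> (\<Sum>i<n. \<bar>A i\<bar>)" using al by (intro tendsto_sum tendsto_rabs) auto
    then show ?thesis using ex(6) by (simp add: LIMSEQ_const_iff)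
  qed
  have "\<forall>i<n. A i = 0"
  proof (cases "A n = d")
    case False
    define Y where "Y r t = (\<Sum>i<n. A i * b i r t)" for r t
    have Y: "solution_jet n p I Y" unfolding Y_def[abs_def] by (rule solution_jet_sum) (use b(1) in auto)
    have zx: "Y r (A n) = 0" if "r < j" for r
    proof -
      have "(\<lambda>m. \<Sum>i<n. a (\<sigma> m) i * b i r (x (\<sigma> m))) \<longlonglongrightarrow> Y r (A n)"
        unfolding Y_def
      proof (rule sl[OF _ xl])
        show "r < n" using that j by simp
        show "A n \<in> I" using x0 sub by blast
        show "x (\<sigma> m) \<in> I" for m using ex(3) sub by blast
      qed
      then show ?thesis using ex(5)[OF that] by (simp add: LIMSEQ_const_iff)
    qed
    have zd: "Y r d = 0" if "r < n - j" for r
    proof -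
      have "(\<lambda>m. taylor_part n (a (\<sigma> m)) d r (e (\<sigma> m))) \<longlonglongrightarrow> A r"
        using that by (intro taylor_part_tendsto al el) auto
      then have "A r = 0" using ex(4)[OF that] by (simp add: LIMSEQ_const_iff)
      then show ?thesis using that sol_d[of r A] by (simp add: Y_def)
    qed
    have "Y 0 t = 0" if "t \<in> I" for t
    proof (rule disconjugate_zeros[OF I dis Y, where F = "{A n, d}" and m = "\<lambda>q. if q = d then n - j else j"])
      show "n \<le> (\<Sum>x\<in>{A n, d}. if x = d then n - j else j)" using False j by simp
    qed (use False x0 sub c j zx zd that in \<open>auto split: if_splits\<close>)
    then have "Y r d = 0" if "r < n" for r
      using jet_zero[OF I, of n Y r d] Y that c by (auto simp: solution_jet_def)
    then show ?thesis using sol_d[of _ A] by (simp add: Y_def)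
  next
    case True
    show ?thesis
    proof (intro allI impI)
      fix i assume i: "i < n"
      have "\<exists>\<xi>\<in>{x (\<sigma> m)..e (\<sigma> m)}. (\<Sum>q<n. a (\<sigma> m) q * b q i (min \<xi> d)) * taylor_part n (a (\<sigma> m)) d i \<xi> = 0" for m
      proof (rule glued_zero[OF I(1) _ _ c ex(3) ex(1) _ _ j(2) i])
        show "jet n I (\<lambda>r t. \<Sum>q<n. a (\<sigma> m) q * b q r t)"
          by (rule jet_sum) (use b(1) in \<open>auto simp: solution_jet_def\<close>)
        show "taylor_part n (a (\<sigma> m)) d = taylor_part n (\<lambda>r. \<Sum>q<n. a (\<sigma> m) q * b q r d) d"
          unfolding taylor_part_def using sol_d by (intro ext sum.cong) auto
      qed (use ex in auto)
      then obtain \<xi> where \<xi>: "\<And>m. \<xi> m \<in> {x (\<sigma> m)..e (\<sigma> m)}"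
        "\<And>m. (\<Sum>q<n. a (\<sigma> m) q * b q i (min (\<xi> m) d)) * taylor_part n (a (\<sigma> m)) d i (\<xi> m) = 0"
        by metis
      have \<xi>l: "\<xi> \<longlonglongrightarrow> d"
        by (rule tendsto_sandwich[OF _ _ xl[unfolded True] el]) (use \<xi>(1) in \<open>auto intro!: always_eventually\<close>)
      have ml: "(\<lambda>m. min (\<xi> m) d) \<longlonglongrightarrow> d" using tendsto_min[OF \<xi>l tendsto_const[of d]] by simp
      have "min (\<xi> m) d \<in> {c..d}" for m using \<xi>(1)[of m] ex(3)[of "\<sigma> m"] c(3) by auto
      then have mI: "min (\<xi> m) d \<in> I" for m using sub by blast
      have "(\<lambda>m. \<Sum>q<n. a (\<sigma> m) q * b q i (min (\<xi> m) d)) \<longlonglongrightarrow> A i"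
        using sl[OF i ml c(2) mI] sol_d[OF i] by simp
      moreover have "(\<lambda>m. taylor_part n (a (\<sigma> m)) d i (\<xi> m)) \<longlonglongrightarrow> A i"
        by (rule taylor_part_tendsto[OF _ \<xi>l i]) (rule al)
      ultimately have "(\<lambda>m. (\<Sum>q<n. a (\<sigma> m) q * b q i (min (\<xi> m) d)) * taylor_part n (a (\<sigma> m)) d i (\<xi> m)) \<longlonglongrightarrow> A i * A i"
        by (rule tendsto_mult)
      then
      have "A i * A i = 0" using \<xi>(2) by (simp add: LIMSEQ_const_iff)
      then show "A i = 0" by simp
    qed
  qed
  then show False using A1 by simp
qed

text \<open>The basis consists of the solutions \<open>U i\<close> with the Taylor data at \<open>d\<close> of \<open>(t - e)\<^bsup>n-1-i\<^esup>\<close>, up to a factor. For a combination of the first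
\<open>j\<close> of them the Taylor polynomial at \<open>d\<close> has a zero of order \<open>n - j\<close> at \<open>e\<close>, so \<open>eventually_no_zeros\<close> applies.\<close>

theorem chebyshev_basis:
  assumes I: "is_interval I" "interior I \<noteq> {}" and p: "\<And>i. i \<in> {1..n} \<Longrightarrow> continuous_on I (p i)"
    and dis: "disconjugate n p I" and n: "0 < n" and c: "c \<in> I" "d \<in> I" "c < d"
  shows "\<exists>U. (\<forall>i<n. solution_jet n p I (U i)) \<and> wronski_property {c..d} n (\<lambda>i. U i 0) \<and>
     (\<forall>Y. solution_jet n p I Y \<longrightarrow> (\<exists>\<alpha>. \<forall>j\<le>n. \<forall>x\<in>I. Y j x = (\<Sum>i<n. \<alpha> i * U i j x)))"
proof -
  have sub: "{c..d} \<subseteq> I" using interval_subset[OF I(1) c(1,2)] .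
  have J: "is_interval {c..d}" "interior {c..d} \<noteq> {}" using c(3) by (auto simp: is_interval_cc)
  have "\<exists>Y. solution_jet n p I Y \<and> (\<forall>j<n. Y j d = (if i = j then 1 else 0))" for i
    unfolding solution_jet_def jet_def conj_assoc
    by (rule linear_ode_existence[OF I(1) c(2)]) (rule p)
  then obtain b where b: "\<And>i. solution_jet n p I (b i)" "\<And>i j. j < n \<Longrightarrow> b i j d = (if i = j then 1 else 0)"
    by metis
  have sol_d: "(\<Sum>i<n. a i * b i r d) = a r" if "r < n" for a r
  proof -
    have "(\<Sum>i<n. a i * b i r d) = (\<Sum>i<n. if i = r then a r else 0)"
      by (intro sum.cong) (use that b(2) in auto)
    then show ?thesis using that by simp
  qed
  have "\<forall>\<^sub>F e in at_right d. \<forall>j\<in>{1..n}. \<forall>x\<in>{c..d}. \<forall>a. (\<forall>k<n - j. taylor_part n a d k e = 0) \<longrightarrow>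
    (\<forall>r<j. (\<Sum>i<n. a i * b i r x) = 0) \<longrightarrow> (\<forall>i<n. a i = 0)"
    by (intro eventually_ball_finite ballI eventually_no_zeros[OF I dis b c]) auto
  from eventually_happens'[OF trivial_limit_at_right_real this] obtain e where "\<forall>j\<in>{1..n}. \<forall>x\<in>{c..d}. \<forall>a. (\<forall>k<n - j. taylor_part n a d k e = 0) \<longrightarrow>
    (\<forall>r<j. (\<Sum>i<n. a i * b i r x) = 0) \<longrightarrow> (\<forall>i<n. a i = 0)" by (rule exE)
  then have e: "\<And>j x a i. j \<in> {1..n} \<Longrightarrow> x \<in> {c..d} \<Longrightarrow> (\<And>k. k < n - j \<Longrightarrow> taylor_part n a d k e = 0) \<Longrightarrow>
    (\<And>r. r < j \<Longrightarrow> (\<Sum>i<n. a i * b i r x) = 0) \<Longrightarrow> i < n \<Longrightarrow> a i = 0"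
    by simp
  define \<delta> where "\<delta> i r = (if r = n - Suc i then 1 else 0 :: real)" for i r
  define v where "v i r = taylor_part n (\<delta> i) e r d" for i r
  define U where "U i r t = (\<Sum>q<n. v i q * b q r t)" for i r t
  have U: "solution_jet n p I (U i)" for i
    unfolding U_def[abs_def] by (rule solution_jet_sum) (rule b(1))
  have Usum: "(\<Sum>i<n. \<alpha> i * U i r t) = (\<Sum>q<n. taylor_part n (\<lambda>r. \<Sum>i<n. \<alpha> i * \<delta> i r) e q d * b q r t)" for \<alpha> r t
  proof -
    have "(\<Sum>i<n. \<alpha> i * U i r t) = (\<Sum>q<n. (\<Sum>i<n. \<alpha> i * v i q) * b q r t)"
      unfolding U_def sum_distrib_left sum_distrib_right by (subst sum.swap) (simp add: mult.assoc)
    then show ?thesis by (simp add: taylor_part_linear v_def)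
  qed
  have \<delta>sum: "(\<Sum>i<n. \<alpha> i * \<delta> i r) = \<alpha> (n - Suc r)" if "r < n" for \<alpha> r
  proof -
    have "(\<Sum>i<n. \<alpha> i * \<delta> i r) = (\<Sum>i<n. if i = n - Suc r then \<alpha> i else 0)"
      unfolding \<delta>_def using that by (intro sum.cong) auto
    then show ?thesis using that by simp
  qed
  have "wronski_property {c..d} n (\<lambda>i. U i 0)"
    unfolding wronski_property_def
  proof (intro ballI allI impI)
    fix x j \<alpha> i assume x: "x \<in> {c..d}" and j: "j \<in> {1..n}" and van: "vanishes_to_order {c..d} (\<lambda>t. \<Sum>i<j. \<alpha> i * U i 0 t) x j" and i: "i < j"
    define \<alpha>' where "\<alpha>' i = (if i < j then \<alpha> i else 0)" for i
    have "jet n {c..d} (\<lambda>r t. \<Sum>i<j. \<alpha> i * U i r t)"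
      by (rule jet_subset[OF jet_sum sub]) (use U in \<open>auto simp: solution_jet_def\<close>)
    from vanishes_jet[OF J this x, of j] van j
    have z: "(\<Sum>i<j. \<alpha> i * U i r x) = 0" if "r < j" for r using that by simp
    have e1: "(\<Sum>i<n. \<alpha>' i * U i r x) = (\<Sum>i<j. \<alpha> i * U i r x)" for r
      using j by (intro sum.mono_neutral_cong_right) (auto simp: \<alpha>'_def)
    define \<eta> where "\<eta> r = (\<Sum>i<n. \<alpha>' i * \<delta> i r)" for r
    define a where "a q = taylor_part n \<eta> e q d" for q
    have ta: "taylor_part n a d k e = \<eta> k" if "k < n" for k
      unfolding a_def using taylor_part_reexpand[of n \<eta> e d k e] taylor_part_d[OF that] by simp
    have a0: "a q = 0" if "q < n" for q
    proof (rule e[OF j x _ _ that])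
      show "taylor_part n a d k e = 0" if "k < n - j" for k
        using that ta[of k] \<delta>sum[of k \<alpha>'] by (auto simp: \<eta>_def \<alpha>'_def)
      show "(\<Sum>i<n. a i * b i r x) = 0" if "r < j" for r
        using Usum[of \<alpha>' r x] e1[of r] z[OF that] by (simp add: a_def \<eta>_def[abs_def])
    qed
    have "taylor_part n a d (n - Suc i) e = 0"
      using a0 unfolding taylor_part_def by (intro sum.neutral) auto
    then have "\<eta> (n - Suc i) = 0" using ta[of "n - Suc i"] j i by auto
    then show "\<alpha> i = 0" using \<delta>sum[of "n - Suc i" \<alpha>'] i j by (simp add: \<eta>_def \<alpha>'_def)
  qed
  moreover have "\<exists>\<alpha>. \<forall>j\<le>n. \<forall>x\<in>I. Y j x = (\<Sum>i<n. \<alpha> i * U i j x)" if Y: "solution_jet n p I Y" for Y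
  proof -
    define \<alpha> where "\<alpha> i = taylor_part n (\<lambda>r. Y r d) d (n - Suc i) e" for i
    have eta: "taylor_part n (\<lambda>r. \<Sum>i<n. \<alpha> i * \<delta> i r) e q d = Y q d" if "q < n" for q
    proof -
      have "taylor_part n (\<lambda>r. \<Sum>i<n. \<alpha> i * \<delta> i r) e q d = taylor_part n (\<lambda>r. taylor_part n (\<lambda>r. Y r d) d r e) e q d"
        unfolding taylor_part_def[of n _ e q d] using \<delta>sum[of _ \<alpha>] by (intro sum.cong) (auto simp: \<alpha>_def)
      then show ?thesis using taylor_part_reexpand taylor_part_d[OF that] by simp
    qed
    define Z where "Z j t = Y j t - (\<Sum>i<n. \<alpha> i * U i j t)" for j t
    have Z: "solution_jet n p I Z" unfolding Z_def[abs_def]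
      by (intro solution_jet_diff Y solution_jet_sum U)
    have Zd: "Z r d = 0" if "r < n" for r
      unfolding Z_def Usum using eta sol_d[OF that, of "\<lambda>q. Y q d"] by simp
    have "Z 0 t = 0" if "t \<in> I" for t
      by (rule disconjugate_zeros[OF I dis Z, where F = "{d}" and m = "\<lambda>_. n"]) (use Zd n c that in auto)
    then have "Z j t = 0" if "j \<le> n" "t \<in> I" for j t
      using jet_zero[OF I, of n Z j t] Z that by (auto simp: solution_jet_def)
    then show ?thesis unfolding Z_def by (intro exI[of _ \<alpha>]) auto
  qed
  ultimately show ?thesis using U by blast
qed

section \<open>Complementary minors and the dual flow\<close>

lemma det_two:
  fixes A :: "real mat"
  assumes A: "A \<in> carrier_mat 2 2"
  shows "det A = A $$ (0, 0) * A $$ (1, 1) - A $$ (0, 1) * A $$ (1, 0)"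
proof -
  have d: "det (mat_delete A i j) = mat_delete A i j $$ (0, 0)" for i j
    by (rule det_single) (use mat_delete_carrier[OF A] in simp)
  have "det A = (\<Sum>j<2. A $$ (0, j) * cofactor A 0 j)" by (rule laplace_expansion_row[OF A]) simp
  also have "\<dots> = A $$ (0, 0) * cofactor A 0 0 + A $$ (0, 1) * cofactor A 0 1"
    by (simp add: numeral_2_eq_2)
  also have "cofactor A 0 0 = A $$ (1, 1)"
    unfolding cofactor_def d using A by (simp add: mat_delete_def)
  also have "cofactor A 0 1 = - A $$ (1, 0)"
    unfolding cofactor_def d using A by (simp add: mat_delete_def)
  finally show ?thesis by simp
qed

text \<open>Jacobi's identity. Replacing the first \<open>k\<close> columns of \<open>N\<close> by unit vectors gives a matrix \<open>P\<close> for which both \<open>P\<close> and \<open>M P\<close> are block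
triangular, with the two minors in question as the only nontrivial diagonal blocks.\<close>

theorem complementary_minor:
  fixes M N :: "real mat"
  assumes M: "M \<in> carrier_mat n n" and N: "N \<in> carrier_mat n n" and MN: "M * N = 1\<^sub>m n" and k: "k \<le> n"
  shows "det (Matrix.mat k k (\<lambda>(i, j). M $$ (i, j))) =
    det M * det (Matrix.mat (n - k) (n - k) (\<lambda>(i, j). N $$ (i + k, j + k)))"
proof -
  let ?M1 = "Matrix.mat k k (\<lambda>(i, j). M $$ (i, j))"
  let ?M3 = "Matrix.mat (n - k) k (\<lambda>(i, j). M $$ (i + k, j))"
  let ?N2 = "Matrix.mat k (n - k) (\<lambda>(i, j). N $$ (i, j + k))"
  let ?N4 = "Matrix.mat (n - k) (n - k) (\<lambda>(i, j). N $$ (i + k, j + k))"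
  define P where "P = Matrix.mat n n (\<lambda>(l, j). if j < k then (if l = j then 1 else 0) else N $$ (l, j))"
  define Q where "Q = Matrix.mat n n (\<lambda>(i, j). if j < k then M $$ (i, j) else if i = j then 1 else 0)"
  have PQ: "P \<in> carrier_mat n n" "Q \<in> carrier_mat n n" by (simp_all add: P_def Q_def)
  have "M * P = Q"
  proof (rule eq_matI)
    fix i j assume "i < dim_row Q" "j < dim_col Q"
    then have ij: "i < n" "j < n" using PQ by auto
    have "(M * P) $$ (i, j) = (\<Sum>l<n. M $$ (i, l) * P $$ (l, j))" by (rule mult_index[OF M PQ(1) ij])
    also have "\<dots> = Q $$ (i, j)"
    proof (cases "j < k")
      case True
      have "(\<Sum>l<n. M $$ (i, l) * P $$ (l, j)) = (\<Sum>l<n. if l = j then M $$ (i, j) else 0)"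
        by (intro sum.cong) (use True ij in \<open>auto simp: P_def\<close>)
      then show ?thesis using True ij by (simp add: Q_def)
    next
      case False
      have "(\<Sum>l<n. M $$ (i, l) * P $$ (l, j)) = (\<Sum>l<n. M $$ (i, l) * N $$ (l, j))"
        by (intro sum.cong) (use False ij in \<open>auto simp: P_def\<close>)
      also have "\<dots> = (1\<^sub>m n) $$ (i, j)" unfolding MN[symmetric] by (rule mult_index[OF M N ij, symmetric])
      finally show ?thesis using False ij by (simp add: Q_def)
    qed
    finally show "(M * P) $$ (i, j) = Q $$ (i, j)" .
  qed (use M PQ in auto)
  then have "det Q = det M * det P" using det_mult[OF M PQ(1)] by simp
  moreover have "P = four_block_mat (1\<^sub>m k) ?N2 (0\<^sub>m (n - k) k) ?N4"
    by (rule eq_matI) (use k in \<open>auto simp: P_def\<close>)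
  then have "det P = det ?N4"
    using det_four_block_mat_lower_left_zero[of "1\<^sub>m k" k ?N2 "n - k" "0\<^sub>m (n - k) k" ?N4] by simp
  moreover have "Q = four_block_mat ?M1 (0\<^sub>m k (n - k)) ?M3 (1\<^sub>m (n - k))"
    by (rule eq_matI) (use k in \<open>auto simp: Q_def\<close>)
  then have "det Q = det ?M1"
    using det_four_block_mat_upper_right_zero[of ?M1 k "0\<^sub>m k (n - k)" "n - k" ?M3 "1\<^sub>m (n - k)"] by simp
  ultimately show ?thesis by simp
qed

text \<open>Steinitz exchange. The row that is added is a combination of the rows of the current matrix in which some row \<open>i \<ge> k\<close> occurs, and it
takes the place of that row; then \<open>i\<close> is swapped into position \<open>k\<close>.\<close>

theorem extend_to_invertible:
  fixes f :: "nat \<Rightarrow> nat \<Rightarrow> real"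
  assumes "k \<le> n" "\<And>c. (\<And>r. r < n \<Longrightarrow> (\<Sum>i<k. c i * f i r) = 0) \<Longrightarrow> \<forall>i<k. c i = 0"
  shows "\<exists>S R. S \<in> carrier_mat n n \<and> R \<in> carrier_mat n n \<and> S * R = 1\<^sub>m n \<and> R * S = 1\<^sub>m n \<and>
    (\<forall>i<k. \<forall>r<n. S $$ (i, r) = f i r)"
  using assms
proof (induction k)
  case 0
  show ?case by (intro exI[of _ "1\<^sub>m n"]) auto
next
  case (Suc k)
  have ind: "\<forall>i<k. c i = 0" if c: "\<And>r. r < n \<Longrightarrow> (\<Sum>i<k. c i * f i r) = 0" for c
  proof -
    have z: "(\<Sum>i<Suc k. (if i < k then c i else 0) * f i r) = 0" if "r < n" for r
      using c[OF that] by simp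
    show ?thesis
    proof (intro allI impI)
      fix i assume "i < k"
      then show "c i = 0" using Suc.prems(2)[OF z, THEN spec, of i] by simp
    qed
  qed
  have "\<exists>S R. S \<in> carrier_mat n n \<and> R \<in> carrier_mat n n \<and> S * R = 1\<^sub>m n \<and> R * S = 1\<^sub>m n \<and>
    (\<forall>i<k. \<forall>r<n. S $$ (i, r) = f i r)"
    by (rule Suc.IH[OF _ ind]) (use Suc.prems(1) in simp_all)
  then obtain S R where SR: "S \<in> carrier_mat n n" "R \<in> carrier_mat n n" "S * R = 1\<^sub>m n" "R * S = 1\<^sub>m n"
    "\<And>i r. i < k \<Longrightarrow> r < n \<Longrightarrow> S $$ (i, r) = f i r"
    by (elim exE conjE) simp
  have k: "k < n" using Suc.prems(1) by simp
  define x where "x j = (\<Sum>q<n. f k q * R $$ (q, j))" for j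
  have fx: "(\<Sum>j<n. x j * S $$ (j, r)) = f k r" if r: "r < n" for r
  proof -
    have "(\<Sum>j<n. x j * S $$ (j, r)) = (\<Sum>q<n. f k q * (\<Sum>j<n. R $$ (q, j) * S $$ (j, r)))"
      unfolding x_def sum_distrib_left sum_distrib_right by (subst sum.swap) (simp add: mult.assoc)
    also have "\<dots> = (\<Sum>q<n. f k q * (1\<^sub>m n) $$ (q, r))"
      unfolding SR(4)[symmetric] by (intro sum.cong refl) (use mult_index[OF SR(2,1)] r in auto)
    also have "\<dots> = (\<Sum>q<n. if q = r then f k r else 0)" by (intro sum.cong) (use r in auto)
    finally show ?thesis using r by simp
  qed
  have "\<exists>i. k \<le> i \<and> i < n \<and> x i \<noteq> 0"
  proof (rule ccontr)
    assume "\<not> ?thesis"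
    then have z: "x i = 0" if "k \<le> i" "i < n" for i using that by blast
    have "(\<Sum>i<Suc k. (if i < k then x i else -1) * f i r) = 0" if r: "r < n" for r
    proof -
      have "f k r = (\<Sum>j<k. x j * S $$ (j, r))"
        unfolding fx[OF r, symmetric] by (intro sum.mono_neutral_right) (use k z in auto)
      also have "\<dots> = (\<Sum>j<k. x j * f j r)" by (intro sum.cong) (use SR(5) r in auto)
      finally show ?thesis by simp
    qed
    from Suc.prems(2)[OF this] show False by force
  qed
  then obtain i where i: "k \<le> i" "i < n" "x i \<noteq> 0" by blast
  define \<tau> where "\<tau> j = (if j = i then k else if j = k then i else j)" for j
  have \<tau>: "\<tau> (\<tau> j) = j" "\<tau> j < n \<longleftrightarrow> j < n" "j < k \<Longrightarrow> \<tau> j = j" for j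
    using i k by (auto simp: \<tau>_def)
  define S' where "S' = Matrix.mat n n (\<lambda>(a, r). if a = k then f k r else S $$ (\<tau> a, r))"
  \<comment> \<open>\<open>E\<close> writes the old rows in terms of the new ones, so \<open>R * E\<close> is the new inverse.\<close>
  define E where "E = Matrix.mat n n (\<lambda>(j, b). if j = i then (if b = k then 1 / x i else - x (\<tau> b) / x i)
     else if b = \<tau> j then 1 else 0)"
  have c: "S' \<in> carrier_mat n n" "E \<in> carrier_mat n n" by (simp_all add: S'_def E_def)
  have \<tau>k: "\<tau> b = i \<longleftrightarrow> b = k" for b using i k by (auto simp: \<tau>_def)
  have "E * S' = S"
  proof (rule eq_matI)
    fix j r assume "j < dim_row S" "r < dim_col S"
    then have j: "j < n" and r: "r < n" using SR by auto
    have "(E * S') $$ (j, r) = (\<Sum>b<n. E $$ (j, b) * S' $$ (b, r))" by (rule mult_index[OF c(2,1) j r])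
    also have "\<dots> = S $$ (j, r)"
    proof (cases "j = i")
      case False
      have "(\<Sum>b<n. E $$ (j, b) * S' $$ (b, r)) = (\<Sum>b<n. if b = \<tau> j then S' $$ (\<tau> j, r) else 0)"
        by (intro sum.cong) (use False j in \<open>auto simp: E_def\<close>)
      also have "\<dots> = S' $$ (\<tau> j, r)" using j \<tau>(2) by simp
      also have "\<dots> = S $$ (j, r)" using False j r \<tau>(1)[of j] \<tau>(2)[of j] \<tau>k[of "\<tau> j"] by (auto simp: S'_def)
      finally show ?thesis .
    next
      case True
      have "(\<Sum>b<n. E $$ (i, b) * S' $$ (b, r)) = (\<Sum>b<n. (if \<tau> b = i then f k r / x i else - x (\<tau> b) / x i * S $$ (\<tau> b, r)))"
        by (intro sum.cong) (use i r \<tau>k in \<open>auto simp: E_def S'_def\<close>)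
      also have "\<dots> = (\<Sum>j<n. if j = i then f k r / x i else - x j / x i * S $$ (j, r))"
        by (rule sum.reindex_bij_witness[of _ \<tau> \<tau>]) (use \<tau> in auto)
      also have "\<dots> = (\<Sum>j<n. (if j = i then f k r / x i + S $$ (i, r) else 0) - x j / x i * S $$ (j, r))"
        by (intro sum.cong) (use i in auto)
      also have "\<dots> = f k r / x i + S $$ (i, r) - (\<Sum>j<n. x j * S $$ (j, r)) / x i"
        using i by (simp add: sum_subtractf sum_divide_distrib)
      also have "\<dots> = S $$ (i, r)" using fx[OF r] by simp
      finally show ?thesis using True by simp
    qed
    finally show "(E * S') $$ (j, r) = S $$ (j, r)" .
  qed (use SR c in auto)
  then have RE: "(R * E) * S' = 1\<^sub>m n" using SR c by (simp add: assoc_mult_mat[of _ n n _ n _ n])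
  have "S' * (R * E) = 1\<^sub>m n"
    by (rule mat_mult_left_right_inverse[OF _ _ RE]) (use SR c in auto)
  moreover have "S' $$ (a, r) = f a r" if "a < Suc k" "r < n" for a r
    using that SR(5)[of a r] \<tau>(3)[of a] k by (auto simp: S'_def less_Suc_eq)
  ultimately show ?case using RE c SR by (intro exI[of _ S'] exI[of _ "R * E"]) auto
qed

text \<open>Differentiating \<open>\<Gamma>\<^sup>-\<^sup>1 \<Gamma> = 1\<close> shows that each row of the inverse moves against the previous one. The entries of a row are obtained
from right to left by substitution, and this also shows that they are differentiable.\<close>

lemma inverse_flow:
  assumes fl: "flow n J \<rho> \<Gamma>" and K: "\<And>t. t \<in> J \<Longrightarrow> unipotent n (K t)" "\<And>t. t \<in> J \<Longrightarrow> K t * \<Gamma> t = 1\<^sub>m n"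
    and r: "1 \<le> r" "r < n"
  shows "c < n \<Longrightarrow> t \<in> J \<Longrightarrow> ((\<lambda>t. K t $$ (r, c)) has_real_derivative - \<rho> (r - 1) t * K t $$ (r - 1, c)) (at t within J)"
proof (induction "n - c" arbitrary: c t rule: less_induct)
  case less
  have G: "unipotent n (\<Gamma> t)" if "t \<in> J" for t using fl that by (simp add: flow_def)
  have prod: "(\<Sum>s<n. K t $$ (q, s) * \<Gamma> t $$ (s, j)) = (if q = j then 1 else 0)" if "t \<in> J" "q < n" "j < n" for t q j
    using mult_index[OF unipotent_carrier[OF K(1)] unipotent_carrier[OF G] that(2,3), of t t] K(2) that by simp
  have split: "(\<Sum>s\<in>{j<..<n}. K t $$ (q, s) * \<Gamma> t $$ (s, j)) = (if q = j then 1 else 0) - K t $$ (q, j)"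
    if "t \<in> J" "q < n" "j < n" for t q j
  proof -
    have "(\<Sum>s<n. K t $$ (q, s) * \<Gamma> t $$ (s, j)) = (\<Sum>s\<in>insert j {j<..<n}. K t $$ (q, s) * \<Gamma> t $$ (s, j))"
      by (intro sum.mono_neutral_right) (use that G[OF that(1)] in \<open>auto simp: unipotent_def\<close>)
    also have "\<dots> = K t $$ (q, j) + (\<Sum>s\<in>{j<..<n}. K t $$ (q, s) * \<Gamma> t $$ (s, j))"
      using G[OF that(1)] that by (simp add: unipotent_def)
    finally show ?thesis using prod[OF that] by simp
  qed
  have Kd: "((\<lambda>t. K t $$ (r, s)) has_real_derivative - \<rho> (r - 1) t * K t $$ (r - 1, s)) (at t within J)"
    if "s \<in> {c<..<n}" for s by (rule less.hyps) (use that less.prems in auto)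
  show ?case
  proof (cases "Suc c < n")
    case False
    then have e: "{c<..<n} = {}" by auto
    have v: "K t $$ (q, c) = (if q = c then 1 else 0)" if "t \<in> J" "q < n" for t q
      using split[OF that less.prems(1)] by (simp add: e)
    have "((\<lambda>t. if r = c then 1 else 0 :: real) has_real_derivative 0) (at t within J)" by simp
    then have "((\<lambda>t. K t $$ (r, c)) has_real_derivative 0) (at t within J)"
      by (rule has_field_derivative_transform_within[where d = 1]) (use less.prems v r in auto)
    moreover have "K t $$ (r - 1, c) = 0" using v[OF less.prems(2), of "r - 1"] r False by auto
    ultimately show ?thesis by simp
  next
    case True
    have Gd: "((\<lambda>t. \<Gamma> t $$ (s, c)) has_real_derivative \<rho> c t * \<Gamma> t $$ (s, Suc c)) (at t within J)" if "s \<in> {c<..<n}" for s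
      using fl less.prems True that by (simp add: flow_def)
    have "((\<lambda>t. (if r = c then 1 else 0) - (\<Sum>s\<in>{c<..<n}. K t $$ (r, s) * \<Gamma> t $$ (s, c))) has_real_derivative
       0 - (\<Sum>s\<in>{c<..<n}. (- \<rho> (r - 1) t * K t $$ (r - 1, s)) * \<Gamma> t $$ (s, c) + (\<rho> c t * \<Gamma> t $$ (s, Suc c)) * K t $$ (r, s))) (at t within J)"
      by (intro DERIV_diff DERIV_const DERIV_sum DERIV_mult Kd Gd)
    moreover have "0 - (\<Sum>s\<in>{c<..<n}. (- \<rho> (r - 1) t * K t $$ (r - 1, s)) * \<Gamma> t $$ (s, c) + (\<rho> c t * \<Gamma> t $$ (s, Suc c)) * K t $$ (r, s))
      = - \<rho> (r - 1) t * K t $$ (r - 1, c)"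
    proof -
      have "(\<Sum>s\<in>{c<..<n}. K t $$ (r, s) * \<Gamma> t $$ (s, Suc c)) = (\<Sum>s<n. K t $$ (r, s) * \<Gamma> t $$ (s, Suc c))"
        by (intro sum.mono_neutral_left) (use True G[OF less.prems(2)] in \<open>auto simp: unipotent_def\<close>)
      then have 1: "(\<Sum>s\<in>{c<..<n}. K t $$ (r, s) * \<Gamma> t $$ (s, Suc c)) = (if r = Suc c then 1 else 0)"
        using prod[OF less.prems(2) r(2) True] by simp
      have 2: "(\<Sum>s\<in>{c<..<n}. K t $$ (r - 1, s) * \<Gamma> t $$ (s, c)) = (if r = Suc c then 1 else 0) - K t $$ (r - 1, c)"
        using split[OF less.prems(2) _ less.prems(1), of "r - 1"] r by auto
      have 3: "(\<Sum>s\<in>{c<..<n}. (- \<rho> (r - 1) t * K t $$ (r - 1, s)) * \<Gamma> t $$ (s, c) + (\<rho> c t * \<Gamma> t $$ (s, Suc c)) * K t $$ (r, s))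
        = - \<rho> (r - 1) t * (\<Sum>s\<in>{c<..<n}. K t $$ (r - 1, s) * \<Gamma> t $$ (s, c)) + \<rho> c t * (\<Sum>s\<in>{c<..<n}. K t $$ (r, s) * \<Gamma> t $$ (s, Suc c))"
        unfolding sum_distrib_left sum.distrib[symmetric] by (intro sum.cong) (auto simp: mult_ac)
      show ?thesis unfolding 3 1 2 by (cases "r = Suc c") (simp_all add: algebra_simps)
    qed
    ultimately have "((\<lambda>t. (if r = c then 1 else 0) - (\<Sum>s\<in>{c<..<n}. K t $$ (r, s) * \<Gamma> t $$ (s, c))) has_real_derivative
        - \<rho> (r - 1) t * K t $$ (r - 1, c)) (at t within J)" by simp
    then show ?thesis
      by (rule has_field_derivative_transform_within[where d = 1]) (use less.prems split r in auto)
  qed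
qed

text \<open>The rows of \<open>K\<close>, in reverse order, become columns; the signs turn the minus sign of \<open>inverse_flow\<close> into a plus, and the unit
diagonal is retained.\<close>

definition dual_frame :: "nat \<Rightarrow> real mat \<Rightarrow> real mat" where
  "dual_frame n K = Matrix.mat n n (\<lambda>(r, i). (-1) ^ (r + i) * K $$ (n - 1 - i, n - 1 - r))"

lemma dual_flow:
  assumes fl: "flow n J \<rho> \<Gamma>" and K: "\<And>t. t \<in> J \<Longrightarrow> unipotent n (K t)" "\<And>t. t \<in> J \<Longrightarrow> K t * \<Gamma> t = 1\<^sub>m n"
  shows "flow n J (\<lambda>i. \<rho> (n - 2 - i)) (\<lambda>t. dual_frame n (K t))"
  unfolding flow_def
proof (intro conjI allI impI ballI)
  show "unipotent n (dual_frame n (K t))" if "t \<in> J" for t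
    using K(1)[OF that] by (auto simp: unipotent_def dual_frame_def power_add[symmetric] mult_2[symmetric])
  show "\<rho> (n - 2 - i) t > 0" if "Suc i < n" "t \<in> J" for i t using fl that by (auto simp: flow_def)
  show "continuous_on J (\<rho> (n - 2 - i))" if "Suc i < n" for i using fl that by (auto simp: flow_def)
  fix r i t assume a: "r < n" "Suc i < n" "t \<in> J"
  have "((\<lambda>t. K t $$ (n - 1 - i, n - 1 - r)) has_real_derivative
      - \<rho> (n - 1 - i - 1) t * K t $$ (n - 1 - i - 1, n - 1 - r)) (at t within J)"
    by (rule inverse_flow[OF fl K]) (use a in auto)
  from DERIV_cmult[OF this, of "(-1) ^ (r + i)"] a
  show "((\<lambda>t. dual_frame n (K t) $$ (r, i)) has_real_derivative
      \<rho> (n - 2 - i) t * dual_frame n (K t) $$ (r, Suc i)) (at t within J)"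
    by (simp add: dual_frame_def numeral_2_eq_2 mult_ac)
qed

text \<open>The leading minor of order \<open>n - 2\<close> of \<open>S H\<close> is, up to a factor, the last minor of order 2 of \<open>(S H)\<^sup>-\<^sup>1 = K R\<close>. It involves the last two columns
of \<open>R\<close> only, which after the reversal of indices make up the pair of functionals on the right.\<close>

theorem dual_wedge:
  assumes n: "2 \<le> n" and S: "S \<in> carrier_mat n n" "R \<in> carrier_mat n n" "S * R = 1\<^sub>m n" "R * S = 1\<^sub>m n"
    and H: "unipotent n H" and K: "unipotent n K" "H * K = 1\<^sub>m n"
  shows "det (Matrix.mat (n - 2) (n - 2) (\<lambda>(i, l). (S * H) $$ (i, l))) =
     det S * lead_wedge n (\<lambda>r. (-1) ^ r * R $$ (n - 1 - r, n - 2), \<lambda>r. (-1) ^ r * R $$ (n - 1 - r, n - 1)) (dual_frame n K)"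
    (is "_ = _ * lead_wedge n ?A _")
proof -
  note cH = unipotent_carrier[OF H] and cK = unipotent_carrier[OF K(1)]
  have MN: "(S * H) * (K * R) = 1\<^sub>m n"
  proof -
    have "(S * H) * (K * R) = S * ((H * K) * R)" using S cH cK
      by (simp add: assoc_mult_mat[of _ n n _ n _ n] mult_carrier_mat[of _ n n _ n])
    then show ?thesis using S K by simp
  qed
  have dSH: "det (S * H) = det S" using det_mult[OF S(1) cH] unipotent_det[OF H] by simp
  define N where "N = K * R"
  have N: "N \<in> carrier_mat n n" using cK S by (simp add: N_def)
  have st: "pairing n (\<lambda>r. (-1) ^ r * R $$ (n - 1 - r, j)) (col_fun (dual_frame n K) i) = (-1) ^ i * N $$ (n - 1 - i, j)"
    if "i < n" "j < n" for i j
  proof -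
    have "pairing n (\<lambda>r. (-1) ^ r * R $$ (n - 1 - r, j)) (col_fun (dual_frame n K) i) =
      (\<Sum>r<n. (-1) ^ i * (K $$ (n - 1 - i, n - Suc r) * R $$ (n - Suc r, j)))"
      unfolding pairing_def col_fun_def
      by (intro sum.cong refl) (use that in \<open>auto simp: dual_frame_def power_add\<close>)
    also have "\<dots> = (\<Sum>s<n. (-1) ^ i * (K $$ (n - 1 - i, s) * R $$ (s, j)))"
      by (rule sum.nat_diff_reindex)
    also have "\<dots> = (-1) ^ i * N $$ (n - 1 - i, j)"
      unfolding N_def sum_distrib_left[symmetric] using mult_index[OF cK S(2), of "n - 1 - i" j] that by simp
    finally show ?thesis .
  qed
  have "lead_wedge n ?A (dual_frame n K) = N $$ (n - 2, n - 2) * N $$ (n - 1, n - 1) - N $$ (n - 2, n - 1) * N $$ (n - 1, n - 2)"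
    using n st[of 0 "n - 2"] st[of 0 "n - 1"] st[of 1 "n - 2"] st[of 1 "n - 1"]
    by (simp add: lead_wedge_def state_def plane_image_def wedge_def numeral_2_eq_2)
  moreover have "det (Matrix.mat 2 2 (\<lambda>(i, j). N $$ (i + (n - 2), j + (n - 2)))) =
      N $$ (n - 2, n - 2) * N $$ (n - 1, n - 1) - N $$ (n - 2, n - 1) * N $$ (n - 1, n - 2)"
  proof -
    have "1 + (n - 2) = n - 1" using n by simp
    then show ?thesis by (subst det_two) auto
  qed
  moreover have "det (Matrix.mat (n - 2) (n - 2) (\<lambda>(i, l). (S * H) $$ (i, l))) =
      det (S * H) * det (Matrix.mat (n - (n - 2)) (n - (n - 2)) (\<lambda>(i, j). N $$ (i + (n - 2), j + (n - 2))))"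
    by (rule complementary_minor[OF _ N]) (use S cH MN in \<open>simp_all add: N_def\<close>)
  moreover have "n - (n - 2) = 2" using n by simp
  ultimately show ?thesis by (simp only: dSH)
qed

section \<open>Zeros of Wronskians\<close>

definition independent_pair :: "nat \<Rightarrow> (nat \<Rightarrow> real) \<times> (nat \<Rightarrow> real) \<Rightarrow> bool" where
  "independent_pair n A \<longleftrightarrow> (\<forall>\<alpha> \<beta>. (\<forall>r<n. \<alpha> * fst A r + \<beta> * snd A r = 0) \<longrightarrow> \<alpha> = 0 \<and> \<beta> = 0)"

text \<open>If all determinants vanished, the plane vectors would lie on a line through the origin, and a nontrivial combination of the two functionals would
annihilate all columns of an invertible matrix.\<close>

lemma nondegenerate_state:
  assumes H: "unipotent n H" and A: "independent_pair n A"
  shows "\<exists>a b. position n (state n A H) a b"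
proof (rule ccontr)
  assume neg: "\<not> ?thesis"
  let ?v = "state n A H"
  have w0: "wedge (?v i) (?v j) = 0" if "i < n" "j < n" for i j
    using position_exists[of i n j ?v] that neg by blast
  have "\<exists>\<alpha> \<beta>. (\<alpha> \<noteq> 0 \<or> \<beta> \<noteq> 0) \<and> (\<forall>i<n. \<alpha> * fst (?v i) + \<beta> * snd (?v i) = 0)"
  proof (cases "\<exists>j<n. ?v j \<noteq> 0")
    case True
    then obtain j where j: "j < n" "?v j \<noteq> 0" by blast
    then have "fst (?v j) \<noteq> 0 \<or> snd (?v j) \<noteq> 0" by (metis prod_eq_iff fst_zero snd_zero)
    moreover have "- snd (?v j) * fst (?v i) + fst (?v j) * snd (?v i) = 0" if "i < n" for i
      using w0[OF j(1) that] by (simp add: wedge_def)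
    ultimately show ?thesis by (intro exI[of _ "- snd (?v j)"] exI[of _ "fst (?v j)"]) auto
  next
    case False
    then show ?thesis by (intro exI[of _ 1] exI[of _ 0]) auto
  qed
  then obtain \<alpha> \<beta> where ab: "\<alpha> \<noteq> 0 \<or> \<beta> \<noteq> 0" "\<And>i. i < n \<Longrightarrow> \<alpha> * fst (?v i) + \<beta> * snd (?v i) = 0" by blast
  define h where "h r = \<alpha> * fst A r + \<beta> * snd A r" for r
  have hp: "pairing n h (col_fun H i) = 0" if "i < n" for i
    using ab(2)[OF that] that
    by (simp add: state_def plane_image_def pairing_def h_def sum_distrib_left sum.distrib[symmetric] algebra_simps)
  obtain K where K: "unipotent n K" "H * K = 1\<^sub>m n" using unipotent_inverse[OF H] by blast
  have "h r = 0" if r: "r < n" for r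
  proof -
    have "pairing n h (col_fun (H * K) r) = pairing n (\<lambda>k. pairing n h (col_fun H k)) (col_fun K r)"
      by (rule pairing_mult[OF unipotent_carrier[OF H] unipotent_carrier[OF K(1)] r])
    also have "\<dots> = 0" unfolding pairing_def[of n "\<lambda>k. pairing n h (col_fun H k)"] using hp by simp
    also have "pairing n h (col_fun (H * K) r) = (\<Sum>q<n. if q = r then h r else 0)"
      unfolding pairing_def K(2) col_fun_def by (intro sum.cong) (use r in auto)
    finally show ?thesis using r by simp
  qed
  then show False using A ab(1) unfolding independent_pair_def h_def by blast
qed

text \<open>Translates \<open>flow_zeros_bound\<close> into multiplicities: at \<open>x\<close>, the quotient of \<open>W\<close> by \<open>(t - x)\<^bsup>a+b-1\<^esup>\<close> has a nonzero limit.\<close>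

theorem flow_zero_mult_bound:
  assumes n: "n \<ge> 2" and I: "is_interval J" "J \<subseteq> I" "interior J \<noteq> {}" and fl: "flow n J \<rho> \<Gamma>" and A: "independent_pair n A"
    and F: "finite F" "F \<subseteq> J" and g: "continuous_on J g" "\<And>t. t \<in> J \<Longrightarrow> g t \<noteq> 0"
    and W: "\<And>t. t \<in> J \<Longrightarrow> W t = g t * lead_wedge n A (\<Gamma> t)"
  shows "(\<Sum>x\<in>F. zero_mult I W x) \<le> enat (2 * (n - 2))"
proof -
  have "\<exists>a b. position n (state n A (\<Gamma> x)) a b" if "x \<in> F" for x
    using nondegenerate_state[OF _ A] fl F that by (auto simp: flow_def)
  then obtain a b where ab: "\<And>x. x \<in> F \<Longrightarrow> position n (state n A (\<Gamma> x)) (a x) (b x)" by metis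
  have "zero_mult I W x \<le> enat (a x + b x - 1)" if x: "x \<in> F" for x
    unfolding zero_mult_def
  proof (rule SUP_least, rule ccontr)
    fix m assume "m \<in> {m. vanishes_to_order I W x m}" and "\<not> enat m \<le> enat (a x + b x - 1)"
    then have m: "vanishes_to_order I W x m" "a x + b x - 1 < m" by auto
    have xJ: "x \<in> J" using x F by blast
    define e where "e = a x + b x - 1"
    have "((\<lambda>t. W t / (t - x) ^ (m - 1)) \<longlongrightarrow> 0) (at x within I)"
      using m by (auto simp: vanishes_to_order_def)
    then have "((\<lambda>t. W t / (t - x) ^ (m - 1)) \<longlongrightarrow> 0) (at x within J)"
      using I(2) by (rule tendsto_within_subset)
    moreover have "((\<lambda>t. (t - x) ^ (m - 1 - e)) \<longlongrightarrow> (x - x) ^ (m - 1 - e)) (at x within J)"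
      by (intro tendsto_intros)
    ultimately have "((\<lambda>t. W t / (t - x) ^ (m - 1) * (t - x) ^ (m - 1 - e)) \<longlongrightarrow> 0 * (x - x) ^ (m - 1 - e)) (at x within J)"
      by (rule tendsto_mult)
    then have "((\<lambda>t. W t / (t - x) ^ (m - 1) * (t - x) ^ (m - 1 - e)) \<longlongrightarrow> 0) (at x within J)" by simp
    then have z: "((\<lambda>t. W t / (t - x) ^ e) \<longlongrightarrow> 0) (at x within J)"
    proof (rule Lim_transform_within[where d = 1])
      fix t assume "0 < dist t x"
      then have "t \<noteq> x" by auto
      moreover have "(t - x) ^ (m - 1) = (t - x) ^ e * (t - x) ^ (m - 1 - e)"
        using m(2) by (simp add: power_add[symmetric] e_def)
      ultimately show "W t / (t - x) ^ (m - 1) * (t - x) ^ (m - 1 - e) = W t / (t - x) ^ e" by simp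
    qed auto
    obtain C where C: "C > 0" "((\<lambda>t. lead_wedge n A (\<Gamma> t) / (t - x) ^ e) \<longlongrightarrow>
      C * wedge (state n A (\<Gamma> x) (a x)) (state n A (\<Gamma> x) (b x))) (at x within J)"
      using wedge_leading[OF I(1) xJ fl ab[OF x]] unfolding e_def by blast
    have "(g \<longlongrightarrow> g x) (at x within J)" using g(1) xJ by (simp add: continuous_on_def)
    from tendsto_mult[OF this C(2)]
    have "((\<lambda>t. W t / (t - x) ^ e) \<longlongrightarrow> g x * (C * wedge (state n A (\<Gamma> x) (a x)) (state n A (\<Gamma> x) (b x)))) (at x within J)"
      by (rule Lim_transform_within[where d = 1]) (use W in auto)
    from tendsto_unique[OF at_within_interval_nontrivial[OF I(1,3) xJ] this z]
    show False using g(2)[OF xJ] C(1) ab[OF x] by (auto simp: position_def)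
  qed
  then have "(\<Sum>x\<in>F. zero_mult I W x) \<le> (\<Sum>x\<in>F. enat (a x + b x - 1))" by (rule sum_mono)
  also have "\<dots> = enat (\<Sum>x\<in>F. a x + b x - 1)"
    using F(1) by (induction F) (auto simp: zero_enat_def)
  also have "\<dots> \<le> enat (2 * (n - 2))"
    using flow_zeros_bound[OF n I(1) fl F ab] by simp
  finally show ?thesis .
qed

lemma jet_Ck:
  assumes "jet n J Y"
  shows "r + k < n \<Longrightarrow> Ck J k (Y r)"
proof (induction k arbitrary: r)
  case 0
  then show ?case using jet_continuous[OF assms, of r] by simp
next
  case (Suc k)
  then show ?case using Suc.IH[of "Suc r"] jetD[OF assms, of r] by (auto intro!: exI[of _ "Y (Suc r)"])
qed

text \<open>The quasi-derivatives of the basis of \<open>chebyshev_basis\<close> are the columns of a flow, and the row \<open>f\<close> consists of the coordinates of \<open>Y\<close> in this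
basis, up to signs.\<close>

theorem solution_frame:
  assumes I: "is_interval I" "interior I \<noteq> {}" and p: "\<And>i. i \<in> {1..n} \<Longrightarrow> continuous_on I (p i)"
    and dis: "disconjugate n p I" and n: "0 < n" and c: "c \<in> I" "d \<in> I" "c < d"
  shows "\<exists>\<rho> \<Gamma> B. flow n {c..d} \<rho> \<Gamma> \<and>
    (\<forall>q<n. continuous_on {c..d} (B q q) \<and> (\<forall>t\<in>{c..d}. B q q t > 0) \<and> (\<forall>i>q. \<forall>t. B q i t = 0)) \<and>
    (\<forall>Y. solution_jet n p I Y \<longrightarrow>
      (\<exists>f. \<forall>q<n. \<forall>t\<in>{c..d}. Y q t = (\<Sum>i\<le>q. B q i t * pairing n f (col_fun (\<Gamma> t) i))))"
proof -
  let ?J = "{c..d}"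
  have sub: "?J \<subseteq> I" using interval_subset[OF I(1) c(1,2)] .
  have J: "is_interval ?J" "interior ?J \<noteq> {}" using c(3) by (auto simp: is_interval_cc)
  obtain U where U: "\<And>i. i < n \<Longrightarrow> solution_jet n p I (U i)" "wronski_property ?J n (\<lambda>i. U i 0)"
    "\<And>Y. solution_jet n p I Y \<Longrightarrow> \<exists>\<alpha>. \<forall>j\<le>n. \<forall>x\<in>I. Y j x = (\<Sum>i<n. \<alpha> i * U i j x)"
    using chebyshev_basis[OF I p dis n c] by blast
  have UJ: "jet n ?J (U i)" if "i < n" for i
    using U(1)[OF that] sub by (auto simp: solution_jet_def intro: jet_subset)
  have "\<exists>\<epsilon> \<rho> \<Phi>. (\<forall>j. \<epsilon> j \<in> {1, -1 :: real}) \<and>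
     (\<forall>i<n. Ck ?J (n - 1 - i) (\<rho> i) \<and> (\<forall>t\<in>?J. \<rho> i t > 0)) \<and>
     (\<forall>j<n. \<forall>t\<in>?J. \<epsilon> j * U j 0 t = \<rho> 0 t * \<Phi> 0 j t) \<and>
     (\<forall>i j. \<forall>t\<in>?J. Suc i < n \<longrightarrow> j < n \<longrightarrow> (\<Phi> i j has_real_derivative \<rho> (Suc i) t * \<Phi> (Suc i) j t) (at t within ?J)) \<and>
     (\<forall>i<n. \<forall>t. \<Phi> i i t = 1 \<and> (\<forall>j<i. \<Phi> i j t = 0))"
    by (rule quasi_derivatives[OF J(1) _ U(2)]) (rule jet_Ck[OF UJ], simp_all)
  then obtain \<epsilon> \<rho> \<Phi> where Q0: "\<forall>j. \<epsilon> j \<in> {1, -1 :: real}"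
     "\<forall>i<n. Ck ?J (n - 1 - i) (\<rho> i) \<and> (\<forall>t\<in>?J. \<rho> i t > 0)"
     "\<forall>j<n. \<forall>t\<in>?J. \<epsilon> j * U j 0 t = \<rho> 0 t * \<Phi> 0 j t"
     "\<forall>i j. \<forall>t\<in>?J. Suc i < n \<longrightarrow> j < n \<longrightarrow> (\<Phi> i j has_real_derivative \<rho> (Suc i) t * \<Phi> (Suc i) j t) (at t within ?J)"
     "\<forall>i<n. \<forall>t. \<Phi> i i t = 1 \<and> (\<forall>j<i. \<Phi> i j t = 0)"
    by (elim exE conjE)
  have Q: "\<And>i. i < n \<Longrightarrow> Ck ?J (n - 1 - i) (\<rho> i)" "\<And>i t. i < n \<Longrightarrow> t \<in> ?J \<Longrightarrow> \<rho> i t > 0" using Q0(2) by auto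
  have "\<exists>B. (\<forall>t. B 0 0 t = \<rho> 0 t) \<and> (\<forall>q\<le>n - 1. (\<forall>i. Ck ?J (n - 1 - q) (B q i)) \<and> (\<forall>t\<in>?J. B q q t > 0) \<and> (\<forall>i>q. \<forall>t. B q i t = 0)) \<and>
     (\<forall>q<n - 1. \<forall>\<phi>. (\<forall>i t. t \<in> ?J \<longrightarrow> Suc i < n \<longrightarrow> (\<phi> i has_real_derivative \<rho> (Suc i) t * \<phi> (Suc i) t) (at t within ?J)) \<longrightarrow>
       (\<forall>t\<in>?J. ((\<lambda>t. \<Sum>i\<le>q. B q i t * \<phi> i t) has_real_derivative (\<Sum>i\<le>Suc q. B (Suc q) i t * \<phi> i t)) (at t within ?J)))"
    by (rule derivatives_from_quasi_derivatives[OF Q]) (use n in simp_all)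
  then obtain B where B: "\<forall>t. B 0 0 t = \<rho> 0 t"
    "\<forall>q\<le>n - 1. (\<forall>i. Ck ?J (n - 1 - q) (B q i)) \<and> (\<forall>t\<in>?J. B q q t > 0) \<and> (\<forall>i>q. \<forall>t. B q i t = 0)"
    "\<forall>q<n - 1. \<forall>\<phi>. (\<forall>i t. t \<in> ?J \<longrightarrow> Suc i < n \<longrightarrow> (\<phi> i has_real_derivative \<rho> (Suc i) t * \<phi> (Suc i) t) (at t within ?J)) \<longrightarrow>
       (\<forall>t\<in>?J. ((\<lambda>t. \<Sum>i\<le>q. B q i t * \<phi> i t) has_real_derivative (\<Sum>i\<le>Suc q. B (Suc q) i t * \<phi> i t)) (at t within ?J))"
    by (elim exE conjE)
  define \<Gamma> where "\<Gamma> t = Matrix.mat n n (\<lambda>(r, i). \<Phi> i r t)" for t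
  have fl: "flow n ?J (\<lambda>i. \<rho> (Suc i)) \<Gamma>"
    unfolding flow_def
  proof (intro conjI allI impI ballI)
    show "unipotent n (\<Gamma> t)" for t using Q0(5) by (auto simp: unipotent_def \<Gamma>_def)
    show "\<rho> (Suc i) t > 0" if "Suc i < n" "t \<in> ?J" for i t using Q(2) that by blast
    show "continuous_on ?J (\<rho> (Suc i))" if "Suc i < n" for i using Ck_continuous[OF Q(1)[OF that]] .
    show "((\<lambda>t. \<Gamma> t $$ (r, i)) has_real_derivative \<rho> (Suc i) t * \<Gamma> t $$ (r, Suc i)) (at t within ?J)"
      if "r < n" "Suc i < n" "t \<in> ?J" for r i t
      using Q0(4) that by (simp add: \<Gamma>_def)
  qed
  have Bp: "\<forall>q<n. continuous_on ?J (B q q) \<and> (\<forall>t\<in>?J. B q q t > 0) \<and> (\<forall>i>q. \<forall>t. B q i t = 0)"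
  proof (intro allI impI)
    fix q assume "q < n"
    then have q: "q \<le> n - 1" by simp
    have b: "(\<forall>i. Ck ?J (n - 1 - q) (B q i)) \<and> (\<forall>t\<in>?J. B q q t > 0) \<and> (\<forall>i>q. \<forall>t. B q i t = 0)"
      using B(2) q by (elim allE impE)
    then have "Ck ?J (n - 1 - q) (B q q)" by (elim conjE allE)
    then show "continuous_on ?J (B q q) \<and> (\<forall>t\<in>?J. B q q t > 0) \<and> (\<forall>i>q. \<forall>t. B q i t = 0)"
      using b Ck_continuous by (elim conjE, intro conjI) assumption+
  qed
  have "\<exists>f. \<forall>q<n. \<forall>t\<in>?J. Y q t = (\<Sum>i\<le>q. B q i t * pairing n f (col_fun (\<Gamma> t) i))" if Y: "solution_jet n p I Y" for Y
  proof -
    obtain \<alpha> where \<alpha>: "\<forall>j\<le>n. \<forall>x\<in>I. Y j x = (\<Sum>i<n. \<alpha> i * U i j x)" using U(3)[OF Y] by (elim exE)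
    define f where "f r = \<alpha> r * \<epsilon> r" for r
    define \<phi> where "\<phi> i t = (\<Sum>r<n. f r * \<Phi> i r t)" for i t
    have \<phi>: "\<forall>i t. t \<in> ?J \<longrightarrow> Suc i < n \<longrightarrow> (\<phi> i has_real_derivative \<rho> (Suc i) t * \<phi> (Suc i) t) (at t within ?J)"
    proof (intro allI impI)
      fix i t assume "t \<in> ?J" "Suc i < n"
      then have "((\<lambda>t. \<Sum>r<n. f r * \<Phi> i r t) has_real_derivative (\<Sum>r<n. f r * (\<rho> (Suc i) t * \<Phi> (Suc i) r t))) (at t within ?J)"
        using Q0(4) by (intro DERIV_sum DERIV_cmult) auto
      then show "(\<phi> i has_real_derivative \<rho> (Suc i) t * \<phi> (Suc i) t) (at t within ?J)"
        by (simp add: \<phi>_def[abs_def] sum_distrib_left mult_ac)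
    qed
    have YJ: "jet n ?J Y" using Y sub by (auto simp: solution_jet_def intro: jet_subset)
    have main: "\<forall>t\<in>?J. Y q t = (\<Sum>i\<le>q. B q i t * \<phi> i t)" if "q < n" for q
      using that
    proof (induction q)
      case 0
      have "Y 0 t = \<rho> 0 t * \<phi> 0 t" if t: "t \<in> ?J" for t
      proof -
        have "\<alpha> i * U i 0 t = \<rho> 0 t * (f i * \<Phi> 0 i t)" if "i < n" for i
        proof -
          have e: "\<epsilon> i * \<epsilon> i = 1" using Q0(1)[rule_format, of i] by auto
          have "\<rho> 0 t * (f i * \<Phi> 0 i t) = \<alpha> i * \<epsilon> i * (\<rho> 0 t * \<Phi> 0 i t)" by (simp add: f_def)
          also have "\<rho> 0 t * \<Phi> 0 i t = \<epsilon> i * U i 0 t" using Q0(3) that t by simp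
          also have "\<alpha> i * \<epsilon> i * (\<epsilon> i * U i 0 t) = (\<epsilon> i * \<epsilon> i) * (\<alpha> i * U i 0 t)" by (simp only: mult_ac)
          finally show ?thesis by (simp add: e)
        qed
        moreover have "Y 0 t = (\<Sum>i<n. \<alpha> i * U i 0 t)" using \<alpha> t sub by auto
        ultimately show ?thesis by (simp add: \<phi>_def sum_distrib_left)
      qed
      then show ?case using B(1) by simp
    next
      case (Suc q)
      show ?case
      proof
        fix t assume t: "t \<in> ?J"
        have "(Y q has_real_derivative Y (Suc q) t) (at t within ?J)" using jetD[OF YJ, of q t] t Suc.prems by simp
        moreover have "q < n - 1" using Suc.prems by simp
        then have d1: "((\<lambda>t. \<Sum>i\<le>q. B q i t * \<phi> i t) has_real_derivative (\<Sum>i\<le>Suc q. B (Suc q) i t * \<phi> i t)) (at t within ?J)"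
          using B(3) \<phi> t by (simp del: sum.atMost_Suc)
        then have "(Y q has_real_derivative (\<Sum>i\<le>Suc q. B (Suc q) i t * \<phi> i t)) (at t within ?J)"
          by (rule has_field_derivative_transform_within[where d = 1]) (use t Suc in auto)
        ultimately show "Y (Suc q) t = (\<Sum>i\<le>Suc q. B (Suc q) i t * \<phi> i t)"
          using vector_derivative_within[OF at_within_interval_nontrivial[OF J t]]
          unfolding has_real_derivative_iff_has_vector_derivative by metis
      qed
    qed
    have pc: "pairing n f (col_fun (\<Gamma> t) i) = \<phi> i t" if "i < n" for i t
      unfolding pairing_def col_fun_def \<phi>_def by (intro sum.cong) (use that in \<open>auto simp: \<Gamma>_def\<close>)
    have "Y q t = (\<Sum>i\<le>q. B q i t * pairing n f (col_fun (\<Gamma> t) i))" if "q < n" "t \<in> ?J" for q t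
      using main[OF that(1)] that pc by (auto intro!: sum.cong)
    then show ?thesis by (intro exI[of _ f]) auto
  qed
  then show ?thesis using fl Bp by (intro exI[of _ "\<lambda>i. \<rho> (Suc i)"] exI[of _ \<Gamma>] exI[of _ B]) (intro conjI allI impI; simp)
qed

text \<open>The coefficient matrix of a triangular combination of columns contributes the product of its diagonal.\<close>

lemma wronskian_factor:
  fixes b P :: "nat \<Rightarrow> nat \<Rightarrow> real"
  assumes "\<And>q l. q < k \<Longrightarrow> q < l \<Longrightarrow> b q l = 0"
  shows "det (Matrix.mat k k (\<lambda>(i, q). \<Sum>l\<le>q. b q l * P i l)) = (\<Prod>q<k. b q q) * det (Matrix.mat k k (\<lambda>(i, l). P i l))"
proof -
  let ?P = "Matrix.mat k k (\<lambda>(i, l). P i l)" and ?B = "Matrix.mat k k (\<lambda>(l, q). b q l)"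
  have c: "?P \<in> carrier_mat k k" "?B \<in> carrier_mat k k" by auto
  have "Matrix.mat k k (\<lambda>(i, q). \<Sum>l\<le>q. b q l * P i l) = ?P * ?B"
  proof (rule eq_matI)
    fix i q assume "i < dim_row (?P * ?B)" "q < dim_col (?P * ?B)"
    then have iq: "i < k" "q < k" by auto
    have "(?P * ?B) $$ (i, q) = (\<Sum>l<k. P i l * b q l)" using mult_index[OF c iq] iq by simp
    also have "\<dots> = (\<Sum>l\<le>q. P i l * b q l)"
      by (intro sum.mono_neutral_right) (use iq assms in auto)
    finally show "Matrix.mat k k (\<lambda>(i, q). \<Sum>l\<le>q. b q l * P i l) $$ (i, q) = (?P * ?B) $$ (i, q)"
      using iq by (simp add: mult.commute)
  qed auto
  moreover have "det ?B = (\<Prod>q<k. b q q)"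
  proof -
    have "det ?B = prod_list (diag_mat ?B)"
      by (rule det_upper_triangular[OF _ c(2)]) (use assms in \<open>auto intro!: upper_triangularI\<close>)
    also have "\<dots> = (\<Prod>q<k. b q q)" unfolding prod_list_diag_prod by (auto simp: lessThan_atLeast0 intro!: prod.cong)
    finally show ?thesis .
  qed
  ultimately show ?thesis using det_mult[OF c] by simp
qed

text \<open>A combination of the coordinate rows that vanishes yields a combination of the solutions with vanishing Taylor data at \<open>d\<close>. By disconjugacy, it
vanishes on all of \<open>I\<close>, beyond the segment on which the coordinates are defined.\<close>

lemma coordinates_independent:
  assumes I: "is_interval I" "interior I \<noteq> {}" and dis: "disconjugate n p I" and n: "0 < n" and c: "c \<in> I" "d \<in> I" "c < d"
    and Y: "\<And>i. i < k \<Longrightarrow> solution_jet n p I (Y i)" and ind: "lin_indep_on I k (\<lambda>i. Y i 0)"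
    and f: "\<And>i q t. i < k \<Longrightarrow> q < n \<Longrightarrow> t \<in> {c..d} \<Longrightarrow> Y i q t = (\<Sum>l\<le>q. b q l t * pairing n (f i) (col_fun (G t) l))"
    and z: "\<And>r. r < n \<Longrightarrow> (\<Sum>i<k. a i * f i r) = 0"
  shows "\<forall>i<k. a i = 0"
proof -
  define Z where "Z q t = (\<Sum>i<k. a i * Y i q t)" for q t
  have Z: "solution_jet n p I Z" unfolding Z_def[abs_def] by (rule solution_jet_sum) (use Y in simp)
  have pz: "(\<Sum>i<k. a i * pairing n (f i) g) = 0" for g
  proof -
    have "(\<Sum>i<k. a i * pairing n (f i) g) = (\<Sum>r<n. (\<Sum>i<k. a i * f i r) * g r)"
      unfolding pairing_def sum_distrib_left sum_distrib_right by (subst sum.swap) (simp add: mult.assoc)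
    then show ?thesis using z by simp
  qed
  have Zd: "Z q d = 0" if "q < n" for q
  proof -
    have "Z q d = (\<Sum>i<k. a i * (\<Sum>l\<le>q. b q l d * pairing n (f i) (col_fun (G d) l)))"
      unfolding Z_def using f that c by (intro sum.cong) auto
    also have "\<dots> = (\<Sum>l\<le>q. b q l d * (\<Sum>i<k. a i * pairing n (f i) (col_fun (G d) l)))"
      unfolding sum_distrib_left by (subst sum.swap) (simp add: mult_ac)
    finally show ?thesis using pz by simp
  qed
  have "Z 0 t = 0" if "t \<in> I" for t
    by (rule disconjugate_zeros[OF I dis Z, where F = "{d}" and m = "\<lambda>_. n"]) (use Zd n c that in auto)
  then show ?thesis using ind unfolding lin_indep_on_def Z_def by blast
qed

lemma wronskian_zeros_on_segment:
  assumes n: "n \<ge> 3" and k: "k = 2 \<or> k = n - 2" and I: "is_interval I" "interior I \<noteq> {}"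
    and p: "\<And>i. i \<in> {1..n} \<Longrightarrow> continuous_on I (p i)" and dis: "disconjugate n p I"
    and y: "\<And>i. i < k \<Longrightarrow> is_solution n p I (y i)" and ind: "lin_indep_on I k y"
    and c: "c \<in> I" "d \<in> I" "c < d" and F: "finite F" "F \<subseteq> {c..d}"
  shows "(\<Sum>x\<in>F. zero_mult I (\<lambda>x. det (wronskian_matrix I k y x)) x) \<le> enat (2 * (n - 2))"
proof -
  let ?J = "{c..d}"
  have sub: "?J \<subseteq> I" using interval_subset[OF I(1) c(1,2)] .
  have J: "is_interval ?J" "interior ?J \<noteq> {}" using c(3) by (auto simp: is_interval_cc)
  have n0: "0 < n" using n by simp
  have "\<exists>\<rho> \<Gamma> B. flow n ?J \<rho> \<Gamma> \<and>
    (\<forall>q<n. continuous_on ?J (B q q) \<and> (\<forall>t\<in>?J. B q q t > 0) \<and> (\<forall>i>q. \<forall>t. B q i t = 0)) \<and>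
    (\<forall>Y. solution_jet n p I Y \<longrightarrow>
      (\<exists>f. \<forall>q<n. \<forall>t\<in>?J. Y q t = (\<Sum>i\<le>q. B q i t * pairing n f (col_fun (\<Gamma> t) i))))"
    by (rule solution_frame[OF I p dis n0 c])
  then obtain \<rho> \<Gamma> B where fl: "flow n ?J \<rho> \<Gamma>"
    and B: "\<forall>q<n. continuous_on ?J (B q q) \<and> (\<forall>t\<in>?J. B q q t > 0) \<and> (\<forall>i>q. \<forall>t. B q i t = 0)"
    and coord: "\<forall>Y. solution_jet n p I Y \<longrightarrow>
      (\<exists>f. \<forall>q<n. \<forall>t\<in>?J. Y q t = (\<Sum>i\<le>q. B q i t * pairing n f (col_fun (\<Gamma> t) i)))"
    by (elim exE conjE)
  define Y where "Y i q = iter_deriv I q (y i)" for i q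
  have Y: "solution_jet n p I (Y i)" if "i < k" for i
    unfolding Y_def using solution_jet_iter_deriv[OF I y[OF that]] .
  have "\<forall>i. \<exists>f. i < k \<longrightarrow> (\<forall>q<n. \<forall>t\<in>?J. Y i q t = (\<Sum>l\<le>q. B q l t * pairing n f (col_fun (\<Gamma> t) l)))"
    using coord Y by blast
  from choice[OF this] obtain f where f: "\<And>i q t. i < k \<Longrightarrow> q < n \<Longrightarrow> t \<in> ?J \<Longrightarrow> Y i q t = (\<Sum>l\<le>q. B q l t * pairing n (f i) (col_fun (\<Gamma> t) l))"
    by blast
  have kn: "k \<le> n" using k n by auto
  have "lin_indep_on I k (\<lambda>i. Y i 0)" using ind by (simp add: Y_def)
  have indep: "\<forall>i<k. a i = 0" if "\<And>r. r < n \<Longrightarrow> (\<Sum>i<k. a i * f i r) = 0" for a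
    by (rule coordinates_independent[OF I dis n0 c Y \<open>lin_indep_on I k (\<lambda>i. Y i 0)\<close> f that])
  define g where "g t = (\<Prod>q<k. B q q t)" for t
  have gc: "continuous_on ?J g" unfolding g_def[abs_def] by (intro continuous_on_prod) (use B kn in auto)
  have g0: "g t > 0" if "t \<in> ?J" for t unfolding g_def by (intro prod_pos) (use B kn that in auto)
  have W: "det (wronskian_matrix I k y t) = g t * det (Matrix.mat k k (\<lambda>(i, l). pairing n (f i) (col_fun (\<Gamma> t) l)))"
    if t: "t \<in> ?J" for t
  proof -
    have "wronskian_matrix I k y t = Matrix.mat k k (\<lambda>(i, q). \<Sum>l\<le>q. B q l t * pairing n (f i) (col_fun (\<Gamma> t) l))"
      unfolding wronskian_matrix_def by (rule eq_matI) (use f[OF _ _ t] kn in \<open>auto simp: Y_def\<close>)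
    then show ?thesis unfolding g_def using wronskian_factor[of k "\<lambda>q l. B q l t"] B kn by simp
  qed
  have unipotent: "unipotent n (\<Gamma> t)" if "t \<in> ?J" for t using fl that by (simp add: flow_def)
  show ?thesis
  proof (cases "k = 2")
    case True
    have A: "independent_pair n (f 0, f 1)"
      unfolding independent_pair_def
    proof (intro allI impI)
      fix \<alpha> \<beta> assume "\<forall>r<n. \<alpha> * fst (f 0, f 1) r + \<beta> * snd (f 0, f 1) r = 0"
      then have "(\<Sum>i<k. (if i = 0 then \<alpha> else \<beta>) * f i r) = 0" if "r < n" for r
        using that by (simp add: True numeral_2_eq_2)
      from indep[OF this] have "\<forall>i<k. (if i = 0 then \<alpha> else \<beta>) = 0" by blast
      from this[rule_format, of 0] this[rule_format, of 1] show "\<alpha> = 0 \<and> \<beta> = 0" by (simp add: True)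
    qed
    have "det (wronskian_matrix I k y t) = g t * lead_wedge n (f 0, f 1) (\<Gamma> t)" if "t \<in> ?J" for t
      unfolding W[OF that] unfolding True using n
      by (subst det_two) (auto simp: lead_wedge_def state_def plane_image_def wedge_def)
    then show ?thesis
      by (intro flow_zero_mult_bound[OF _ J(1) sub J(2) fl A F gc]) (use n g0 in fastforce)+
  next
    case False
    then have k2: "k = n - 2" using k by simp
    have "\<exists>S R. S \<in> carrier_mat n n \<and> R \<in> carrier_mat n n \<and> S * R = 1\<^sub>m n \<and> R * S = 1\<^sub>m n \<and>
      (\<forall>i<k. \<forall>r<n. S $$ (i, r) = f i r)"
      by (rule extend_to_invertible[OF kn]) (rule indep)
    then obtain S R where S: "S \<in> carrier_mat n n" "R \<in> carrier_mat n n" "S * R = 1\<^sub>m n" "R * S = 1\<^sub>m n"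
      and Sf: "\<forall>i<k. \<forall>r<n. S $$ (i, r) = f i r" by (elim exE conjE)
    let ?A = "(\<lambda>r. (-1) ^ r * R $$ (n - 1 - r, n - 2), \<lambda>r. (-1) ^ r * R $$ (n - 1 - r, n - 1))"
    have dS: "det S \<noteq> 0"
    proof
      assume "det S = 0"
      then show False using det_mult[OF S(1,2)] S(3) by simp
    qed
    have "\<forall>t. \<exists>K. t \<in> ?J \<longrightarrow> unipotent n K \<and> \<Gamma> t * K = 1\<^sub>m n \<and> K * \<Gamma> t = 1\<^sub>m n"
      using unipotent_inverse unipotent by blast
    from choice[OF this] obtain K where K: "\<And>t. t \<in> ?J \<Longrightarrow> unipotent n (K t)" "\<And>t. t \<in> ?J \<Longrightarrow> \<Gamma> t * K t = 1\<^sub>m n"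
      "\<And>t. t \<in> ?J \<Longrightarrow> K t * \<Gamma> t = 1\<^sub>m n" by blast
    have A: "independent_pair n ?A"
      unfolding independent_pair_def
    proof (intro allI impI)
      fix \<alpha> \<beta> assume z: "\<forall>r<n. \<alpha> * fst ?A r + \<beta> * snd ?A r = 0"
      have z': "\<alpha> * R $$ (s, n - 2) + \<beta> * R $$ (s, n - 1) = 0" if "s < n" for s
      proof -
        have "n - 1 - s < n" "n - 1 - (n - 1 - s) = s" using that by auto
        then have "(-1) ^ (n - 1 - s) * (\<alpha> * R $$ (s, n - 2) + \<beta> * R $$ (s, n - 1)) = 0"
          using z[rule_format, of "n - 1 - s"] by (simp add: distrib_left mult_ac)
        then show ?thesis by simp
      qed
      have "\<alpha> * (1\<^sub>m n) $$ (i, n - 2) + \<beta> * (1\<^sub>m n) $$ (i, n - 1) = 0" if "i < n" for i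
      proof -
        have "\<alpha> * (1\<^sub>m n) $$ (i, n - 2) + \<beta> * (1\<^sub>m n) $$ (i, n - 1) =
          (\<Sum>s<n. S $$ (i, s) * (\<alpha> * R $$ (s, n - 2) + \<beta> * R $$ (s, n - 1)))"
          unfolding S(3)[symmetric] using mult_index[OF S(1,2) that] n
          by (simp add: sum_distrib_left sum.distrib[symmetric] distrib_left mult_ac)
        then show ?thesis using z' by simp
      qed
      from this[of "n - 2"] this[of "n - 1"] show "\<alpha> = 0 \<and> \<beta> = 0"
        using n by (auto split: if_splits)
    qed
    have "det (wronskian_matrix I k y t) = g t * det S * lead_wedge n ?A (dual_frame n (K t))" if t: "t \<in> ?J" for t
    proof -
      have "Matrix.mat k k (\<lambda>(i, l). pairing n (f i) (col_fun (\<Gamma> t) l)) = Matrix.mat (n - 2) (n - 2) (\<lambda>(i, l). (S * \<Gamma> t) $$ (i, l))"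
      proof (rule eq_matI)
        fix i l assume "i < dim_row (Matrix.mat (n - 2) (n - 2) (\<lambda>(i, l). (S * \<Gamma> t) $$ (i, l)))"
          "l < dim_col (Matrix.mat (n - 2) (n - 2) (\<lambda>(i, l). (S * \<Gamma> t) $$ (i, l)))"
        then have il: "i < k" "l < k" "i < n" "l < n" using k2 kn by auto
        have "(S * \<Gamma> t) $$ (i, l) = (\<Sum>r<n. S $$ (i, r) * \<Gamma> t $$ (r, l))"
          by (rule mult_index[OF S(1) unipotent_carrier[OF unipotent[OF t]] il(3,4)])
        also have "\<dots> = pairing n (f i) (col_fun (\<Gamma> t) l)"
          unfolding pairing_def col_fun_def using Sf il(1) by (intro sum.cong) auto
        finally show "Matrix.mat k k (\<lambda>(i, l). pairing n (f i) (col_fun (\<Gamma> t) l)) $$ (i, l) =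
          Matrix.mat (n - 2) (n - 2) (\<lambda>(i, l). (S * \<Gamma> t) $$ (i, l)) $$ (i, l)" using il k2 by simp
      qed (use k2 in auto)
      moreover have "2 \<le> n" using n by simp
      ultimately show ?thesis
        unfolding W[OF t] using dual_wedge[OF _ S unipotent[OF t] K(1,2)[OF t]] by (simp only: mult.assoc)
    qed
    moreover have "flow n ?J (\<lambda>i. \<rho> (n - 2 - i)) (\<lambda>t. dual_frame n (K t))"
      by (rule dual_flow[OF fl K(1,3)])
    moreover have "continuous_on ?J (\<lambda>t. g t * det S)" by (intro continuous_on_mult gc continuous_on_const)
    moreover have "g t * det S \<noteq> 0" if "t \<in> ?J" for t using g0[OF that] dS by simp
    moreover have "2 \<le> n" using n by simp
    ultimately show ?thesis using A
      by (intro flow_zero_mult_bound[where J = ?J and g = "\<lambda>t. g t * det S" and n = n] J sub F) blast+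
  qed
qed

theorem theorem1:
  fixes n k :: nat and I :: "real set"
    and p :: "nat \<Rightarrow> real \<Rightarrow> real" and y :: "nat \<Rightarrow> real \<Rightarrow> real"
  assumes "n \<ge> 3" and "k = 2 \<or> k = n - 2"
    and "is_interval I" and "interior I \<noteq> {}" and "open I \<or> closed I"
    and "\<forall>i\<in>{1..n}. continuous_on I (p i)"
    and "disconjugate n p I"
    and "\<forall>i<k. is_solution n p I (y i)"
    and "lin_indep_on I k y"
  shows "zero_count I (\<lambda>x. det (wronskian_matrix I k y x)) \<le> enat (k * (n - k))"
proof -
  have kk: "k * (n - k) = 2 * (n - 2)" using assms(1,2) by auto
  obtain u v where uv: "u \<in> I" "v \<in> I" "u < v"
  proof -
    obtain x where "x \<in> interior I" using assms(4) by blast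
    then obtain e where "e > 0" "cball x e \<subseteq> I" by (auto simp: mem_interior_cball)
    moreover have "x \<in> cball x e" "x + e \<in> cball x e" using \<open>e > 0\<close> by (auto simp: dist_real_def)
    ultimately have "x \<in> I" "x + e \<in> I" "x < x + e" by auto
    then show ?thesis by (rule that)
  qed
  show ?thesis
    unfolding kk zero_count_def
  proof (rule SUP_least)
    fix F assume "F \<in> {F. finite F \<and> F \<subseteq> I}"
    then have F: "finite F" "F \<subseteq> I" by auto
    \<comment> \<open>The two additional points make the segment nondegenerate.\<close>
    let ?G = "insert u (insert v F)"
    have G: "finite ?G" "?G \<noteq> {}" "?G \<subseteq> I" using F uv by auto
    have "Min ?G \<in> I" "Max ?G \<in> I" using Min_in[OF G(1,2)] Max_in[OF G(1,2)] G(3) by blast+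
    moreover have "Min ?G \<le> u" "v \<le> Max ?G" by (rule Min_le[OF G(1)], simp) (rule Max_ge[OF G(1)], simp)
    then have "Min ?G < Max ?G" using uv(3) by linarith
    moreover have "F \<subseteq> {Min ?G..Max ?G}"
    proof
      fix x assume "x \<in> F"
      then have "x \<in> ?G" by simp
      then show "x \<in> {Min ?G..Max ?G}" using Min_le[OF G(1)] Max_ge[OF G(1)] by simp
    qed
    ultimately show "(\<Sum>x\<in>F. zero_mult I (\<lambda>x. det (wronskian_matrix I k y x)) x) \<le> enat (2 * (n - 2))"
      using assms F(1) by (intro wronskian_zeros_on_segment[where p = p and c = "Min ?G" and d = "Max ?G"]) auto
  qed
qed

end
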